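(* If $X$ is a separable Banach space not containing an isomorphic copy of $\ell^1$, then there exists a unique ordinal $\xi<\omega_1$ such that: (i) for all ordinals $\zeta$ with $\xi\le\zeta<\omega_1$ the space $X$ has the weak $\zeta$-Banach–Saks property; (ii) for every $\zeta<\xi$ the space $X$ fails the weak $\zeta$-Banach–Saks property.
   Context: Notation: $\mathbb N=\{1,2,\dots\}$. For an infinite $N\subset\mathbb N$, $[N]$ is the set of all infinite subsets of $N$. $(e_n)$ is the unit vector basis of $\ell^1(\mathbb N)$. For each (nonzero) countable limit ordinal $\xi$ fix once and for all a strictly increasing sequence $(\xi_n)_{n\in\mathbb N}$ of successor ordinals with $\sup_n\xi_n=\xi$. Repeated Averages (RA) Hierarchy: for $M\in[\mathbb N]$ and $\xi<\omega_1$ one defines a sequence $(\xi^M_n)_{n\in\mathbb N}$ of finitely supported elements of the positive part $S^+_{\ell^1}$ of the unit sphere of $\ell^1(\mathbb N)$ (with successive supports whose union is $M$) by induction on $\xi$. (i) $0^M_n=e_{m_n}$ where $m_1<m_2<\cdots$ enumerates $M$. (ii) If $\xi=\zeta+1$: put $k_1=0$, $s_1=\min\operatorname{supp}\zeta^M_1$, and for $n\ge2$ put $k_n=k_{n-1}+s_{n-1}$, $s_n=\min\operatorname{supp}\zeta^M_{k_n+1}$; then $\xi^M_n=\frac1{s_n}\left(\zeta^M_{k_n+1}+\cdots+\zeta^M_{k_n+s_n}\right)$. (iii) If $\xi$ is a limit ordinal with fixed sequence $(\xi_n)$: put $M_1=M$, $n_1=\min M_1$, and inductively $M_{k+1}=M_k\setminus\operatorname{supp}(\xi_{n_k})^{M_k}_1$,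 $n_{k+1}=\min M_{k+1}$; then $\xi^M_k=(\xi_{n_k})^{M_k}_1$. Summability: for a bounded sequence $H=(x_n)$ in $X$ and $A=(a_n)\in S^+_{\ell^1}$ put $A\cdot H=\sum_na_nx_n$. $H$ is $(M,\xi)$ summable if $(\xi^M_n\cdot H)_{n\in\mathbb N}$ is Cesàro summable, i.e. $\frac1n\sum_{k=1}^n\xi^M_k\cdot H$ converges in norm as $n\to\infty$. $X$ has the weak $\xi$-Banach–Saks property (w $\xi$-BS) if for every weakly convergent sequence $(x_n)_{n\in\mathbb N}$ in $X$ there exists $L\in[\mathbb N]$ such that $(x_n)_{n\in\mathbb N}$ is $(L,\xi)$ summable. *)

theory Defs
  imports "HOL-Analysis.Analysis"
begin

section \<open>The countable ordinals\<close>

text \<open>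
  The ordinals below $\omega_1$, carried by the successor cardinal of \<^const>\<open>natLeq\<close>. The lemmas
  \<open>uncountable_omega1\<close> and \<open>countable_lessThan_omega1\<close> characterise this well-order up to isomorphism.
\<close>

typedef omega1 = "Field (cardSuc natLeq)"
proof -
  have "Field (cardSuc natLeq) \<noteq> {}"
    using natLeq_Card_order Field_natLeq by (simp add: Field_cardSuc_not_empty)
  then show ?thesis by blast
qed

lemma Well_order_cardSuc_natLeq: "Well_order (cardSuc natLeq)"
  using cardSuc_Card_order[OF natLeq_Card_order] by (simp add: card_order_on_def)

instantiation omega1 :: linorder
begin

definition less_eq_omega1 :: "omega1 \<Rightarrow> omega1 \<Rightarrow> bool" where
  "x \<le> y \<longleftrightarrow> (Rep_omega1 x, Rep_omega1 y) \<in> cardSuc natLeq"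

definition less_omega1 :: "omega1 \<Rightarrow> omega1 \<Rightarrow> bool" where
  "x < y \<longleftrightarrow> x \<le> y \<and> \<not> y \<le> (x :: omega1)"

instance
proof
  have "Linear_order (cardSuc natLeq)"
    using Well_order_cardSuc_natLeq by (simp add: well_order_on_def)
  then have R: "Refl (cardSuc natLeq)" and T: "trans (cardSuc natLeq)"
    and A: "antisym (cardSuc natLeq)" and Tot: "Total (cardSuc natLeq)"
    by (auto simp: linear_order_on_def partial_order_on_def preorder_on_def)
  fix x y z :: omega1
  show "x < y \<longleftrightarrow> x \<le> y \<and> \<not> y \<le> x" by (rule less_omega1_def)
  show "x \<le> x"
    using R Rep_omega1[of x] by (auto simp: less_eq_omega1_def refl_on_def)
  show "x \<le> y \<Longrightarrow> y \<le> z \<Longrightarrow> x \<le> z"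
    using T by (auto simp: less_eq_omega1_def dest: transD)
  show "x \<le> y \<Longrightarrow> y \<le> x \<Longrightarrow> x = y"
    using A by (auto simp: less_eq_omega1_def Rep_omega1_inject dest: antisymD)
  show "x \<le> y \<or> y \<le> x"
    using Tot R Rep_omega1[of x] Rep_omega1[of y]
    by (cases "x = y") (auto simp: less_eq_omega1_def total_on_def Rep_omega1_inject refl_on_def)
qed

end

lemma less_omega1_iff:
  "x < y \<longleftrightarrow> (Rep_omega1 x, Rep_omega1 y) \<in> cardSuc natLeq - Id"
  unfolding less_le less_eq_omega1_def by (auto simp: Rep_omega1_inject)

instance omega1 :: wellorder
proof (rule wf_wellorderI)
  have "wf (cardSuc natLeq - Id)"
    using Well_order_cardSuc_natLeq by (simp add: well_order_on_def)
  then have "wf (inv_image (cardSuc natLeq - Id) Rep_omega1)"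
    by (rule wf_inv_image)
  also have "inv_image (cardSuc natLeq - Id) Rep_omega1 = {(x, y). x < y}"
    by (auto simp: less_omega1_iff inv_image_def)
  finally show "wf {(x :: omega1, y). x < y}" .
qed standard

lemma uncountable_omega1:
  includes cardinal_syntax
  shows "uncountable (UNIV :: omega1 set)"
proof
  assume "countable (UNIV :: omega1 set)"
  then have "countable (range Rep_omega1)" by (rule countable_image)
  then have "countable (Field (cardSuc natLeq))"
    using type_definition.Rep_range[OF type_definition_omega1] by simp
  then have "|Field (cardSuc natLeq)| \<le>o |UNIV :: nat set|"
    unfolding countable_def by (auto simp: card_of_ordLeq[symmetric])
  moreover have "|Field (cardSuc natLeq)| =o cardSuc natLeq"
    by (rule card_of_Field_ordIso[OF cardSuc_Card_order[OF natLeq_Card_order]])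
  ultimately have "cardSuc natLeq \<le>o |UNIV :: nat set|"
    by (metis ordIso_symmetric ordIso_ordLeq_trans)
  then have "cardSuc natLeq \<le>o natLeq"
    using card_of_nat ordLeq_ordIso_trans by blast
  then show False
    using cardSuc_greater[OF natLeq_Card_order] not_ordLess_ordLeq by blast
qed

lemma countable_lessThan_omega1:
  includes cardinal_syntax
  shows "countable {..<x :: omega1}"
proof -
  have "|underS (cardSuc natLeq) (Rep_omega1 x)| <o cardSuc natLeq"
    by (rule card_of_underS[OF cardSuc_Card_order[OF natLeq_Card_order] Rep_omega1])
  then have "|underS (cardSuc natLeq) (Rep_omega1 x)| \<le>o natLeq"
    using cardSuc_ordLeq_ordLess[OF natLeq_Card_order card_of_Card_order] by blast
  then have "|underS (cardSuc natLeq) (Rep_omega1 x)| \<le>o |UNIV :: nat set|"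
    using card_of_nat ordIso_symmetric ordLeq_ordIso_trans by blast
  then have "countable (underS (cardSuc natLeq) (Rep_omega1 x))"
    unfolding countable_def by (auto simp: card_of_ordLeq[symmetric])
  moreover have "Rep_omega1 ` {..<x} \<subseteq> underS (cardSuc natLeq) (Rep_omega1 x)"
    by (auto simp: less_omega1_iff underS_def)
  ultimately have "countable (Rep_omega1 ` {..<x})"
    using countable_subset by blast
  then show ?thesis
    by (rule countable_image_inj_on) (simp add: inj_on_def Rep_omega1_inject)
qed

lemma ex_greater_omega1: "\<exists>y. x < (y :: omega1)"
proof (rule ccontr)
  assume "\<nexists>y. x < y"
  then have "UNIV = insert x {..<x}" by (auto simp: not_less order.order_iff_strict)
  then have "countable (UNIV :: omega1 set)"
    by (metis countable_insert countable_lessThan_omega1)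
  then show False using uncountable_omega1 by simp
qed

instantiation omega1 :: zero
begin
definition zero_omega1 :: omega1 where "0 = (LEAST x :: omega1. True)"
instance ..
end

lemma zero_le_omega1 [simp]: "0 \<le> (x :: omega1)"
  unfolding zero_omega1_def by (rule Least_le) simp

definition osucc :: "omega1 \<Rightarrow> omega1" where
  "osucc x = (LEAST y. x < y)"

definition is_succ :: "omega1 \<Rightarrow> bool" where
  "is_succ x \<longleftrightarrow> (\<exists>y. x = osucc y)"

definition is_limit :: "omega1 \<Rightarrow> bool" where
  "is_limit x \<longleftrightarrow> x \<noteq> 0 \<and> \<not> is_succ x"

definition opred :: "omega1 \<Rightarrow> omega1" where
  "opred x = (THE y. x = osucc y)"

lemma less_osucc [simp]: "x < osucc x"
  unfolding osucc_def using ex_greater_omega1 by (rule LeastI_ex)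

lemma osucc_le_iff: "osucc x \<le> y \<longleftrightarrow> x < y"
  by (metis less_osucc osucc_def Least_le order.strict_trans2)

lemma osucc_inject [simp]: "osucc x = osucc y \<longleftrightarrow> x = y"
  by (metis less_osucc osucc_le_iff linorder_neqE order.refl not_less)

lemma opred_osucc [simp]: "opred (osucc x) = x"
  by (simp add: opred_def)

lemma osucc_neq_zero [simp]: "osucc x \<noteq> 0"
  by (metis less_osucc zero_le_omega1 not_less)


section \<open>The repeated averages hierarchy\<close>

text \<open>
  The choice, for every countable limit ordinal, of a strictly increasing sequence of successor
  ordinals converging to it. These sequences are indexed by the positive integers; the last
  conjunct says that \<open>\<xi>\<close> is the least upper bound of the sequence.
\<close>

definition limit_sequences :: "(omega1 \<Rightarrow> nat \<Rightarrow> omega1) \<Rightarrow> bool" where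
  "limit_sequences \<phi> \<longleftrightarrow>
     (\<forall>\<xi>. is_limit \<xi> \<longrightarrow>
        strict_mono_on {1..} (\<phi> \<xi>) \<and>
        (\<forall>n\<ge>1. is_succ (\<phi> \<xi> n)) \<and>
        (\<forall>\<eta>. (\<forall>n\<ge>1. \<phi> \<xi> n \<le> \<eta>) \<longleftrightarrow> \<xi> \<le> \<eta>))"

lemma limit_sequences_less:
  assumes "limit_sequences \<phi>" "is_limit \<xi>" "n \<ge> 1"
  shows "\<phi> \<xi> n < \<xi>"
proof -
  have "\<phi> \<xi> n < \<phi> \<xi> (Suc n)"
    using assms by (auto simp: limit_sequences_def strict_mono_on_def)
  also have "\<phi> \<xi> (Suc n) \<le> \<xi>"
    using assms by (metis le_SucI limit_sequences_def order.refl)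
  finally show ?thesis .
qed

text \<open>
  Sets \<open>M\<close> are sets of positive integers, but the terms of each sequence $\xi^M_1, \xi^M_2, \dots$
  are numbered from \<open>0\<close>, so that \<open>repeated_average \<phi> \<xi> M n\<close> below is $\xi^M_{n+1}$.
  Elements of $\ell^1$ are functions \<open>nat \<Rightarrow> real\<close>.
\<close>

definition supp :: "(nat \<Rightarrow> real) \<Rightarrow> nat set" where
  "supp a = {i. a i \<noteq> 0}"

text \<open>
  For the sequence \<open>A\<close> of $\zeta$-averages, \<open>block_start A n\<close> is $k_{n+1}$ and \<open>block_length A n\<close>
  is $s_{n+1}$. On \<^typ>\<open>nat\<close>, \<^const>\<open>Inf\<close> of a nonempty set is its minimum.
\<close>

primrec block_start :: "(nat \<Rightarrow> nat \<Rightarrow> real) \<Rightarrow> nat \<Rightarrow> nat" where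
  "block_start A 0 = 0"
| "block_start A (Suc n) = block_start A n + Inf (supp (A (block_start A n)))"

definition block_length :: "(nat \<Rightarrow> nat \<Rightarrow> real) \<Rightarrow> nat \<Rightarrow> nat" where
  "block_length A n = Inf (supp (A (block_start A n)))"

definition succ_average :: "(nat \<Rightarrow> nat \<Rightarrow> real) \<Rightarrow> nat \<Rightarrow> nat \<Rightarrow> real" where
  "succ_average A n =
     (\<lambda>i. (1 / real (block_length A n)) * (\<Sum>j<block_length A n. A (block_start A n + j) i))"

text \<open>
  In the limit step \<open>F m M\<close> is the first $\xi_m$-average of \<open>M\<close>, and \<open>limit_set F M k\<close>
  is $M_{k+1}$.
\<close>

primrec limit_set :: "(nat \<Rightarrow> nat set \<Rightarrow> nat \<Rightarrow> real) \<Rightarrow> nat set \<Rightarrow> nat \<Rightarrow> nat set" where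
  "limit_set F M 0 = M"
| "limit_set F M (Suc k) = limit_set F M k - supp (F (Inf (limit_set F M k)) (limit_set F M k))"

definition limit_average ::
    "(nat \<Rightarrow> nat set \<Rightarrow> nat \<Rightarrow> real) \<Rightarrow> nat set \<Rightarrow> nat \<Rightarrow> nat \<Rightarrow> real" where
  "limit_average F M k = F (Inf (limit_set F M k)) (limit_set F M k)"

definition repeated_average ::
    "(omega1 \<Rightarrow> nat \<Rightarrow> omega1) \<Rightarrow> omega1 \<Rightarrow> nat set \<Rightarrow> nat \<Rightarrow> nat \<Rightarrow> real" where
  "repeated_average \<phi> = wfrec {(\<eta>, \<xi>). \<eta> < \<xi>} (\<lambda>R \<xi> M.
     if \<xi> = 0 then (\<lambda>n. indicator {enumerate M n})
     else if is_succ \<xi> then succ_average (R (opred \<xi>) M)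
     else limit_average (\<lambda>m N. R (\<phi> \<xi> m) N 0) M)"

lemma repeated_average_unfold:
  "repeated_average \<phi> \<xi> M =
     (let R = cut (repeated_average \<phi>) {(\<eta>, \<xi>). \<eta> < \<xi>} \<xi> in
      if \<xi> = 0 then (\<lambda>n. indicator {enumerate M n})
      else if is_succ \<xi> then succ_average (R (opred \<xi>) M)
      else limit_average (\<lambda>m N. R (\<phi> \<xi> m) N 0) M)"
  unfolding repeated_average_def Let_def by (subst wfrec[OF wf]) (rule refl)

lemma repeated_average_0:
  "repeated_average \<phi> 0 M n = indicator {enumerate M n}"
  by (subst repeated_average_unfold) (simp add: Let_def)

lemma repeated_average_osucc:
  "repeated_average \<phi> (osucc \<zeta>) M = succ_average (repeated_average \<phi> \<zeta> M)"
  by (subst repeated_average_unfold) (auto simp: Let_def is_succ_def cut_def)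

lemma finite_supp_succ_average:
  assumes "\<And>n. finite (supp (A n))"
  shows "finite (supp (succ_average A n))"
proof (rule finite_subset)
  show "supp (succ_average A n) \<subseteq> (\<Union>j<block_length A n. supp (A (block_start A n + j)))"
    by (force simp: supp_def succ_average_def intro: sum.neutral)
  show "finite (\<Union>j<block_length A n. supp (A (block_start A n + j)))"
    using assms by simp
qed

lemma limit_set_infinite:
  assumes "infinite M" "M \<subseteq> {1..}"
    and "\<And>m N. m \<ge> 1 \<Longrightarrow> infinite N \<Longrightarrow> N \<subseteq> {1..} \<Longrightarrow> finite (supp (F m N))"
  shows "infinite (limit_set F M k) \<and> limit_set F M k \<subseteq> {1..} \<and> Inf (limit_set F M k) \<ge> 1"
proof (induction k)
  case 0
  have "M \<noteq> {}" using assms(1) by auto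
  then have "Inf M \<in> M" by (rule Inf_nat_def1)
  then show ?case using assms by auto
next
  case (Suc k)
  let ?N = "limit_set F M k"
  have "infinite (?N - supp (F (Inf ?N) ?N))"
    using Suc assms(3) by (intro Diff_infinite_finite) auto
  then have *: "infinite (limit_set F M (Suc k))" by simp
  then have "limit_set F M (Suc k) \<noteq> {}" by (metis finite.emptyI)
  then have "Inf (limit_set F M (Suc k)) \<in> limit_set F M (Suc k)" by (rule Inf_nat_def1)
  moreover have "limit_set F M (Suc k) \<subseteq> {1..}" using Suc by auto
  ultimately show ?case using * by (metis atLeast_iff subsetD)
qed

lemma limit_average_cong:
  assumes "infinite M" "M \<subseteq> {1..}"
    and fin: "\<And>m N. m \<ge> 1 \<Longrightarrow> infinite N \<Longrightarrow> N \<subseteq> {1..} \<Longrightarrow> finite (supp (G m N))"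
    and eq: "\<And>m N. m \<ge> 1 \<Longrightarrow> F m N = G m N"
  shows "limit_average F M = limit_average G M"
proof -
  have pos: "Inf (limit_set G M k) \<ge> 1" for k
    using limit_set_infinite[of M G k] assms(1,2) fin by blast
  have "limit_set F M k = limit_set G M k" for k
    by (induction k) (use pos eq in auto)
  then show ?thesis
    using pos eq by (auto simp: limit_average_def fun_eq_iff)
qed

lemma finite_supp_repeated_average:
  assumes "limit_sequences \<phi>" "infinite M" "M \<subseteq> {1..}"
  shows "finite (supp (repeated_average \<phi> \<xi> M n))"
  using assms(2,3)
proof (induction \<xi> arbitrary: M n rule: less_induct)
  case (less \<xi>)
  consider "\<xi> = 0" | \<zeta> where "\<xi> = osucc \<zeta>" | "is_limit \<xi>"
    by (auto simp: is_limit_def is_succ_def)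
  then show ?case
  proof cases
    case 1
    then show ?thesis by (simp add: repeated_average_0 supp_def indicator_def)
  next
    case 2
    then show ?thesis using less by (auto simp: repeated_average_osucc intro: finite_supp_succ_average)
  next
    case 3
    define F where
      "F = (\<lambda>m N. cut (repeated_average \<phi>) {(\<eta>, \<xi>). \<eta> < \<xi>} \<xi> (\<phi> \<xi> m) N 0)"
    have F: "F m N = repeated_average \<phi> (\<phi> \<xi> m) N 0" if "m \<ge> 1" for m N
      using limit_sequences_less[OF assms(1) 3 that] by (simp add: F_def cut_def)
    have fin: "finite (supp (F m N))" if "m \<ge> 1" "infinite N" "N \<subseteq> {1..}" for m N
      using less.IH[OF limit_sequences_less[OF assms(1) 3 that(1)] that(2,3)] F that by simp
    have "repeated_average \<phi> \<xi> M = limit_average F M"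
      using 3 by (subst repeated_average_unfold) (simp add: Let_def is_limit_def F_def)
    moreover have "finite (supp (limit_average F M n))"
      unfolding limit_average_def
      using limit_set_infinite[of M F n] less.prems fin by blast
    ultimately show ?thesis by simp
  qed
qed

lemma repeated_average_limit:
  assumes "limit_sequences \<phi>" "is_limit \<xi>" "infinite M" "M \<subseteq> {1..}"
  shows "repeated_average \<phi> \<xi> M = limit_average (\<lambda>m N. repeated_average \<phi> (\<phi> \<xi> m) N 0) M"
proof -
  let ?F = "\<lambda>m N. cut (repeated_average \<phi>) {(\<eta>, \<xi>). \<eta> < \<xi>} \<xi> (\<phi> \<xi> m) N 0"
  have "repeated_average \<phi> \<xi> M = limit_average ?F M"
    using assms(2) by (subst repeated_average_unfold) (simp add: Let_def is_limit_def)
  also have "\<dots> = limit_average (\<lambda>m N. repeated_average \<phi> (\<phi> \<xi> m) N 0) M"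
    using assms(3,4)
  proof (rule limit_average_cong)
    show "finite (supp (repeated_average \<phi> (\<phi> \<xi> m) N 0))"
      if "infinite N" "N \<subseteq> {1..}" for m N
      using finite_supp_repeated_average[OF assms(1) that] .
    show "?F m N = repeated_average \<phi> (\<phi> \<xi> m) N 0" if "m \<ge> 1" for m N
      using limit_sequences_less[OF assms(1,2) that] by (simp add: cut_def)
  qed
  finally show ?thesis .
qed


section \<open>Summability and the weak Banach--Saks properties\<close>

definition average :: "(nat \<Rightarrow> real) \<Rightarrow> (nat \<Rightarrow> 'a) \<Rightarrow> 'a :: banach" where
  "average a x = (\<Sum>i. a i *\<^sub>R x i)"

text \<open>
  Sequences in the space are indexed by all of \<^typ>\<open>nat\<close>; since averages over sets of positive
  integers ignore the term of index \<open>0\<close> and convergence does not depend on it, these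
  stand for sequences indexed by the positive integers.
\<close>

definition summable_along ::
    "(omega1 \<Rightarrow> nat \<Rightarrow> omega1) \<Rightarrow> nat set \<Rightarrow> omega1 \<Rightarrow> (nat \<Rightarrow> 'a :: banach) \<Rightarrow> bool" where
  "summable_along \<phi> M \<xi> x \<longleftrightarrow>
     convergent (\<lambda>n. (1 / real n) *\<^sub>R (\<Sum>k<n. average (repeated_average \<phi> \<xi> M k) x))"

definition weakly_convergent :: "(nat \<Rightarrow> 'a :: real_normed_vector) \<Rightarrow> bool" where
  "weakly_convergent x \<longleftrightarrow>
     (\<exists>l. \<forall>f :: 'a \<Rightarrow> real. bounded_linear f \<longrightarrow> (\<lambda>n. f (x n)) \<longlonglongrightarrow> f l)"

definition weak_Banach_Saks ::
    "(omega1 \<Rightarrow> nat \<Rightarrow> omega1) \<Rightarrow> omega1 \<Rightarrow> 'a :: banach itself \<Rightarrow> bool" where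
  "weak_Banach_Saks \<phi> \<xi> (_ :: 'a itself) \<longleftrightarrow>
     (\<forall>x :: nat \<Rightarrow> 'a. weakly_convergent x \<longrightarrow>
        (\<exists>L. infinite L \<and> L \<subseteq> {1..} \<and> summable_along \<phi> L \<xi> x))"


section \<open>Copies of the space of absolutely summable sequences\<close>

definition l1 :: "(nat \<Rightarrow> real) set" where
  "l1 = {a. summable (\<lambda>i. \<bar>a i\<bar>)}"

definition l1_norm :: "(nat \<Rightarrow> real) \<Rightarrow> real" where
  "l1_norm a = (\<Sum>i. \<bar>a i\<bar>)"

text \<open>
  A linear map on \<^const>\<open>l1\<close> that is bounded above and below, that is, an isomorphism
  of normed spaces onto its image.
\<close>

definition contains_l1 :: "'a :: banach itself \<Rightarrow> bool" where
  "contains_l1 (_ :: 'a itself) \<longleftrightarrow>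
     (\<exists>T :: (nat \<Rightarrow> real) \<Rightarrow> 'a.
        (\<forall>a\<in>l1. \<forall>b\<in>l1. T (\<lambda>i. a i + b i) = T a + T b) \<and>
        (\<forall>r. \<forall>a\<in>l1. T (\<lambda>i. r * a i) = r *\<^sub>R T a) \<and>
        (\<exists>c>0. \<exists>C. \<forall>a\<in>l1. c * l1_norm a \<le> norm (T a) \<and> norm (T a) \<le> C * l1_norm a))"

end

theory Submission
  imports Defs
begin

text \<open>
  Suppose a weakly null sequence \<open>x\<close> is not $(L,\xi)$-summable for any \<open>L\<close>. By Ramsey's theorem for
  open sets, the $\xi$-averages of \<open>x\<close> have norm at least some $\epsilon$ for all \<open>L\<close> inside some
  \<open>M\<close>, so the hereditary family of all finite \<open>F\<close> such that some functional in the dual ball is at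
  least $\delta$ on $\{x_i : i \in F\}$ has $\xi$-measure bounded below along \<open>M\<close>. Being large in this
  sense passes from $\xi$ to smaller ordinals $\eta$, and it forces the family to contain a
  spread copy of the whole Schreier family $\mathcal S_\eta$. Hence a subsequence \<open>y\<close> of \<open>x\<close> has
  $\mathcal S_\eta$ in its own family, for every $\eta \le \xi$.

  For $\eta = \zeta + 1 \le \xi$ this shows that \<open>y\<close> is not $(L,\zeta)$-summable for any \<open>L\<close>, because
  $\zeta$-summability would make the $(\zeta+1)$-averages converge to \<open>0\<close>. So the weak
  Banach--Saks properties increase with the ordinal. If all of them failed, then, taking
  $\eta = \xi$ and a further subsequence on which functionals can be prescribed with signs, one would
  obtain in a fixed countable dense set, with a constant not depending on $\xi$, trees of
  $\ell^1$-sequences of rank at least every $\xi < \omega_1$. Such a tree has an infinite branch, which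
  spans a copy of $\ell^1$.
\<close>

section \<open>Countable ordinals\<close>

text \<open>The sequences fixed at different limit ordinals are unrelated, so for \<eta> < \<xi> the
  Schreier families and the averages of the two orders are not comparable by inclusion. Hence
  largeness cannot simply be restricted from \<xi> to \<eta>; instead smallness is pushed up from
  \<eta> to \<xi>, and Ramsey's theorem turns this around. A Schreier copy is extracted only
  afterwards, for the one order in question. The step from \<zeta> to \<zeta> + 1 in the
  monotonicity rests on the growth of the blocks: the number of \<zeta>-averages in a block exceeds
  the number of all earlier ones, so a block mean is a bounded combination of two Cesaro means. The
  functionals behind the l1 lower bounds are at least \<delta> on a chosen part of a Schreier set
  and at most \<delta> / 2 on the rest. There is no control from below on the rest; a change of sign
  of all coefficients compensates for this.\<close>

lemma omega1_cases [case_names zero succ limit]: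
  obtains "\<xi> = 0" | \<zeta> where "\<xi> = osucc \<zeta>" | "is_limit \<xi>"
  by (auto simp: is_limit_def is_succ_def)

lemma omega1_induct [case_names zero succ limit]:
  assumes "P 0" "\<And>\<zeta>. P \<zeta> \<Longrightarrow> P (osucc \<zeta>)"
    and "\<And>\<xi>. is_limit \<xi> \<Longrightarrow> (\<And>\<eta>. \<eta> < \<xi> \<Longrightarrow> P \<eta>) \<Longrightarrow> P \<xi>"
  shows "P \<xi>"
proof (induction \<xi> rule: less_induct)
  case (less \<xi>)
  then show ?case using assms by (cases \<xi> rule: omega1_cases) auto
qed

lemma not_is_limit [simp]: "\<not> is_limit 0" "\<not> is_limit (osucc \<zeta>)"
  by (auto simp: is_limit_def is_succ_def)

lemma countable_bounded_omega1:
  assumes "countable (A :: omega1 set)"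
  shows "\<exists>\<gamma>. \<forall>\<alpha>\<in>A. \<alpha> \<le> \<gamma>"
proof -
  have "countable (\<Union>\<alpha>\<in>A. {..<\<alpha>})" using assms countable_lessThan_omega1 by blast
  then have "(\<Union>\<alpha>\<in>A. {..<\<alpha>}) \<noteq> UNIV" using uncountable_omega1 by metis
  then obtain \<gamma> where "\<gamma> \<notin> (\<Union>\<alpha>\<in>A. {..<\<alpha>})" by blast
  then have "\<forall>\<alpha>\<in>A. \<alpha> \<le> \<gamma>" by (auto simp: not_less)
  then show ?thesis by blast
qed

section \<open>Ramsey theory\<close>

definition initial_segment :: "nat set \<Rightarrow> nat set \<Rightarrow> bool" where
  "initial_segment E L \<longleftrightarrow> finite E \<and> E \<subseteq> L \<and> (\<forall>x\<in>L - E. \<forall>e\<in>E. e < x)"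

lemma infinite_Int_greaterThan:
  assumes "infinite A"
  shows "infinite (A \<inter> {n::nat<..})"
proof
  assume "finite (A \<inter> {n<..})"
  then have "finite (A \<inter> {n<..} \<union> {..n})" by simp
  moreover have "A \<subseteq> A \<inter> {n<..} \<union> {..n}" by auto
  ultimately show False using assms finite_subset by blast
qed

section \<open>Fusion of dense hereditary properties\<close>

lemma dense_finite:
  fixes D :: "'i \<Rightarrow> nat set \<Rightarrow> bool"
  assumes "finite I" "infinite N" "N \<subseteq> M"
    and dense: "\<And>i N. i \<in> I \<Longrightarrow> infinite N \<Longrightarrow> N \<subseteq> M \<Longrightarrow> \<exists>N'\<subseteq>N. infinite N' \<and> D i N'"
    and hered: "\<And>i N N'. D i N \<Longrightarrow> N' \<subseteq> N \<Longrightarrow> infinite N' \<Longrightarrow> D i N'"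
  shows "\<exists>N'\<subseteq>N. infinite N' \<and> (\<forall>i\<in>I. D i N')"
  using assms(1) dense
proof (induction I)
  case empty
  then show ?case using assms(2) by auto
next
  case (insert i I)
  then have "\<exists>N'\<subseteq>N. infinite N' \<and> (\<forall>i\<in>I. D i N')" by (intro insert.IH) simp
  then obtain N1 where N1: "N1 \<subseteq> N" "infinite N1" "\<forall>i\<in>I. D i N1" by blast
  have "\<exists>N'\<subseteq>N1. infinite N' \<and> D i N'"
    by (rule insert.prems) (use N1 assms(3) in auto)
  then obtain N2 where N2: "N2 \<subseteq> N1" "infinite N2" "D i N2" by blast
  have "D j N2" if "j \<in> insert i I" for j
  proof (cases "j = i")
    case False
    then have "D j N1" using that N1(3) by blast
    then show ?thesis using N2(1,2) by (rule hered)
  qed (use N2 in simp)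
  then show ?case using N1 N2 by (intro exI[of _ N2]) auto
qed

text \<open>\<open>N\<close> consists of the minima of a decreasing sequence of sets. Everything in
  \<open>N\<close> beyond \<open>n\<close> comes from a set that was shrunk after \<open>n\<close>
  had become known, so it can be made to satisfy the finitely many requirements with index up to
  \<open>Suc n\<close>. The bound \<open>Suc n\<close> instead of \<open>n\<close> is what
  \<open>captures_diagonal\<close> uses, and \<open>D 0 N\<close> serves the case where no element
  has been chosen yet.\<close>

lemma fusion:
  fixes D :: "nat \<Rightarrow> nat set \<Rightarrow> bool"
  assumes inf: "infinite M"
    and dense: "\<And>n N. infinite N \<Longrightarrow> N \<subseteq> M \<Longrightarrow> \<exists>N'\<subseteq>N. infinite N' \<and> D n N'"
    and hered: "\<And>n N N'. D n N \<Longrightarrow> N' \<subseteq> N \<Longrightarrow> infinite N' \<Longrightarrow> D n N'"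
  shows "\<exists>N\<subseteq>M. infinite N \<and> D 0 N \<and> (\<forall>n\<in>N. \<forall>k\<le>Suc n. D k (N \<inter> {n<..}))"
proof -
  define P where "P = (\<lambda>(k::nat) A. infinite A \<and> A \<subseteq> M \<and> D 0 A)"
  define Q where "Q = (\<lambda>(k::nat) A B. B \<subseteq> A \<inter> {Inf A<..} \<and> (\<forall>j\<le>Suc (Inf A). D j B))"
  have "\<exists>A. \<forall>k. P k (A k) \<and> Q k (A k) (A (Suc k))"
  proof (rule dependent_nat_choice)
    show "\<exists>A. P 0 A" using dense[OF inf order.refl, of 0] unfolding P_def by blast
    fix A k assume A: "P k A"
    have "\<exists>B\<subseteq>A \<inter> {Inf A<..}. infinite B \<and> (\<forall>j\<in>{..Suc (Inf A)}. D j B)"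
      by (rule dense_finite[where M = M]) (use A infinite_Int_greaterThan dense hered in \<open>auto simp: P_def\<close>)
    then obtain B where "B \<subseteq> A \<inter> {Inf A<..}" "infinite B" "\<forall>j\<in>{..Suc (Inf A)}. D j B"
      by blast
    then show "\<exists>B. P (Suc k) B \<and> Q k A B"
      using A unfolding P_def Q_def by (intro exI[of _ B]) auto
  qed
  then obtain A where A: "\<And>k. P k (A k)" "\<And>k. Q k (A k) (A (Suc k))" by blast
  have in_A: "Inf (A k) \<in> A k" for k
    using A(1)[of k] unfolding P_def by (metis Inf_nat_def1 finite.emptyI)
  have dec: "A (k + j) \<subseteq> A k" for k j
    using A(2) unfolding Q_def by (induction j) fastforce+
  have less: "Inf (A k) < Inf (A (Suc k))" for k
    using in_A[of "Suc k"] A(2)[of k] unfolding Q_def by auto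
  have mono: "strict_mono (\<lambda>k. Inf (A k))" by (simp add: strict_mono_Suc_iff less)
  define N where "N = range (\<lambda>k. Inf (A k))"
  have "infinite N"
    unfolding N_def by (rule range_inj_infinite[OF strict_mono_imp_inj_on[OF mono]])
  have NA: "N \<subseteq> A 0" using in_A dec[of 0] unfolding N_def by auto
  have "D k (N \<inter> {n<..})" if n: "n \<in> N" and k: "k \<le> Suc n" for n k
  proof -
    obtain i where i: "n = Inf (A i)" using n N_def by auto
    have "Inf (A j) \<in> A (Suc i)" if "n < Inf (A j)" for j
    proof -
      have "i < j" using that i strict_mono_less[OF mono] by simp
      then obtain d where "j = Suc i + d" by (metis add_Suc less_iff_Suc_add)
      then show ?thesis using in_A[of j] dec[of "Suc i" d] by auto
    qed
    then have "N \<inter> {n<..} \<subseteq> A (Suc i)" unfolding N_def by auto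
    moreover have "D k (A (Suc i))" using A(2)[of i] k i unfolding Q_def by auto
    ultimately show ?thesis using hered infinite_Int_greaterThan[OF \<open>infinite N\<close>] by blast
  qed
  moreover have "D 0 N" using hered[of 0 "A 0" N] NA \<open>infinite N\<close> A(1)[of 0] unfolding P_def by auto
  moreover have "N \<subseteq> M" using NA A(1)[of 0] unfolding P_def by auto
  ultimately show ?thesis using \<open>infinite N\<close> by blast
qed

text \<open>The acceptance-rejection argument of Nash-Williams, Galvin and Prikry.
  \<open>accepts N G\<close> says that every infinite subset of \<open>N\<close> beyond
  \<open>G\<close> completes \<open>G\<close> to a set with an initial segment in \<open>F\<close>;
  \<open>rejects\<close> forbids this for all infinite subsets of \<open>N\<close>. A first fusion
  makes \<open>N\<close> decide each of its finite subsets. If the empty set is rejected, a second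
  fusion yields a set all of whose finite subsets are rejected, and none of these lies in
  \<open>F\<close>, since members of \<open>F\<close> are accepted.\<close>

lemma open_ramsey:
  fixes F :: "nat set set"
  assumes inf: "infinite M"
  shows "\<exists>N\<subseteq>M. infinite N \<and>
    ((\<forall>L\<subseteq>N. infinite L \<longrightarrow> (\<exists>E\<in>F. initial_segment E L)) \<or> (\<forall>E\<subseteq>N. finite E \<longrightarrow> E \<notin> F))"
proof -
  define accepts where "accepts = (\<lambda>N G. \<forall>L\<subseteq>N. infinite L \<longrightarrow> (\<forall>g\<in>G. \<forall>l\<in>L. g < l) \<longrightarrow>
    (\<exists>E\<in>F. initial_segment E (G \<union> L)))"
  define rejects where "rejects = (\<lambda>N G. \<forall>N'\<subseteq>N. infinite N' \<longrightarrow> \<not> accepts N' G)"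
  have acc_mono: "accepts N' G" if "accepts N G" "N' \<subseteq> N" for N N' G
    using that unfolding accepts_def by blast
  have rej_mono: "rejects N' G" if "rejects N G" "N' \<subseteq> N" for N N' G
    using that unfolding rejects_def by blast
  define D where "D = (\<lambda>n N. \<forall>G\<in>Pow {..n}. accepts N G \<or> rejects N G)"
  have "\<exists>N\<subseteq>M. infinite N \<and> D 0 N \<and> (\<forall>n\<in>N. \<forall>k\<le>Suc n. D k (N \<inter> {n<..}))"
  proof (rule fusion[OF inf])
    fix n :: nat and N assume "infinite N" "N \<subseteq> M"
    then show "\<exists>N'\<subseteq>N. infinite N' \<and> D n N'"
      unfolding D_def
    proof (intro dense_finite[where M = M])
      fix G and N :: "nat set" assume "infinite N"
      then show "\<exists>N'\<subseteq>N. infinite N' \<and> (accepts N' G \<or> rejects N' G)"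
        unfolding rejects_def by blast
    qed (use acc_mono rej_mono in blast)+
  qed (use acc_mono rej_mono in \<open>unfold D_def, blast\<close>)
  then obtain N where N: "N \<subseteq> M" "infinite N" "D 0 N"
    and DN: "\<And>n. n \<in> N \<Longrightarrow> D n (N \<inter> {n<..})" by (metis le_SucI order.refl)
  \<comment> \<open>The fusion decides \<open>G\<close> only beyond \<open>Max G\<close>; this
    suffices because acceptance of \<open>G\<close> concerns only sets beyond
    \<open>G\<close>.\<close>
  have dec: "accepts N G \<or> rejects N G" if "finite G" "G \<subseteq> N" for G
  proof (cases "G = {}")
    case True
    then show ?thesis using N(3) unfolding D_def by blast
  next
    case False
    define n where "n = Max G"
    have n: "n \<in> G" "\<And>g. g \<in> G \<Longrightarrow> g \<le> n" using False that n_def by auto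
    have "accepts (N \<inter> {n<..}) G \<or> rejects (N \<inter> {n<..}) G"
      using DN[of n] n that unfolding D_def by blast
    moreover have "accepts N G" if "accepts (N \<inter> {n<..}) G"
      using that n(1) unfolding accepts_def by (auto simp: subset_iff)
    moreover have "rejects N G" if "rejects (N \<inter> {n<..}) G"
      unfolding rejects_def
    proof (intro allI impI notI)
      fix N' assume "N' \<subseteq> N" "infinite N'" "accepts N' G"
      then show False
        using that acc_mono[of N' G "N' \<inter> {n<..}"] infinite_Int_greaterThan[of N' n]
        unfolding rejects_def by blast
    qed
    ultimately show ?thesis by blast
  qed
  show ?thesis
  proof (cases "accepts N {}")
    case True
    then show ?thesis using N unfolding accepts_def by auto
  next
    case False
    then have rej0: "rejects N {}" using dec[of "{}"] by auto
    have fin: "finite {m \<in> N. (\<forall>g\<in>G. g < m) \<and> \<not> rejects N (insert m G)}"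
      (is "finite ?B") if G: "finite G" "G \<subseteq> N" "rejects N G" for G
    proof (rule ccontr)
      assume B: "infinite ?B"
      \<comment> \<open>The minimum \<open>m\<close> of a set \<open>L\<close> inside
        \<open>?B\<close> lies in \<open>?B\<close>, so \<open>insert m G\<close> is accepted, and
        the rest of \<open>L\<close> completes it.\<close>
      have "accepts ?B G"
        unfolding accepts_def
      proof (intro allI impI)
        fix L assume L: "L \<subseteq> ?B" "infinite L" "\<forall>g\<in>G. \<forall>l\<in>L. g < l"
        define m where "m = Inf L"
        have "L \<noteq> {}" using L(2) by auto
        then have m: "m \<in> L" unfolding m_def by (rule Inf_nat_def1)
        have "accepts N (insert m G)" using dec[of "insert m G"] G L m by auto
        moreover have "infinite (L - {m})" using L by simp
        moreover have "\<forall>g\<in>insert m G. \<forall>l\<in>L - {m}. g < l"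
          using L(3) m unfolding m_def by (auto simp: le_neq_implies_less wellorder_Inf_le1)
        ultimately have "\<exists>E\<in>F. initial_segment E (insert m G \<union> (L - {m}))"
          using L(1) unfolding accepts_def by blast
        moreover have "insert m G \<union> (L - {m}) = G \<union> L" using m by auto
        ultimately show "\<exists>E\<in>F. initial_segment E (G \<union> L)" by simp
      qed
      moreover have "?B \<subseteq> N" by blast
      ultimately show False using G(3) B unfolding rejects_def by simp
    qed
    define D2 where "D2 = (\<lambda>n N'. \<forall>G\<in>Pow ({..n} \<inter> N). rejects N G \<longrightarrow>
      (\<forall>m\<in>N'. (\<forall>g\<in>G. g < m) \<longrightarrow> rejects N (insert m G)))"
    have "\<exists>N'\<subseteq>N. infinite N' \<and> D2 0 N' \<and> (\<forall>n\<in>N'. \<forall>k\<le>Suc n. D2 k (N' \<inter> {n<..}))"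
    proof (rule fusion[OF N(2)])
      fix n :: nat and N1 assume N1: "infinite N1" "N1 \<subseteq> N"
      show "\<exists>N'\<subseteq>N1. infinite N' \<and> D2 n N'"
        unfolding D2_def
      proof (rule dense_finite[where M = N])
        fix G and N2 assume G: "G \<in> Pow ({..n} \<inter> N)" and N2: "infinite N2" "N2 \<subseteq> N"
        show "\<exists>N'\<subseteq>N2. infinite N' \<and> (rejects N G \<longrightarrow>
          (\<forall>m\<in>N'. (\<forall>g\<in>G. g < m) \<longrightarrow> rejects N (insert m G)))"
        proof (cases "rejects N G")
          case True
          have "finite G" using G finite_subset[of G "{..n}"] by auto
          then have "infinite (N2 - {m \<in> N. (\<forall>g\<in>G. g < m) \<and> \<not> rejects N (insert m G)})"
            using fin[of G] G True N2 by (intro Diff_infinite_finite) auto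
          then show ?thesis using N2
            by (intro exI[of _ "N2 - {m \<in> N. (\<forall>g\<in>G. g < m) \<and> \<not> rejects N (insert m G)}"]) auto
        qed (use N2 in blast)
      qed (use N1 in auto)
    qed (auto simp: D2_def)
    then obtain N' where N': "N' \<subseteq> N" "infinite N'" "D2 0 N'"
      and D2N: "\<And>n. n \<in> N' \<Longrightarrow> D2 n (N' \<inter> {n<..})" by (metis le_SucI order.refl)
    have rej: "rejects N G" if "finite G" "G \<subseteq> N'" for G
      using that
    proof (induction G rule: finite_linorder_max_induct)
      case empty
      then show ?case using rej0 by simp
    next
      case (insert b A)
      show ?case
      proof (cases "A = {}")
        case True
        then show ?thesis using N'(3) rej0 insert.prems unfolding D2_def by auto
      next
        case False
        define n where "n = Max A"
        have n: "n \<in> A" "\<And>g. g \<in> A \<Longrightarrow> g \<le> n" using False insert.hyps n_def by auto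
        then have "A \<in> Pow ({..n} \<inter> N)" "b \<in> N' \<inter> {n<..}" "n \<in> N'" "\<forall>a\<in>A. a < b"
          using insert N'(1) by auto
        then show ?thesis using insert D2N[of n] unfolding D2_def by blast
      qed
    qed
    have "E \<notin> F" if E: "E \<subseteq> N'" "finite E" for E
    proof
      assume "E \<in> F"
      then have "accepts N E"
        using E unfolding accepts_def initial_segment_def by blast
      then show False using rej[OF E(2,1)] N(2) unfolding rejects_def by blast
    qed
    then show ?thesis using N N' by (intro exI[of _ N']) auto
  qed
qed

text \<open>\<open>cont\<close> says that \<open>P\<close> is clopen for the topology generated by
  initial segments. The sets \<open>E\<close> that force \<open>P\<close> then generate exactly
  \<open>P\<close>, and the asymmetric alternative of \<open>open_ramsey\<close> becomes
  homogeneity.\<close>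

lemma clopen_ramsey:
  fixes P :: "nat set \<Rightarrow> bool"
  assumes inf: "infinite M" and "M \<subseteq> X"
    and cont: "\<And>L. infinite L \<Longrightarrow> L \<subseteq> X \<Longrightarrow> \<exists>E. initial_segment E L \<and>
      (\<forall>L'. infinite L' \<longrightarrow> L' \<subseteq> X \<longrightarrow> initial_segment E L' \<longrightarrow> P L' = P L)"
  shows "\<exists>N\<subseteq>M. infinite N \<and> ((\<forall>L\<subseteq>N. infinite L \<longrightarrow> P L) \<or> (\<forall>L\<subseteq>N. infinite L \<longrightarrow> \<not> P L))"
proof -
  define F where "F = {E. \<forall>L. infinite L \<longrightarrow> L \<subseteq> X \<longrightarrow> initial_segment E L \<longrightarrow> P L}"
  have P_iff: "P L \<longleftrightarrow> (\<exists>E\<in>F. initial_segment E L)" if "infinite L" "L \<subseteq> X" for L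
    using cont[OF that] that unfolding F_def by blast
  obtain N where N: "N \<subseteq> M" "infinite N"
    "(\<forall>L\<subseteq>N. infinite L \<longrightarrow> (\<exists>E\<in>F. initial_segment E L)) \<or> (\<forall>E\<subseteq>N. finite E \<longrightarrow> E \<notin> F)"
    using open_ramsey[OF inf, of F] by blast
  have "\<not> P L" if E: "\<forall>E\<subseteq>N. finite E \<longrightarrow> E \<notin> F" and L: "L \<subseteq> N" "infinite L" for L
  proof
    assume "P L"
    moreover have "L \<subseteq> X" using L(1) N(1) assms(2) by blast
    ultimately obtain E where "E \<in> F" "initial_segment E L" using P_iff L(2) by blast
    then show False using E L unfolding initial_segment_def by blast
  qed
  moreover have "P L" if "\<forall>L\<subseteq>N. infinite L \<longrightarrow> (\<exists>E\<in>F. initial_segment E L)" "L \<subseteq> N" "infinite L" for L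
    using that P_iff[of L] N(1) assms(2) by simp
  ultimately show ?thesis using N by blast
qed

section \<open>Structure of the repeated averages\<close>

definition index_set :: "nat set \<Rightarrow> bool" where
  "index_set L \<longleftrightarrow> infinite L \<and> L \<subseteq> {1..}"

lemma index_set_Inf:
  assumes "index_set L"
  shows "Inf L \<in> L" "Inf L \<ge> 1" "i \<in> L \<Longrightarrow> Inf L \<le> i"
proof -
  have "L \<noteq> {}" using assms by (auto simp: index_set_def)
  then show "Inf L \<in> L" by (rule Inf_nat_def1)
  then show "Inf L \<ge> 1" using assms by (auto simp: index_set_def)
  show "i \<in> L \<Longrightarrow> Inf L \<le> i" by (simp add: wellorder_Inf_le1)
qed

lemma index_set_subset: "index_set L \<Longrightarrow> L' \<subseteq> L \<Longrightarrow> infinite L' \<Longrightarrow> index_set L'"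
  by (auto simp: index_set_def)

lemma Inf_initial_segment:
  assumes "initial_segment E L" "E \<noteq> {}"
  shows "Inf L = Inf E"
proof (rule antisym)
  have E: "Inf E \<in> E" using assms(2) by (rule Inf_nat_def1)
  then show "Inf L \<le> Inf E" using assms(1) by (intro wellorder_Inf_le1) (auto simp: initial_segment_def)
  have "Inf L \<in> L" using assms by (intro Inf_nat_def1) (auto simp: initial_segment_def)
  then show "Inf E \<le> Inf L"
    using assms(1) E by (cases "Inf L \<in> E") (auto simp: initial_segment_def wellorder_Inf_le1 order.strict_implies_order)
qed

locale repeated_averages =
  fixes \<phi> :: "omega1 \<Rightarrow> nat \<Rightarrow> omega1"
  assumes limit_sequences: "limit_sequences \<phi>"
begin

abbreviation ra :: "omega1 \<Rightarrow> nat set \<Rightarrow> nat \<Rightarrow> nat \<Rightarrow> real" where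
  "ra \<equiv> repeated_average \<phi>"

abbreviation avg :: "omega1 \<Rightarrow> nat set \<Rightarrow> nat \<Rightarrow> real" where
  "avg \<xi> L \<equiv> ra \<xi> L 0"

primrec remainder :: "omega1 \<Rightarrow> nat set \<Rightarrow> nat \<Rightarrow> nat set" where
  "remainder \<xi> L 0 = L"
| "remainder \<xi> L (Suc n) = remainder \<xi> L n - supp (avg \<xi> (remainder \<xi> L n))"

lemma finite_supp_ra: "index_set L \<Longrightarrow> finite (supp (ra \<xi> L n))"
  using finite_supp_repeated_average[OF limit_sequences] by (simp add: index_set_def)

lemma index_set_remainder: "index_set L \<Longrightarrow> index_set (remainder \<xi> L n)"
proof (induction n)
  case (Suc n)
  then have "infinite (remainder \<xi> L (Suc n))"
    using Diff_infinite_finite[OF finite_supp_ra, of "remainder \<xi> L n"] by (simp add: index_set_def)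
  then show ?case using Suc by (auto simp: index_set_def)
qed simp

lemma remainder_add: "remainder \<xi> L (k + j) = remainder \<xi> (remainder \<xi> L k) j"
  by (induction j) auto

lemma remainder_antimono: "i \<le> j \<Longrightarrow> remainder \<xi> L j \<subseteq> remainder \<xi> L i"
proof (induction j)
  case (Suc j)
  then show ?case by (cases "i = Suc j") auto
qed simp

text \<open>All later averages of \<open>L\<close> are first averages of a remainder of \<open>L\<close>, and a first average is
  determined by any set having its support as an initial segment; these two facts let the Ramsey
  theorem act on averages.\<close>

definition coherent :: "omega1 \<Rightarrow> bool" where
  "coherent \<xi> \<longleftrightarrow> (\<forall>L. index_set L \<longrightarrow>
     (\<forall>i. avg \<xi> L i \<ge> 0) \<and> supp (avg \<xi> L) \<noteq> {} \<and> initial_segment (supp (avg \<xi> L)) L \<and>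
     sum (avg \<xi> L) (supp (avg \<xi> L)) = 1 \<and>
     (\<forall>n. ra \<xi> L n = avg \<xi> (remainder \<xi> L n)) \<and>
     (\<forall>L'. index_set L' \<longrightarrow> initial_segment (supp (avg \<xi> L)) L' \<longrightarrow> avg \<xi> L' = avg \<xi> L))"

context
  fixes \<xi> :: omega1
  assumes coherent: "coherent \<xi>"
begin

lemma coherentD:
  assumes "index_set L"
  shows "avg \<xi> L i \<ge> 0" "supp (avg \<xi> L) \<noteq> {}" "initial_segment (supp (avg \<xi> L)) L"
    "sum (avg \<xi> L) (supp (avg \<xi> L)) = 1" "ra \<xi> L n = avg \<xi> (remainder \<xi> L n)"
    "index_set L' \<Longrightarrow> initial_segment (supp (avg \<xi> L)) L' \<Longrightarrow> avg \<xi> L' = avg \<xi> L"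
  using coherent[unfolded coherent_def, THEN spec, THEN mp, OF assms] by blast+

lemma coherent_Inf_supp: "index_set L \<Longrightarrow> Inf (supp (avg \<xi> L)) = Inf L"
  using Inf_initial_segment[OF coherentD(3,2)] by simp

lemma coherent_ra:
  assumes "index_set L"
  shows "ra \<xi> L n i \<ge> 0" "sum (ra \<xi> L n) (supp (ra \<xi> L n)) = 1"
    "supp (ra \<xi> L n) \<subseteq> remainder \<xi> L n" "Inf (supp (ra \<xi> L n)) = Inf (remainder \<xi> L n)"
  using coherentD(1-4)[OF index_set_remainder[OF assms]]
    coherent_Inf_supp[OF index_set_remainder[OF assms]]
  unfolding coherentD(5)[OF assms, of n] by (auto simp: initial_segment_def)

lemma coherent_ra_shift:
  assumes "index_set L"
  shows "ra \<xi> L (k + j) = ra \<xi> (remainder \<xi> L k) j"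
  using coherentD(5)[OF assms, of "k + j"] coherentD(5)[OF index_set_remainder[OF assms, of \<xi> k], of j]
  by (simp only: remainder_add)

lemma coherent_remainder_Suc:
  "index_set L \<Longrightarrow> remainder \<xi> L (Suc n) = remainder \<xi> L n - supp (ra \<xi> L n)"
  using coherentD(5)[of L n] by simp

lemma coherent_initial_segment:
  assumes "index_set L"
  shows "initial_segment (L - remainder \<xi> L k) L"
proof (induction k)
  case (Suc k)
  let ?R = "remainder \<xi> L k"
  have sub: "?R \<subseteq> L" using remainder_antimono[of 0 k] by simp
  have "initial_segment (supp (avg \<xi> ?R)) ?R"
    by (rule coherentD(3)[OF index_set_remainder[OF assms]])
  then have A: "finite (supp (avg \<xi> ?R))" "supp (avg \<xi> ?R) \<subseteq> ?R"
      "\<And>x e. x \<in> ?R - supp (avg \<xi> ?R) \<Longrightarrow> e \<in> supp (avg \<xi> ?R) \<Longrightarrow> e < x"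
    by (auto simp: initial_segment_def)
  have B: "finite (L - ?R)" "\<And>x e. x \<in> L - (L - ?R) \<Longrightarrow> e \<in> L - ?R \<Longrightarrow> e < x"
    using Suc by (auto simp: initial_segment_def)
  have eq: "L - remainder \<xi> L (Suc k) = (L - ?R) \<union> supp (avg \<xi> ?R)" using A(2) sub by auto
  show ?case
    unfolding eq initial_segment_def
  proof (intro conjI ballI)
    fix x e assume "x \<in> L - (L - ?R \<union> supp (avg \<xi> ?R))" "e \<in> L - ?R \<union> supp (avg \<xi> ?R)"
    then show "e < x" using A(3) B(2) by blast
  qed (use A B sub in auto)
qed (simp add: initial_segment_def)

lemma coherent_UN_supp:
  assumes "index_set L"
  shows "(\<Union>j<k. supp (ra \<xi> L j)) = L - remainder \<xi> L k"
proof (induction k)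
  case (Suc k)
  have "remainder \<xi> L k \<subseteq> L" using remainder_antimono[of 0 k] by simp
  moreover have "supp (ra \<xi> L k) \<subseteq> remainder \<xi> L k" using coherent_ra(3)[OF assms] .
  ultimately show ?case
    using Suc coherent_remainder_Suc[OF assms, of k] by (auto simp: lessThan_Suc simp del: remainder.simps)
qed simp

text \<open>Provides the continuity that \<open>clopen_ramsey\<close> asks for: the first
  \<open>k\<close> averages depend only on the finite initial segment that carries them.\<close>

lemma coherent_determined:
  assumes L: "index_set L" "index_set L'" and "initial_segment (L - remainder \<xi> L k) L'"
  shows "(\<forall>j<k. ra \<xi> L' j = ra \<xi> L j) \<and> L' - remainder \<xi> L' k = L - remainder \<xi> L k"
  using assms(3)
proof (induction k)
  case (Suc k)
  let ?R = "remainder \<xi> L k" and ?R' = "remainder \<xi> L' k"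
  have R: "?R \<subseteq> L" "?R' \<subseteq> L'" using remainder_antimono[of 0 k] by simp_all
  have S: "initial_segment (supp (avg \<xi> ?R)) ?R"
    by (rule coherentD(3)[OF index_set_remainder[OF L(1)]])
  have I: "initial_segment (L - ?R) L" by (rule coherent_initial_segment[OF L(1)])
  have SR: "supp (avg \<xi> ?R) \<subseteq> ?R" using S by (simp add: initial_segment_def)
  have eq: "L - remainder \<xi> L (Suc k) = (L - ?R) \<union> supp (avg \<xi> ?R)" using SR R by auto
  have I': "initial_segment (L - ?R \<union> supp (avg \<xi> ?R)) L'" using Suc.prems eq by simp
  have "initial_segment (L - ?R) L'"
    unfolding initial_segment_def
  proof (intro conjI ballI)
    show "finite (L - ?R)" using I by (simp add: initial_segment_def)
    show "L - ?R \<subseteq> L'" using I' by (simp add: initial_segment_def)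
    fix x e assume x: "x \<in> L' - (L - ?R)" and e: "e \<in> L - ?R"
    show "e < x"
    proof (cases "x \<in> supp (avg \<xi> ?R)")
      case True
      then have "x \<in> L - (L - ?R)" using SR R by auto
      then show ?thesis using I e by (auto simp: initial_segment_def)
    next
      case False
      then show ?thesis using I' x e by (auto simp: initial_segment_def)
    qed
  qed
  then have IH: "\<forall>j<k. ra \<xi> L' j = ra \<xi> L j" "L' - ?R' = L - ?R" using Suc.IH by auto
  have "initial_segment (supp (avg \<xi> ?R)) ?R'"
    unfolding initial_segment_def
  proof (intro conjI ballI)
    show "finite (supp (avg \<xi> ?R))" using S by (simp add: initial_segment_def)
    have "supp (avg \<xi> ?R) \<subseteq> L'" using I' by (simp add: initial_segment_def)
    then show "supp (avg \<xi> ?R) \<subseteq> ?R'" using IH(2) SR by auto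
    fix x e assume x: "x \<in> ?R' - supp (avg \<xi> ?R)" and e: "e \<in> supp (avg \<xi> ?R)"
    have "x \<in> L' - (L - ?R \<union> supp (avg \<xi> ?R))" using x R IH(2) by blast
    then show "e < x" using I' e by (auto simp: initial_segment_def)
  qed
  then have E: "avg \<xi> ?R' = avg \<xi> ?R"
    by (rule coherentD(6)[OF index_set_remainder[OF L(1)] index_set_remainder[OF L(2)]])
  then have "ra \<xi> L' k = ra \<xi> L k"
    using coherentD(5)[OF L(1), of k] coherentD(5)[OF L(2), of k] by simp
  moreover have "L' - remainder \<xi> L' (Suc k) = L - remainder \<xi> L (Suc k)"
    using E IH(2) eq R I' by (auto simp: initial_segment_def)
  ultimately show ?case using IH(1) less_Suc_eq by auto
qed simp

end

section \<open>Coherence of all orders, by induction\<close>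

lemma avg_0: "avg 0 L = indicator {Inf L}"
  by (simp add: repeated_average_0 enumerate_0 Inf_nat_def)

lemma coherent_0: "coherent 0"
proof -
  have supp: "supp (avg 0 L) = {Inf L}" for L
    by (auto simp: avg_0 supp_def indicator_def)
  have ra: "ra 0 L n = avg 0 (remainder 0 L n)" for L n
  proof (induction n arbitrary: L)
    case (Suc n)
    have "remainder 0 L (Suc n) = remainder 0 (L - {Inf L}) n"
      using remainder_add[of 0 L 1 n] supp by simp
    moreover have "ra 0 L (Suc n) = ra 0 (L - {Inf L}) n"
      by (simp add: repeated_average_0 Inf_nat_def enumerate_Suc)
    ultimately show ?case using Suc by simp
  qed simp
  show ?thesis
    unfolding coherent_def
  proof (intro allI impI conjI)
    fix L assume L: "index_set L"
    show "initial_segment (supp (avg 0 L)) L"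
      using index_set_Inf[OF L] by (auto simp: supp initial_segment_def le_neq_implies_less)
    show "ra 0 L n = avg 0 (remainder 0 L n)" for n by (rule ra)
    fix L' assume "initial_segment (supp (avg 0 L)) L'"
    then have "Inf L' = Inf L" using Inf_initial_segment[of "{Inf L}" L'] by (simp add: supp)
    then show "avg 0 L' = avg 0 L" by (simp only: avg_0)
  qed (simp_all only: supp, simp_all add: avg_0)
qed

text \<open>The first block has \<open>Inf L\<close> terms because the support of the first
  \<zeta>-average starts at the minimum of \<open>L\<close>. The coefficients are nonnegative, so
  nothing cancels in the mean and its support is the whole union.\<close>

lemma coherent_osucc_props:
  assumes coh: "coherent \<zeta>" and L: "index_set L"
  shows "avg (osucc \<zeta>) L = (\<lambda>i. (1 / real (Inf L)) * (\<Sum>j<Inf L. ra \<zeta> L j i))"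
    and "supp (avg (osucc \<zeta>) L) = L - remainder \<zeta> L (Inf L)"
proof -
  show 1: "avg (osucc \<zeta>) L = (\<lambda>i. (1 / real (Inf L)) * (\<Sum>j<Inf L. ra \<zeta> L j i))"
    using coherent_Inf_supp[OF coh L]
    by (simp add: repeated_average_osucc succ_average_def block_length_def)
  have "supp (avg (osucc \<zeta>) L) = (\<Union>j<Inf L. supp (ra \<zeta> L j))"
    using index_set_Inf(2)[OF L] coherent_ra(1)[OF coh L]
    by (auto simp: 1 supp_def sum_nonneg_eq_0_iff)
  then show "supp (avg (osucc \<zeta>) L) = L - remainder \<zeta> L (Inf L)"
    using coherent_UN_supp[OF coh L] by simp
qed

lemma coherent_osucc:
  assumes coh: "coherent \<zeta>"
  shows "coherent (osucc \<zeta>)"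
proof -
  \<comment> \<open>After \<open>n\<close> blocks the remainder of order
    \<open>osucc \<zeta>\<close> is the remainder of order \<zeta> at the start of the next block,
    so the next block is the first block of that remainder.\<close>
  have rem: "ra (osucc \<zeta>) L n = avg (osucc \<zeta>) (remainder (osucc \<zeta>) L n) \<and>
      remainder (osucc \<zeta>) L n = remainder \<zeta> L (block_start (ra \<zeta> L) n)"
    if L: "index_set L" for L n
  proof (induction n)
    case (Suc n)
    let ?k = "block_start (ra \<zeta> L) n"
    let ?R = "remainder \<zeta> L ?k"
    have R: "index_set ?R" by (rule index_set_remainder[OF L])
    have start: "block_start (ra \<zeta> L) (Suc n) = ?k + Inf ?R"
      using coherent_ra(4)[OF coh L] by simp
    have "remainder (osucc \<zeta>) L (Suc n) = ?R - supp (avg (osucc \<zeta>) ?R)" using Suc by simp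
    also have "\<dots> = remainder \<zeta> ?R (Inf ?R)"
      using coherent_osucc_props(2)[OF coh R] remainder_antimono[of 0 "Inf ?R" \<zeta> ?R] by auto
    finally have r: "remainder (osucc \<zeta>) L (Suc n) = remainder \<zeta> L (block_start (ra \<zeta> L) (Suc n))"
      by (simp only: start remainder_add)
    let ?k' = "block_start (ra \<zeta> L) (Suc n)"
    let ?R' = "remainder \<zeta> L ?k'"
    have R': "index_set ?R'" by (rule index_set_remainder[OF L])
    have len: "block_length (ra \<zeta> L) (Suc n) = Inf ?R'"
      using coherent_ra(4)[OF coh L] by (simp only: block_length_def)
    have "ra (osucc \<zeta>) L (Suc n) = avg (osucc \<zeta>) ?R'"
      unfolding coherent_osucc_props(1)[OF coh R']
      by (simp only: repeated_average_osucc succ_average_def len coherent_ra_shift[OF coh L])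
    then show ?case by (simp only: r)
  qed simp
  show ?thesis
    unfolding coherent_def
  proof (intro allI impI conjI)
    fix L assume L: "index_set L"
    note props = coherent_osucc_props[OF coh L]
    let ?s = "Inf L"
    have s: "?s \<ge> 1" using index_set_Inf(2)[OF L] .
    show "avg (osucc \<zeta>) L i \<ge> 0" for i
      using coherent_ra(1)[OF coh L] by (simp add: props(1) sum_nonneg)
    have U: "supp (avg (osucc \<zeta>) L) = (\<Union>j<?s. supp (ra \<zeta> L j))"
      using coherent_UN_supp[OF coh L] props(2) by simp
    show ne: "supp (avg (osucc \<zeta>) L) \<noteq> {}" using coherentD(2)[OF coh L] s U by fastforce
    show "initial_segment (supp (avg (osucc \<zeta>) L)) L"
      using coherent_initial_segment[OF coh L] props(2) by simp
    have fin: "finite (supp (avg (osucc \<zeta>) L))" by (rule finite_supp_ra[OF L])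
    have "sum (ra \<zeta> L j) (supp (avg (osucc \<zeta>) L)) = 1" if "j < ?s" for j
    proof -
      have "sum (ra \<zeta> L j) (supp (avg (osucc \<zeta>) L)) = sum (ra \<zeta> L j) (supp (ra \<zeta> L j))"
        by (rule sum.mono_neutral_right[OF fin]) (use that U in \<open>auto simp: supp_def\<close>)
      then show ?thesis using coherent_ra(2)[OF coh L] by simp
    qed
    then have "(\<Sum>j<?s. sum (ra \<zeta> L j) (supp (avg (osucc \<zeta>) L))) = real ?s" by simp
    moreover have "sum (avg (osucc \<zeta>) L) (supp (avg (osucc \<zeta>) L)) =
        (1 / real ?s) * (\<Sum>j<?s. sum (ra \<zeta> L j) (supp (avg (osucc \<zeta>) L)))"
      by (subst (1) props(1), subst sum.swap) (simp add: sum_distrib_left)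
    ultimately show "sum (avg (osucc \<zeta>) L) (supp (avg (osucc \<zeta>) L)) = 1" using s by simp
    show "ra (osucc \<zeta>) L n = avg (osucc \<zeta>) (remainder (osucc \<zeta>) L n)" for n using rem[OF L, of n] by simp
    fix L' assume L': "index_set L'" and I: "initial_segment (supp (avg (osucc \<zeta>) L)) L'"
    have "initial_segment (supp (avg (osucc \<zeta>) L)) L"
      using coherent_initial_segment[OF coh L] props(2) by simp
    then have s': "Inf L' = ?s" using Inf_initial_segment[OF I ne] Inf_initial_segment[OF _ ne] by simp
    have "\<forall>j<?s. ra \<zeta> L' j = ra \<zeta> L j"
      using coherent_determined[OF coh L L', of ?s] I props(2) by simp
    then show "avg (osucc \<zeta>) L' = avg (osucc \<zeta>) L"
      unfolding props(1) coherent_osucc_props(1)[OF coh L'] s' by simp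
  qed
qed

lemma avg_limit:
  assumes "is_limit \<xi>" "index_set L"
  shows "avg \<xi> L = avg (\<phi> \<xi> (Inf L)) L"
  using repeated_average_limit[OF limit_sequences assms(1)] assms(2)
  by (simp add: limit_average_def index_set_def)

text \<open>By \<open>avg_limit\<close> the first average has order
  \<open>\<phi> \<xi> (Inf L)\<close>. A set with the same nonempty initial segment has the same
  minimum, hence uses the same order, and coherence is inherited from there.\<close>

lemma coherent_limit:
  assumes lim: "is_limit \<xi>" and coh: "\<And>\<eta>. \<eta> < \<xi> \<Longrightarrow> coherent \<eta>"
  shows "coherent \<xi>"
  unfolding coherent_def
proof (intro allI impI)
  fix L assume L: "index_set L"
  let ?F = "\<lambda>m N. avg (\<phi> \<xi> m) N"
  have c: "coherent (\<phi> \<xi> (Inf L))"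
    using coh limit_sequences_less[OF limit_sequences lim index_set_Inf(2)[OF L]] .
  have set: "limit_set ?F L n = remainder \<xi> L n" for n
    by (induction n) (simp_all add: avg_limit[OF lim index_set_remainder[OF L]])
  have "ra \<xi> L n = limit_average ?F L n" for n
    using repeated_average_limit[OF limit_sequences lim] L by (simp add: index_set_def)
  then have "ra \<xi> L n = avg \<xi> (remainder \<xi> L n)" for n
    using avg_limit[OF lim index_set_remainder[OF L]] by (simp add: limit_average_def set)
  moreover have "avg \<xi> L' = avg \<xi> L"
    if L': "index_set L'" and I: "initial_segment (supp (avg \<xi> L)) L'" for L'
  proof -
    have "supp (avg \<xi> L) \<noteq> {}" "initial_segment (supp (avg \<xi> L)) L"
      using coherentD(2,3)[OF c L] avg_limit[OF lim L] by auto
    then have "Inf L' = Inf L" using Inf_initial_segment I by metis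
    then show ?thesis
      using coherentD(6)[OF c L L'] I avg_limit[OF lim L] avg_limit[OF lim L'] by simp
  qed
  ultimately show "(\<forall>i. avg \<xi> L i \<ge> 0) \<and> supp (avg \<xi> L) \<noteq> {} \<and> initial_segment (supp (avg \<xi> L)) L \<and>
     sum (avg \<xi> L) (supp (avg \<xi> L)) = 1 \<and>
     (\<forall>n. ra \<xi> L n = avg \<xi> (remainder \<xi> L n)) \<and>
     (\<forall>L'. index_set L' \<longrightarrow> initial_segment (supp (avg \<xi> L)) L' \<longrightarrow> avg \<xi> L' = avg \<xi> L)"
    using coherentD(1-4)[OF c L, folded avg_limit[OF lim L]] by blast
qed

lemma coherent: "coherent \<xi>"
  by (induction \<xi> rule: omega1_induct) (simp_all add: coherent_0 coherent_osucc coherent_limit)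

end

section \<open>Schreier families and large families\<close>

context repeated_averages
begin

lemmas avg_nonneg = coherentD(1)[OF coherent]
  and supp_avg_nonempty = coherentD(2)[OF coherent]
  and ra_eq_avg = coherentD(5)[OF coherent]
  and ra_nonneg = coherent_ra(1)[OF coherent]
  and sum_ra_supp = coherent_ra(2)[OF coherent]
  and supp_ra_subset = coherent_ra(3)[OF coherent]
  and Inf_supp_ra = coherent_ra(4)[OF coherent]
  and ra_shift = coherent_ra_shift[OF coherent]
  and avg_osucc = coherent_osucc_props(1)[OF coherent]
  and supp_avg_osucc = coherent_osucc_props(2)[OF coherent]
  and remainder_initial_segment = coherent_initial_segment[OF coherent]

lemma remainder_subset: "remainder \<xi> L n \<subseteq> L"
  using remainder_antimono[of 0 n] by simp

lemma sum_ra_superset: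
  assumes "index_set L" "finite F" "supp (ra \<xi> L n) \<subseteq> F"
  shows "sum (ra \<xi> L n) F = 1"
proof -
  have "sum (ra \<xi> L n) F = sum (ra \<xi> L n) (supp (ra \<xi> L n))"
    by (rule sum.mono_neutral_right[OF assms(2,3)]) (auto simp: supp_def)
  then show ?thesis using sum_ra_supp[OF assms(1)] by simp
qed

lemma sum_ra_le_1:
  assumes "index_set L" "finite F"
  shows "sum (ra \<xi> L n) F \<le> 1"
proof -
  have "sum (ra \<xi> L n) F \<le> sum (ra \<xi> L n) (F \<union> supp (ra \<xi> L n))"
    using assms finite_supp_ra ra_nonneg by (intro sum_mono2) auto
  also have "\<dots> = 1" using assms finite_supp_ra by (intro sum_ra_superset) auto
  finally show ?thesis .
qed

lemma sum_avg_osucc: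
  assumes "index_set L"
  shows "sum (avg (osucc \<zeta>) L) F = (\<Sum>j<Inf L. sum (ra \<zeta> L j) F) / real (Inf L)"
  unfolding avg_osucc[OF assms] by (subst sum.swap) (simp add: sum_divide_distrib)

text \<open>A property of the first \<open>k\<close> averages is clopen by
  \<open>coherent_determined\<close>.\<close>

lemma averages_ramsey:
  assumes M: "index_set M"
    and det: "\<And>L L'. index_set L \<Longrightarrow> index_set L' \<Longrightarrow> (\<forall>j<k. ra \<xi> L' j = ra \<xi> L j) \<Longrightarrow> P L' = P L"
  shows "\<exists>N\<subseteq>M. infinite N \<and> ((\<forall>L\<subseteq>N. infinite L \<longrightarrow> P L) \<or> (\<forall>L\<subseteq>N. infinite L \<longrightarrow> \<not> P L))"
proof (rule clopen_ramsey)
  show "infinite M" "M \<subseteq> {1..}" using M by (auto simp: index_set_def)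
  fix L :: "nat set" assume "infinite L" "L \<subseteq> {1..}"
  then have L: "index_set L" by (simp add: index_set_def)
  show "\<exists>E. initial_segment E L \<and>
    (\<forall>L'. infinite L' \<longrightarrow> L' \<subseteq> {1..} \<longrightarrow> initial_segment E L' \<longrightarrow> P L' = P L)"
  proof (intro exI conjI allI impI)
    show "initial_segment (L - remainder \<xi> L k) L" by (rule remainder_initial_segment[OF L])
    fix L' :: "nat set"
    assume "infinite L'" "L' \<subseteq> {1..}" and I: "initial_segment (L - remainder \<xi> L k) L'"
    then have L': "index_set L'" by (simp add: index_set_def)
    show "P L' = P L"
      using coherent_determined[OF coherent L L' I] by (intro det[OF L L']) simp
  qed
qed

text \<open>In the limit step any \<open>n \<le> min F\<close> may be used, not only \<open>n = min F\<close> as for the averages: this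
  makes the families closed under spreading.\<close>

inductive schreier :: "omega1 \<Rightarrow> nat set \<Rightarrow> bool"
  and blocks :: "omega1 \<Rightarrow> nat \<Rightarrow> nat set \<Rightarrow> bool" where
  schreier_zero: "F \<subseteq> {n} \<Longrightarrow> schreier 0 F"
| schreier_osucc: "blocks \<zeta> n F \<Longrightarrow> F \<subseteq> {n..} \<Longrightarrow> schreier (osucc \<zeta>) F"
| schreier_limit: "is_limit \<xi> \<Longrightarrow> n \<ge> 1 \<Longrightarrow> schreier (\<phi> \<xi> n) F \<Longrightarrow> F \<subseteq> {n..} \<Longrightarrow> schreier \<xi> F"
| blocks_zero: "blocks \<zeta> 0 {}"
| blocks_Suc: "schreier \<zeta> G \<Longrightarrow> blocks \<zeta> k H \<Longrightarrow> (\<And>g h. g \<in> G \<Longrightarrow> h \<in> H \<Longrightarrow> g < h) \<Longrightarrow>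
    blocks \<zeta> (Suc k) (G \<union> H)"

lemma schreier_zeroD: "schreier 0 F \<Longrightarrow> \<exists>n. F \<subseteq> {n}"
  by (erule schreier.cases) (auto simp: osucc_neq_zero[symmetric])

lemma schreier_osuccD: "schreier (osucc \<zeta>) F \<Longrightarrow> \<exists>n. blocks \<zeta> n F \<and> F \<subseteq> {n..}"
  by (erule schreier.cases) auto

lemma schreier_limitD:
  "schreier \<xi> F \<Longrightarrow> is_limit \<xi> \<Longrightarrow> \<exists>n\<ge>1. schreier (\<phi> \<xi> n) F \<and> F \<subseteq> {n..}"
  by (erule schreier.cases) auto

lemma blocks_zeroD: "blocks \<zeta> 0 F \<Longrightarrow> F = {}"
  by (erule blocks.cases) auto

lemma blocks_SucD: "blocks \<zeta> (Suc k) F \<Longrightarrow>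
  \<exists>G H. F = G \<union> H \<and> schreier \<zeta> G \<and> blocks \<zeta> k H \<and> (\<forall>g\<in>G. \<forall>h\<in>H. g < h)"
  by (erule blocks.cases) auto

lemma schreier_finite: "schreier \<xi> F \<Longrightarrow> finite F"
  and blocks_finite: "blocks \<zeta> k H \<Longrightarrow> finite H"
proof (induction rule: schreier_blocks.inducts)
  case (schreier_zero F n)
  then show ?case by (rule finite_subset) simp
qed auto

lemma schreier_subset: "schreier \<xi> F \<Longrightarrow> F' \<subseteq> F \<Longrightarrow> schreier \<xi> F'"
  and blocks_subset: "blocks \<zeta> k H \<Longrightarrow> H' \<subseteq> H \<Longrightarrow> blocks \<zeta> k H'"
proof (induction arbitrary: F' and H' rule: schreier_blocks.inducts)
  case (schreier_zero F n)
  then show ?case by (meson order_trans schreier_blocks.schreier_zero)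
next
  case (schreier_osucc \<zeta> n F)
  then show ?case by (meson order_trans schreier_blocks.schreier_osucc)
next
  case (schreier_limit \<xi> n F)
  then show ?case by (meson order_trans schreier_blocks.schreier_limit)
next
  case (blocks_zero \<zeta>)
  then show ?case using schreier_blocks.blocks_zero by simp
next
  case (blocks_Suc \<zeta> G k H)
  have "blocks \<zeta> (Suc k) (H' \<inter> G \<union> H' \<inter> H)"
    using blocks_Suc by (intro schreier_blocks.blocks_Suc) auto
  moreover have "H' \<inter> G \<union> H' \<inter> H = H'" using blocks_Suc.prems by auto
  ultimately show ?case by simp
qed

lemma schreier_spread:
    "schreier \<xi> F \<Longrightarrow> strict_mono_on F g \<Longrightarrow> (\<And>i. i \<in> F \<Longrightarrow> i \<le> g i) \<Longrightarrow> schreier \<xi> (g ` F)"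
  and blocks_spread:
    "blocks \<zeta> k H \<Longrightarrow> strict_mono_on H g \<Longrightarrow> (\<And>i. i \<in> H \<Longrightarrow> i \<le> g i) \<Longrightarrow> blocks \<zeta> k (g ` H)"
proof (induction rule: schreier_blocks.inducts)
  case (schreier_zero F n)
  then have "g ` F \<subseteq> {g n}" by auto
  then show ?case by (rule schreier_blocks.schreier_zero)
next
  case (schreier_osucc \<zeta> n F)
  then show ?case by (intro schreier_blocks.schreier_osucc[of \<zeta> n]) (auto intro: order_trans)
next
  case (schreier_limit \<xi> n F)
  then show ?case by (intro schreier_blocks.schreier_limit[of \<xi> n]) (auto intro: order_trans)
next
  case (blocks_zero \<zeta>)
  then show ?case using schreier_blocks.blocks_zero by simp
next
  case (blocks_Suc \<zeta> G k H)
  have "blocks \<zeta> (Suc k) (g ` G \<union> g ` H)"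
  proof (rule schreier_blocks.blocks_Suc)
    show "schreier \<zeta> (g ` G)"
      by (rule blocks_Suc(2)) (use blocks_Suc.prems in \<open>auto intro: monotone_on_subset\<close>)
    show "blocks \<zeta> k (g ` H)"
      by (rule blocks_Suc(4)) (use blocks_Suc.prems in \<open>auto intro: monotone_on_subset\<close>)
    fix a b assume "a \<in> g ` G" "b \<in> g ` H"
    then show "a < b" using blocks_Suc(5) blocks_Suc.prems(1)
      by (auto simp: strict_mono_on_def)
  qed
  then show ?case by (simp add: image_Un)
qed

lemma blocks_remainder:
  assumes "\<And>L. index_set L \<Longrightarrow> schreier \<zeta> (supp (avg \<zeta> L))" "index_set L"
  shows "blocks \<zeta> k (L - remainder \<zeta> L k)"
  using assms(2)
proof (induction k arbitrary: L)
  case 0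
  then show ?case by (simp add: blocks_zero)
next
  case (Suc k)
  let ?R = "remainder \<zeta> L 1"
  have I: "initial_segment (supp (avg \<zeta> L)) L" by (rule coherentD(3)[OF coherent Suc.prems])
  have "blocks \<zeta> (Suc k) (supp (avg \<zeta> L) \<union> (?R - remainder \<zeta> ?R k))"
  proof (rule blocks_Suc)
    show "schreier \<zeta> (supp (avg \<zeta> L))" by (rule assms(1)[OF Suc.prems])
    show "blocks \<zeta> k (?R - remainder \<zeta> ?R k)"
      by (rule Suc.IH[OF index_set_remainder[OF Suc.prems]])
  qed (use I in \<open>auto simp: initial_segment_def\<close>)
  moreover have "supp (avg \<zeta> L) \<union> (?R - remainder \<zeta> ?R k) = L - remainder \<zeta> L (Suc k)"
    using remainder_add[of \<zeta> L 1 k] remainder_subset[of \<zeta> ?R k] I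
    by (auto simp: initial_segment_def)
  ultimately show ?case by simp
qed

lemma schreier_supp_avg: "index_set L \<Longrightarrow> schreier \<xi> (supp (avg \<xi> L))"
proof (induction \<xi> arbitrary: L rule: omega1_induct)
  case zero
  show ?case by (rule schreier_zero[of _ "Inf L"]) (auto simp: avg_0 supp_def indicator_def)
next
  case (succ \<zeta>)
  have "blocks \<zeta> (Inf L) (supp (avg (osucc \<zeta>) L))"
    using blocks_remainder[OF succ.IH succ.prems] supp_avg_osucc[OF succ.prems] by simp
  then show ?case
    using index_set_Inf(3)[OF succ.prems] supp_avg_osucc[OF succ.prems]
    by (intro schreier_osucc[of \<zeta> "Inf L"]) auto
next
  case (limit \<xi>)
  let ?n = "Inf L"
  have n: "?n \<ge> 1" by (rule index_set_Inf(2)[OF limit.prems])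
  show ?case
  proof (rule schreier_limit[OF limit.hyps n])
    show "schreier (\<phi> \<xi> ?n) (supp (avg \<xi> L))"
      using limit.IH[OF limit_sequences_less[OF limit_sequences limit.hyps n] limit.prems]
        avg_limit[OF limit.hyps limit.prems] by simp
    show "supp (avg \<xi> L) \<subseteq> {?n..}"
      using coherentD(3)[OF coherent limit.prems, of \<xi>] index_set_Inf(3)[OF limit.prems]
      by (auto simp: initial_segment_def)
  qed
qed

section \<open>Families measured by the averages\<close>

definition large :: "nat set set \<Rightarrow> omega1 \<Rightarrow> real \<Rightarrow> nat set \<Rightarrow> bool" where
  "large \<F> \<xi> \<epsilon> M \<longleftrightarrow> (\<forall>L\<subseteq>M. infinite L \<longrightarrow> (\<exists>F\<in>\<F>. \<epsilon> \<le> sum (avg \<xi> L) F))"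

definition below :: "nat set set \<Rightarrow> omega1 \<Rightarrow> real \<Rightarrow> nat set \<Rightarrow> bool" where
  "below \<F> \<xi> \<epsilon> M \<longleftrightarrow> (\<forall>L\<subseteq>M. infinite L \<longrightarrow> (\<forall>F\<in>\<F>. sum (avg \<xi> L) F < \<epsilon>))"

text \<open>Being \<open>below\<close> is asked of densely many sets, the form that fusion accepts
  at limit ordinals. By Ramsey's theorem it holds on \<open>M\<close> as soon as \<open>\<F>\<close>
  is large on no infinite subset of \<open>M\<close>; this is used in
  \<open>large_antimono\<close>.\<close>

definition small :: "nat set set \<Rightarrow> omega1 \<Rightarrow> real \<Rightarrow> nat set \<Rightarrow> bool" where
  "small \<F> \<xi> \<epsilon> M \<longleftrightarrow> (\<forall>N\<subseteq>M. infinite N \<longrightarrow>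
     (\<exists>N'\<subseteq>N. infinite N' \<and> below \<F> \<xi> \<epsilon> N'))"

text \<open>A successor ordinal above \<eta> has a predecessor not below \<eta>. An average of order
  \<open>\<phi> \<xi> n\<close> is a mean of averages of that predecessor order, to which the
  induction hypothesis of \<open>small_mono\<close> applies.\<close>

lemma limit_sequence_eventually:
  assumes "is_limit \<xi>" "\<eta> < \<xi>"
  shows "\<exists>n0\<ge>1. \<forall>n\<ge>n0. \<exists>\<theta>\<ge>\<eta>. \<phi> \<xi> n = osucc \<theta>"
proof -
  have L: "strict_mono_on {1..} (\<phi> \<xi>)" "\<And>n. n \<ge> 1 \<Longrightarrow> is_succ (\<phi> \<xi> n)"
    "(\<forall>n\<ge>1. \<phi> \<xi> n \<le> \<eta>) \<longleftrightarrow> \<xi> \<le> \<eta>"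
    using limit_sequences assms(1) by (auto simp: limit_sequences_def)
  from L(3) assms(2) have "\<not> (\<forall>n\<ge>1. \<phi> \<xi> n \<le> \<eta>)" by (simp add: not_le)
  then obtain n0 where n0: "n0 \<ge> 1" "\<eta> < \<phi> \<xi> n0" by (auto simp: not_le)
  have "\<exists>\<theta>\<ge>\<eta>. \<phi> \<xi> n = osucc \<theta>" if n: "n \<ge> n0" for n
  proof -
    have "\<phi> \<xi> n0 \<le> \<phi> \<xi> n"
      using n n0(1) L(1) by (cases "n = n0") (auto simp: strict_mono_on_def order.order_iff_strict)
    then have "\<eta> < \<phi> \<xi> n" using n0(2) by simp
    moreover obtain \<theta> where "\<phi> \<xi> n = osucc \<theta>" using L(2)[of n] n n0(1) by (auto simp: is_succ_def)
    ultimately show ?thesis by (metis osucc_le_iff not_le)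
  qed
  then show ?thesis using n0(1) by blast
qed

text \<open>At a limit ordinal the first average of \<open>L\<close> with minimum \<open>m\<close> is a mean of \<open>m\<close> averages of one
  order \<open>\<theta> m\<close>, all but the first of which live on elements beyond \<open>m\<close> and can be kept small by
  fusion, as \<open>\<theta> m\<close> is known once \<open>m\<close> is chosen.\<close>

lemma small_mono:
  assumes fin: "\<And>F. F \<in> \<F> \<Longrightarrow> finite F" and M: "index_set M"
    and small: "small \<F> \<eta> \<epsilon> M" and "\<eta> \<le> \<xi>" "\<epsilon> < \<epsilon>'"
  shows "small \<F> \<xi> \<epsilon>' M"
  using assms(4,5)
proof (induction \<xi> arbitrary: \<epsilon>' rule: less_induct)
  case (less \<xi>)
  show ?case
  proof (cases "\<xi> = \<eta>")
    case True
    have "below \<F> \<xi> \<epsilon>' N" if "below \<F> \<xi> \<epsilon> N" for N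
      using that less.prems(2) unfolding below_def by (meson less_trans)
    then show ?thesis using small True unfolding small_def by blast
  next
    case False
    then have lt: "\<eta> < \<xi>" using less.prems(1) by simp
    show ?thesis
    proof (cases \<xi> rule: omega1_cases)
      case zero
      then show ?thesis using lt by (metis not_le zero_le_omega1)
    next
      case (succ \<theta>)
      then have \<theta>: "\<eta> \<le> \<theta>" "\<theta> < \<xi>" using lt osucc_le_iff[of \<theta> \<eta>] by (auto simp: not_less)
      have sm: "small \<F> \<theta> \<epsilon>' M" using less.IH[OF \<theta>(2,1) less.prems(2)] .
      show ?thesis
        unfolding small_def
      proof (intro allI impI)
        fix N assume N: "N \<subseteq> M" "infinite N"
        then obtain N' where N': "N' \<subseteq> N" "infinite N'" and below: "below \<F> \<theta> \<epsilon>' N'"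
          using sm unfolding small_def by blast
        have "sum (avg \<xi> L) F < \<epsilon>'" if L: "L \<subseteq> N'" "infinite L" and F: "F \<in> \<F>" for L F
        proof -
          have iL: "index_set L" using index_set_subset[OF M] L N' N by blast
          have pos: "Inf L \<ge> 1" by (rule index_set_Inf(2)[OF iL])
          have "sum (ra \<theta> L j) F < \<epsilon>'" for j
            unfolding ra_eq_avg[OF iL, of \<theta> j]
            using index_set_remainder[OF iL, of \<theta> j] remainder_subset[of \<theta> L j] L(1) F below
            unfolding below_def index_set_def by (meson order_trans)
          then have "(\<Sum>j<Inf L. sum (ra \<theta> L j) F) < (\<Sum>j<Inf L. \<epsilon>')"
            using pos by (intro sum_strict_mono) (auto simp: lessThan_empty_iff)
          then show ?thesis using pos by (simp add: succ sum_avg_osucc[OF iL] field_simps)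
        qed
        then show "\<exists>N'\<subseteq>N. infinite N' \<and> below \<F> \<xi> \<epsilon>' N'"
          using N' unfolding below_def by (intro exI[of _ N']) simp
      qed
    next
      case limit
      obtain n0 where n0: "n0 \<ge> 1" "\<forall>n\<ge>n0. \<exists>\<theta>\<ge>\<eta>. \<phi> \<xi> n = osucc \<theta>"
        using limit_sequence_eventually[OF limit lt] by blast
      then obtain \<theta> where \<theta>: "\<And>n. n \<ge> n0 \<Longrightarrow> \<eta> \<le> \<theta> n" "\<And>n. n \<ge> n0 \<Longrightarrow> \<phi> \<xi> n = osucc (\<theta> n)"
        by metis
      have \<theta>_less: "\<theta> n < \<xi>" if "n \<ge> n0" for n
      proof -
        have "\<theta> n < \<phi> \<xi> n" using \<theta>(2)[OF that] by simp
        also have "\<phi> \<xi> n < \<xi>" using limit_sequences_less[OF limit_sequences limit] n0(1) that by simp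
        finally show ?thesis .
      qed
      \<comment> \<open>Half of the gap is spent on the induction hypothesis; the other half absorbs
        the first average in each mean.\<close>
      define \<delta> where "\<delta> = (\<epsilon> + \<epsilon>') / 2"
      have \<delta>: "\<epsilon> < \<delta>" "\<delta> < \<epsilon>'" using less.prems(2) by (auto simp: \<delta>_def)
      show ?thesis
        unfolding small_def
      proof (intro allI impI)
        fix N assume N: "N \<subseteq> M" "infinite N"
        define D where "D = (\<lambda>n N'. n \<ge> n0 \<longrightarrow> below \<F> (\<theta> n) \<delta> N')"
        have "\<exists>N'\<subseteq>N. infinite N' \<and> D 0 N' \<and> (\<forall>n\<in>N'. \<forall>k\<le>Suc n. D k (N' \<inter> {n<..}))"
        proof (rule fusion[OF N(2)])
          fix n A assume A: "infinite A" "A \<subseteq> N"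
          show "\<exists>N'\<subseteq>A. infinite N' \<and> D n N'"
          proof (cases "n \<ge> n0")
            case True
            then have "small \<F> (\<theta> n) \<delta> M" using less.IH \<theta>_less \<theta>(1) \<delta>(1) by blast
            then show ?thesis using A N unfolding small_def D_def by (meson order_trans)
          next
            case False
            then show ?thesis using A by (auto simp: D_def)
          qed
        qed (auto simp: D_def below_def)
        then obtain N1 where N1: "N1 \<subseteq> N" "infinite N1" "\<And>n. n \<in> N1 \<Longrightarrow> D n (N1 \<inter> {n<..})"
          by (metis le_SucI order.refl)
        \<comment> \<open>The first average has mass at most \<open>1\<close>, so it adds at most
          \<open>1 / m\<close> to a mean of \<open>m\<close> terms; \<open>m > m0\<close> makes this
          less than \<open>\<epsilon>' - \<delta>\<close>.\<close>
        obtain m0 :: nat where m0: "n0 \<le> m0" "1 / (\<epsilon>' - \<delta>) < real m0"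
          by (metis le_cases le_less_trans less_le_trans of_nat_mono of_nat_le_iff reals_Archimedean2)
        define N2 where "N2 = N1 \<inter> {m0<..}"
        have N2: "N2 \<subseteq> N1" "infinite N2" using infinite_Int_greaterThan[OF N1(2)] by (auto simp: N2_def)
        have "sum (avg \<xi> L) F < \<epsilon>'" if L: "L \<subseteq> N2" "infinite L" and F: "F \<in> \<F>" for L F
        proof -
          have iL: "index_set L" using index_set_subset[OF M] L N2 N1 N by blast
          define m where "m = Inf L"
          have m: "m \<in> L" using index_set_Inf(1)[OF iL] by (simp add: m_def)
          then have m2: "m \<in> N1" "m0 < m" using L(1) by (auto simp: N2_def)
          then have mn0: "m \<ge> n0" "m \<ge> 1" using m0(1) n0(1) by auto
          have "sum (ra (\<theta> m) L (Suc j)) F \<le> \<delta>" for j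
          proof -
            have "remainder (\<theta> m) L (Suc j) \<subseteq> remainder (\<theta> m) L 1"
              by (rule remainder_antimono) simp
            also have "\<dots> \<subseteq> L - {m}"
            proof -
              have I: "initial_segment (supp (avg (\<theta> m) L)) L" "supp (avg (\<theta> m) L) \<noteq> {}"
                using coherentD(2,3)[OF coherent iL] by auto
              have "m \<in> supp (avg (\<theta> m) L)"
                using Inf_initial_segment[OF I] I(2) by (metis Inf_nat_def1 m_def)
              then show ?thesis by auto
            qed
            also have "\<dots> \<subseteq> N1 \<inter> {m<..}"
              using L(1) index_set_Inf(3)[OF iL] by (fastforce simp: m_def N2_def le_neq_implies_less)
            finally have "remainder (\<theta> m) L (Suc j) \<subseteq> N1 \<inter> {m<..}" .
            moreover have "infinite (remainder (\<theta> m) L (Suc j))"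
              using index_set_remainder[OF iL] unfolding index_set_def by blast
            ultimately show ?thesis
              unfolding ra_eq_avg[OF iL, of _ "Suc j"]
              using N1(3)[OF m2(1)] mn0(1) F unfolding D_def below_def by (meson less_imp_le)
          qed
          then have "(\<Sum>j<m. sum (ra (\<theta> m) L j) F) \<le> (\<Sum>j<m. (if j = 0 then 1 else \<delta>))"
            using sum_ra_le_1[OF iL fin[OF F]]
            by (intro sum_mono) (metis gr0_implies_Suc neq0_conv)
          also have "\<dots> \<le> 1 + (\<Sum>j<m. \<delta>)"
          proof -
            have nn: "0 \<le> \<delta>"
            proof -
              have "0 \<le> sum (ra (\<theta> m) L (Suc 0)) F" using ra_nonneg[OF iL] by (simp add: sum_nonneg)
              then show ?thesis using \<open>\<And>j. sum (ra (\<theta> m) L (Suc j)) F \<le> \<delta>\<close>[of 0] by linarith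
            qed
            have "(\<Sum>j<m. (if j = 0 then 1 else \<delta>)) \<le> (\<Sum>j<m. (if j = 0 then 1 else 0) + \<delta>)"
              using nn by (intro sum_mono) auto
            also have "\<dots> = 1 + (\<Sum>j<m. \<delta>)" using mn0(2) by (simp add: sum.distrib)
            finally show ?thesis .
          qed
          finally have "(\<Sum>j<m. sum (ra (\<theta> m) L j) F) \<le> 1 + real m * \<delta>" by simp
          moreover have "sum (avg \<xi> L) F = (\<Sum>j<m. sum (ra (\<theta> m) L j) F) / real m"
            using avg_limit[OF limit iL] \<theta>(2)[OF mn0(1)] sum_avg_osucc[OF iL, of "\<theta> m" F]
            by (simp add: m_def)
          moreover have "1 < real m * (\<epsilon>' - \<delta>)"
          proof -
            have "1 / (\<epsilon>' - \<delta>) < real m" using m0(2) m2(2) by linarith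
            then show ?thesis using \<delta> by (simp add: field_simps)
          qed
          ultimately show ?thesis using mn0(2) by (simp add: pos_divide_less_eq algebra_simps)
        qed
        then show "\<exists>N'\<subseteq>N. infinite N' \<and> below \<F> \<xi> \<epsilon>' N'"
          using N2 N1 unfolding below_def by (intro exI[of _ N2]) auto
      qed
    qed
  qed
qed

text \<open>If no infinite subset of \<open>M\<close> were large at \<eta>, Ramsey's theorem would
  find inside every infinite subset one on which the averages of order \<eta> stay below
  \<open>\<epsilon>'\<close>. This smallness rises to \<xi> by \<open>small_mono\<close>, with
  \<open>\<epsilon>'\<close> replaced by \<open>\<epsilon>\<close>, and contradicts largeness
  there.\<close>

lemma large_antimono:
  assumes fin: "\<And>F. F \<in> \<F> \<Longrightarrow> finite F" and M: "index_set M"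
    and large: "large \<F> \<xi> \<epsilon> M" and "\<eta> \<le> \<xi>" "\<epsilon>' < \<epsilon>"
  shows "\<exists>N\<subseteq>M. infinite N \<and> large \<F> \<eta> \<epsilon>' N"
proof (rule ccontr)
  assume contra: "\<not> ?thesis"
  have "small \<F> \<eta> \<epsilon>' M"
    unfolding small_def
  proof (intro allI impI)
    fix N assume N: "N \<subseteq> M" "infinite N"
    then have iN: "index_set N" using index_set_subset[OF M] by blast
    have "\<exists>N'\<subseteq>N. infinite N' \<and> ((\<forall>L\<subseteq>N'. infinite L \<longrightarrow> (\<exists>F\<in>\<F>. \<epsilon>' \<le> sum (avg \<eta> L) F)) \<or>
        (\<forall>L\<subseteq>N'. infinite L \<longrightarrow> \<not> (\<exists>F\<in>\<F>. \<epsilon>' \<le> sum (avg \<eta> L) F)))"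
      by (rule averages_ramsey[OF iN, where k = 1 and \<xi> = \<eta>]) simp
    then obtain N' where N': "N' \<subseteq> N" "infinite N'" "large \<F> \<eta> \<epsilon>' N' \<or> below \<F> \<eta> \<epsilon>' N'"
      unfolding large_def below_def by (force simp: not_le)
    then show "\<exists>N'\<subseteq>N. infinite N' \<and> below \<F> \<eta> \<epsilon>' N'"
      using contra N(1) by (meson order_trans)
  qed
  then have "small \<F> \<xi> \<epsilon> M" using small_mono[OF fin M] assms(4,5) by blast
  then obtain N' where "N' \<subseteq> M" "infinite N'"
    "below \<F> \<xi> \<epsilon> N'"
    using M unfolding small_def index_set_def by blast
  then show False using large unfolding large_def below_def by (meson leD order.refl)
qed

end

section \<open>Large families contain Schreier families\<close>

definition hereditary :: "'i set set \<Rightarrow> bool" where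
  "hereditary \<F> \<longleftrightarrow> (\<forall>F\<in>\<F>. finite F \<and> (\<forall>G\<subseteq>F. G \<in> \<F>))"

text \<open>Only the values of \<open>\<mu>\<close> from \<open>n\<close> on have to lie in \<open>N\<close>; this slack keeps the index of an element
  under control when sets are chosen one after the other.\<close>

definition captures :: "nat \<Rightarrow> nat set set \<Rightarrow> (nat set \<Rightarrow> bool) \<Rightarrow> nat set \<Rightarrow> bool" where
  "captures n \<F> S N \<longleftrightarrow> (\<forall>\<mu>. strict_mono \<mu> \<longrightarrow> \<mu> ` {n..} \<subseteq> N \<longrightarrow>
     (\<forall>F. S F \<longrightarrow> F \<subseteq> {n..} \<longrightarrow> \<mu> ` F \<in> \<F>))"

lemma captures_antimono: "captures n \<F> S N \<Longrightarrow> N' \<subseteq> N \<Longrightarrow> captures n \<F> S N'"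
  unfolding captures_def by (meson order_trans)

lemma captures_family_antimono:
  "captures n \<F> S N \<Longrightarrow> (\<And>F. S' F \<Longrightarrow> S F) \<Longrightarrow> captures n \<F> S' N"
  unfolding captures_def by blast

text \<open>Take \<open>N'\<close> to be \<open>N\<close> without its first \<open>n\<close>
  elements. The values of \<open>\<mu>\<close> from \<open>c\<close> on then lie beyond these, and
  since \<open>c \<le> n\<close>, the values below \<open>c\<close> may be replaced by the first
  \<open>c\<close> elements of \<open>N\<close> without losing monotonicity. The new map has its
  whole range in \<open>N\<close>, and the image of \<open>F\<close> is unchanged.\<close>

lemma captures_shift:
  assumes N: "infinite N" and cap: "captures 0 \<F> S N"
  shows "\<exists>N'\<subseteq>N. infinite N' \<and> (\<forall>c\<le>n. captures c \<F> S N')"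
proof (intro exI conjI allI impI)
  let ?N' = "enumerate N ` {n..}"
  have mono: "strict_mono (enumerate N)" using N by (simp add: strict_mono_enumerate)
  show "?N' \<subseteq> N" using enumerate_in_set[OF N] by auto
  show "infinite ?N'"
    using mono by (simp add: finite_image_iff strict_mono_on_imp_inj_on strict_mono_imp_inj_on inj_on_subset
        infinite_Ici)
  fix c assume c: "c \<le> n"
  show "captures c \<F> S ?N'"
    unfolding captures_def
  proof (intro allI impI)
    fix \<mu> :: "nat \<Rightarrow> nat" and F assume \<mu>: "strict_mono \<mu>" "\<mu> ` {c..} \<subseteq> ?N'" and F: "S F" "F \<subseteq> {c..}"
    define \<mu>' where "\<mu>' i = (if i < c then enumerate N i else \<mu> i)" for i
    have less: "enumerate N i < \<mu> j" if ij: "i < c" "c \<le> j" for i j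
    proof -
      obtain l where l: "l \<ge> n" "\<mu> j = enumerate N l" using \<mu>(2) ij by (auto simp: image_subset_iff)
      then show ?thesis using c ij mono by (simp add: strict_mono_less)
    qed
    have "strict_mono \<mu>'"
    proof (rule strict_monoI)
      fix i j :: nat assume "i < j"
      then show "\<mu>' i < \<mu>' j"
        using less[of i j] mono \<mu>(1) by (auto simp: \<mu>'_def strict_mono_less)
    qed
    moreover have "range \<mu>' \<subseteq> N"
    proof
      fix x assume "x \<in> range \<mu>'"
      then obtain i where x: "x = \<mu>' i" by blast
      show "x \<in> N"
      proof (cases "i < c")
        case True
        then show ?thesis using x enumerate_in_set[OF N] by (simp add: \<mu>'_def)
      next
        case False
        then have "x \<in> \<mu> ` {c..}" using x by (auto simp: \<mu>'_def)
        then show ?thesis using \<mu>(2) enumerate_in_set[OF N] by auto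
      qed
    qed
    ultimately have "\<mu>' ` F \<in> \<F>" using cap F(1) unfolding captures_def by (simp add: atLeast_0)
    moreover have "\<mu>' ` F = \<mu> ` F" using F(2) by (intro image_cong) (auto simp: \<mu>'_def)
    ultimately show "\<mu> ` F \<in> \<F>" by simp
  qed
qed

text \<open>A family \<open>S n\<close> constrained by \<open>F \<subseteq> {n..}\<close> is the
  common shape of successor and limit Schreier families. For \<open>n = Suc m\<close> the values of
  \<open>\<mu>\<close> from \<open>n\<close> on lie in \<open>N\<close> beyond
  \<open>\<mu> m\<close>, and \<open>m \<le> \<mu> m\<close> gives
  \<open>n \<le> Suc (\<mu> m)\<close>, so the fusion has taken care of \<open>S n\<close>
  there.\<close>

lemma captures_diagonal:
  assumes M: "infinite M"
    and dense: "\<And>n N. infinite N \<Longrightarrow> N \<subseteq> M \<Longrightarrow> \<exists>N'\<subseteq>N. infinite N' \<and> captures 0 \<F> (S n) N'"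
  shows "\<exists>N\<subseteq>M. infinite N \<and> captures 0 \<F> (\<lambda>F. \<exists>n. S n F \<and> F \<subseteq> {n..}) N"
proof -
  define D where "D = (\<lambda>n N. \<forall>c\<le>n. captures c \<F> (S n) N)"
  have "\<exists>N\<subseteq>M. infinite N \<and> D 0 N \<and> (\<forall>n\<in>N. \<forall>k\<le>Suc n. D k (N \<inter> {n<..}))"
  proof (rule fusion[OF M])
    fix n N assume N: "infinite N" "N \<subseteq> M"
    then obtain N1 where N1: "N1 \<subseteq> N" "infinite N1" "captures 0 \<F> (S n) N1" using dense by blast
    then obtain N2 where "N2 \<subseteq> N1" "infinite N2" "D n N2"
      using captures_shift[OF N1(2,3), of n] unfolding D_def by blast
    then show "\<exists>N'\<subseteq>N. infinite N' \<and> D n N'" using N1(1) by (meson order_trans)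
  qed (use captures_antimono in \<open>unfold D_def, blast\<close>)
  then obtain N where N: "N \<subseteq> M" "infinite N" "D 0 N"
    and DN: "\<And>n k. n \<in> N \<Longrightarrow> k \<le> Suc n \<Longrightarrow> D k (N \<inter> {n<..})" by blast
  have "captures 0 \<F> (\<lambda>F. \<exists>n. S n F \<and> F \<subseteq> {n..}) N"
    unfolding captures_def
  proof (intro allI impI)
    fix \<mu> :: "nat \<Rightarrow> nat" and F assume \<mu>: "strict_mono \<mu>" "\<mu> ` {0..} \<subseteq> N" and "\<exists>n. S n F \<and> F \<subseteq> {n..}"
    then obtain n where n: "S n F" "F \<subseteq> {n..}" by blast
    show "\<mu> ` F \<in> \<F>"
    proof (cases n)
      case 0
      then show ?thesis using N(3) \<mu> n unfolding D_def captures_def by blast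
    next
      case (Suc m)
      have "m \<le> \<mu> m" using \<mu>(1) by (rule strict_mono_imp_increasing)
      moreover have "\<mu> m \<in> N" using \<mu>(2) by auto
      ultimately have "captures n \<F> (S n) (N \<inter> {\<mu> m<..})"
        using DN[of "\<mu> m" n] Suc unfolding D_def by simp
      moreover have "\<mu> ` {n..} \<subseteq> N \<inter> {\<mu> m<..}"
        using \<mu> Suc by (auto simp: strict_mono_less)
      ultimately show ?thesis using \<mu>(1) n unfolding captures_def by blast
    qed
  qed
  then show ?thesis using N by blast
qed

context repeated_averages
begin

section \<open>Selections of averages, and several averages at once\<close>

lemma supp_ra_less:
  assumes "index_set L" "a < b" "x \<in> supp (ra \<xi> L a)" "y \<in> supp (ra \<xi> L b)"
  shows "x < y"
proof -
  let ?R = "remainder \<xi> L a"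
  have x: "x \<in> supp (avg \<xi> ?R)" using assms(3) ra_eq_avg[OF assms(1), of \<xi> a] by simp
  have "y \<in> remainder \<xi> L (Suc a)"
    using supp_ra_subset[OF assms(1), of \<xi> b] remainder_antimono[of "Suc a" b \<xi> L] assms(2,4)
    by auto
  then have "y \<in> ?R - supp (avg \<xi> ?R)" by simp
  then show ?thesis
    using x coherentD(3)[OF coherent index_set_remainder[OF assms(1)]]
    unfolding initial_segment_def by blast
qed

lemma supp_ra_nonempty: "index_set L \<Longrightarrow> supp (ra \<xi> L n) \<noteq> {}"
  using ra_eq_avg[of L \<xi> n] supp_avg_nonempty[OF index_set_remainder] by simp

text \<open>A first average is recovered from any set of which its support is an initial segment, so
  the chosen averages reappear one by one in the union of their supports. This serves to move
  averages on which a family is large to the front.\<close>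

lemma ra_selection:
  fixes \<xi> :: omega1
  assumes L: "index_set L" and h: "strict_mono h"
  defines "L' \<equiv> \<Union>i. supp (ra \<xi> L (h i))"
  shows "index_set L'" "L' \<subseteq> L" "ra \<xi> L' i = ra \<xi> L (h i)"
proof -
  have sub: "supp (ra \<xi> L n) \<subseteq> L" for n
    using supp_ra_subset[OF L] remainder_subset by blast
  then show L'L: "L' \<subseteq> L" unfolding L'_def by blast
  define p where "p i = (SOME x. x \<in> supp (ra \<xi> L (h i)))" for i
  have p: "p i \<in> supp (ra \<xi> L (h i))" for i
    unfolding p_def using supp_ra_nonempty[OF L] by (simp add: some_in_eq)
  have "strict_mono p"
  proof (rule strict_monoI)
    fix i j :: nat assume "i < j"
    then show "p i < p j" using supp_ra_less[OF L _ p p] h by (simp add: strict_mono_less)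
  qed
  then have "infinite (range p)" by (intro range_inj_infinite strict_mono_imp_inj_on)
  moreover have "range p \<subseteq> L'" unfolding L'_def using p by blast
  ultimately have "infinite L'" using finite_subset by blast
  then show iL': "index_set L'" using L'L L index_set_subset by blast
  have step: "avg \<xi> (remainder \<xi> L' i) = ra \<xi> L (h i)"
    if rem: "remainder \<xi> L' i = (\<Union>j\<in>{i..}. supp (ra \<xi> L (h j)))" for i
  proof -
    let ?R = "remainder \<xi> L (h i)"
    have eq: "ra \<xi> L (h i) = avg \<xi> ?R" by (rule ra_eq_avg[OF L])
    have "initial_segment (supp (ra \<xi> L (h i))) (remainder \<xi> L' i)"
      unfolding initial_segment_def rem
    proof (intro conjI ballI)
      show "finite (supp (ra \<xi> L (h i)))" by (rule finite_supp_ra[OF L])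
      fix x e assume x: "x \<in> (\<Union>j\<in>{i..}. supp (ra \<xi> L (h j))) - supp (ra \<xi> L (h i))"
        and e: "e \<in> supp (ra \<xi> L (h i))"
      then obtain j where j: "j \<ge> i" "x \<in> supp (ra \<xi> L (h j))" by blast
      then have "i < j" using x by (cases "i = j") auto
      then show "e < x" using supp_ra_less[OF L _ e j(2)] h by (simp add: strict_mono_less)
    qed auto
    then show ?thesis
      using coherentD(6)[OF coherent index_set_remainder[OF L] index_set_remainder[OF iL']]
      unfolding eq by blast
  qed
  have rem: "remainder \<xi> L' i = (\<Union>j\<in>{i..}. supp (ra \<xi> L (h j)))" for i
  proof (induction i)
    case (Suc i)
    have disj: "supp (ra \<xi> L (h i)) \<inter> supp (ra \<xi> L (h j)) = {}" if "j > i" for j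
      using supp_ra_less[OF L, of "h i" "h j"] that h by (force simp: strict_mono_less)
    have "{i..} = insert i {Suc i..}" by auto
    then have "remainder \<xi> L' (Suc i) =
        (supp (ra \<xi> L (h i)) \<union> (\<Union>j\<in>{Suc i..}. supp (ra \<xi> L (h j)))) - supp (ra \<xi> L (h i))"
      using Suc step[OF Suc] by simp
    also have "\<dots> = (\<Union>j\<in>{Suc i..}. supp (ra \<xi> L (h j)))" proof -
      have "supp (ra \<xi> L (h i)) \<inter> (\<Union>j\<in>{Suc i..}. supp (ra \<xi> L (h j))) = {}"
        using disj unfolding Int_UN_distrib by (simp add: Suc_le_eq)
      then show ?thesis by blast
    qed
    finally show ?case .
  qed (simp add: L'_def atLeast_0)
  show "ra \<xi> L' i = ra \<xi> L (h i)"
    using step[OF rem] ra_eq_avg[OF iL', of \<xi> i] by simp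
qed

definition jointly_large :: "nat set set \<Rightarrow> omega1 \<Rightarrow> nat \<Rightarrow> real \<Rightarrow> nat set \<Rightarrow> bool" where
  "jointly_large \<F> \<xi> k \<epsilon> M \<longleftrightarrow>
     (\<forall>L\<subseteq>M. infinite L \<longrightarrow> (\<exists>F\<in>\<F>. \<forall>j<k. \<epsilon> \<le> sum (ra \<xi> L j) F))"

definition large_captures :: "omega1 \<Rightarrow> bool" where
  "large_captures \<xi> \<longleftrightarrow> (\<forall>\<F> \<epsilon> M. hereditary \<F> \<longrightarrow> index_set M \<longrightarrow> \<epsilon> > 0 \<longrightarrow> large \<F> \<xi> \<epsilon> M \<longrightarrow>
     (\<exists>N\<subseteq>M. infinite N \<and> captures 0 \<F> (schreier \<xi>) N))"

text \<open>The first of \<open>k + 1\<close> blocks is found by applying the hypothesis on \<open>\<zeta>\<close> to the family of all \<open>G\<close>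
  whose links \<open>{F. G \<union> F \<in> \<F>}\<close> are still large for \<open>k\<close> blocks.\<close>

lemma jointly_large_captures:
  assumes \<zeta>: "large_captures \<zeta>" and \<epsilon>: "\<epsilon> > 0"
  shows "hereditary \<F> \<Longrightarrow> index_set M \<Longrightarrow> jointly_large \<F> \<zeta> k \<epsilon> M \<Longrightarrow>
    \<exists>N\<subseteq>M. infinite N \<and> captures 0 \<F> (blocks \<zeta> k) N"
proof (induction k arbitrary: \<F> M)
  case 0
  then have "infinite M" by (simp add: index_set_def)
  then obtain F where "F \<in> \<F>" using 0(3) unfolding jointly_large_def by blast
  then have "{} \<in> \<F>" using 0(1) unfolding hereditary_def by blast
  then have "captures 0 \<F> (blocks \<zeta> 0) M"
    unfolding captures_def using blocks_zeroD by (metis image_empty)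
  then show ?case using \<open>infinite M\<close> by blast
next
  case (Suc k)
  define ok where "ok = (\<lambda>G L. \<exists>F. G \<union> F \<in> \<F> \<and> (\<forall>j<k. \<epsilon> \<le> sum (ra \<zeta> L j) F))"
  define D where "D = (\<lambda>n N. \<forall>G\<in>Pow {..n}. (\<forall>L\<subseteq>N. infinite L \<longrightarrow> ok G L) \<or>
    (\<forall>L\<subseteq>N. infinite L \<longrightarrow> \<not> ok G L))"
  have iM: "infinite M" using Suc.prems(2) by (simp add: index_set_def)
  have "\<exists>N\<subseteq>M. infinite N \<and> D 0 N \<and> (\<forall>n\<in>N. \<forall>k\<le>Suc n. D k (N \<inter> {n<..}))"
  proof (rule fusion[OF iM])
    fix n N assume N: "infinite N" "N \<subseteq> M"
    show "\<exists>N'\<subseteq>N. infinite N' \<and> D n N'"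
      unfolding D_def
    proof (rule dense_finite[where M = M])
      fix G N assume N: "infinite N" "N \<subseteq> M"
      then have "index_set N" using index_set_subset[OF Suc.prems(2)] by blast
      then show "\<exists>N'\<subseteq>N. infinite N' \<and>
          ((\<forall>L\<subseteq>N'. infinite L \<longrightarrow> ok G L) \<or> (\<forall>L\<subseteq>N'. infinite L \<longrightarrow> \<not> ok G L))"
        by (rule averages_ramsey[where k = k and \<xi> = \<zeta>]) (simp add: ok_def)
    next
      fix G and N N' :: "nat set"
      assume "(\<forall>L\<subseteq>N. infinite L \<longrightarrow> ok G L) \<or> (\<forall>L\<subseteq>N. infinite L \<longrightarrow> \<not> ok G L)" "N' \<subseteq> N"
      then show "(\<forall>L\<subseteq>N'. infinite L \<longrightarrow> ok G L) \<or> (\<forall>L\<subseteq>N'. infinite L \<longrightarrow> \<not> ok G L)"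
        by (meson order_trans)
    qed (use N in auto)
  next
    fix n N N' assume "D n N" "N' \<subseteq> N"
    then show "D n N'" unfolding D_def by (meson order_trans)
  qed
  then obtain M1 where M1: "M1 \<subseteq> M" "infinite M1" "D 0 M1"
    and DM1: "\<And>n. n \<in> M1 \<Longrightarrow> D n (M1 \<inter> {n<..})" by (meson le_SucI order.refl)
  have iM1: "index_set M1" using index_set_subset[OF Suc.prems(2)] M1 by blast
  \<comment> \<open>The threshold \<open>n\<close> reflects that the Ramsey decision for
    \<open>G\<close> is available only beyond the elements of \<open>G\<close>.\<close>
  define \<G> where "\<G> = {G. finite G \<and> (\<exists>n. \<forall>L\<subseteq>M1 \<inter> {n<..}. infinite L \<longrightarrow> ok G L)}"
  have ok_subset: "ok G' L" if "ok G L" "G' \<subseteq> G" for G G' L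
  proof -
    obtain F where F: "G \<union> F \<in> \<F>" "\<forall>j<k. \<epsilon> \<le> sum (ra \<zeta> L j) F"
      using \<open>ok G L\<close> unfolding ok_def by blast
    have "G' \<union> F \<subseteq> G \<union> F" using \<open>G' \<subseteq> G\<close> by blast
    then have "G' \<union> F \<in> \<F>" using F(1) Suc.prems(1) unfolding hereditary_def by blast
    then show ?thesis using F(2) unfolding ok_def by blast
  qed
  have her: "hereditary \<G>"
    unfolding hereditary_def
  proof (intro ballI conjI allI impI)
    fix G G' assume G: "G \<in> \<G>"
    then show "finite G" by (simp add: \<G>_def)
    assume sub: "G' \<subseteq> G"
    obtain n where "\<forall>L\<subseteq>M1 \<inter> {n<..}. infinite L \<longrightarrow> ok G L" using G unfolding \<G>_def by blast
    then have "\<forall>L\<subseteq>M1 \<inter> {n<..}. infinite L \<longrightarrow> ok G' L" using ok_subset[OF _ sub] by blast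
    moreover have "finite G'" using sub \<open>finite G\<close> by (rule finite_subset)
    ultimately show "G' \<in> \<G>" unfolding \<G>_def by blast
  qed
  \<comment> \<open>A single witness \<open>L\<close> suffices, since the fusion has decided
    \<open>ok G\<close> uniformly for all infinite sets beyond \<open>Max G\<close>.\<close>
  have in_G: "G \<in> \<G>"
    if G: "finite G" "G \<subseteq> M1" and L: "L \<subseteq> M1" "infinite L" "\<And>g l. g \<in> G \<Longrightarrow> l \<in> L \<Longrightarrow> g < l"
      and ok: "ok G L" for G L
  proof (cases "G = {}")
    case True
    then have "\<forall>L\<subseteq>M1. infinite L \<longrightarrow> ok G L" using M1(3) L ok unfolding D_def by blast
    then show ?thesis using G(1) unfolding \<G>_def by blast
  next
    case False
    define n where "n = Max G"
    have n: "n \<in> G" "\<And>g. g \<in> G \<Longrightarrow> g \<le> n" using False G n_def by auto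
    have "L \<subseteq> M1 \<inter> {n<..}" using L n(1) by blast
    moreover have "D n (M1 \<inter> {n<..})" using DM1 n(1) G(2) by blast
    moreover have "G \<in> Pow {..n}" using n(2) by auto
    ultimately have "\<forall>L\<subseteq>M1 \<inter> {n<..}. infinite L \<longrightarrow> ok G L"
      using L(2) ok unfolding D_def by blast
    then show ?thesis using G(1) unfolding \<G>_def by blast
  qed
  have "large \<G> \<zeta> \<epsilon> M1"
    unfolding large_def
  proof (intro allI impI)
    fix L assume L: "L \<subseteq> M1" "infinite L"
    then have iL: "index_set L" using index_set_subset[OF iM1] by blast
    have "L \<subseteq> M" using L M1 by blast
    then obtain F where F: "F \<in> \<F>" "\<forall>j<Suc k. \<epsilon> \<le> sum (ra \<zeta> L j) F"
      using Suc.prems(3) L(2) unfolding jointly_large_def by blast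
    have finF: "finite F" using F(1) Suc.prems(1) unfolding hereditary_def by blast
    define G where "G = F \<inter> supp (avg \<zeta> L)"
    let ?R = "remainder \<zeta> L 1"
    have I: "initial_segment (supp (avg \<zeta> L)) L" by (rule coherentD(3)[OF coherent iL])
    have "G \<in> \<G>"
    proof (rule in_G)
      show "finite G" using finF by (simp add: G_def)
      show "G \<subseteq> M1" using I L(1) by (auto simp: G_def initial_segment_def)
      show "?R \<subseteq> M1" using L(1) remainder_subset by blast
      show "infinite ?R" using index_set_remainder[OF iL, of \<zeta> 1] unfolding index_set_def by blast
      show "\<And>g l. g \<in> G \<Longrightarrow> l \<in> ?R \<Longrightarrow> g < l" using I by (auto simp: G_def initial_segment_def)
      have "G \<union> F = F" by (auto simp: G_def)
      moreover have "\<epsilon> \<le> sum (ra \<zeta> ?R j) F" if "j < k" for j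
        using F(2)[rule_format, of "Suc j"] that ra_shift[OF iL, where k = 1 and j = j and \<xi> = \<zeta>] by simp
      ultimately show "ok G ?R" using F(1) unfolding ok_def by (intro exI[of _ F]) simp
    qed
    moreover have "sum (avg \<zeta> L) F = sum (avg \<zeta> L) G"
      unfolding G_def by (rule sum.mono_neutral_right[OF finF]) (auto simp: supp_def)
    then have "\<epsilon> \<le> sum (avg \<zeta> L) G" using F(2) by (metis zero_less_Suc)
    ultimately show "\<exists>G\<in>\<G>. \<epsilon> \<le> sum (avg \<zeta> L) G" by blast
  qed
  then obtain N1 where N1: "N1 \<subseteq> M1" "infinite N1" "captures 0 \<G> (schreier \<zeta>) N1"
    using \<zeta> her iM1 \<epsilon> unfolding large_captures_def by blast
  define link where "link G = {F. G \<union> F \<in> \<F>}" for G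
  have her_link: "hereditary (link G)" for G
    unfolding hereditary_def link_def
  proof (intro ballI conjI allI impI; simp)
    fix F assume F: "G \<union> F \<in> \<F>"
    then show "finite F" using Suc.prems(1) unfolding hereditary_def by auto
    fix F' assume "F' \<subseteq> F"
    then have "G \<union> F' \<subseteq> G \<union> F" by blast
    then show "G \<union> F' \<in> \<F>" using F Suc.prems(1) unfolding hereditary_def by blast
  qed
  \<comment> \<open>\<open>c\<close> runs up to \<open>Suc n\<close> because the later blocks start
    at \<open>Suc i\<close> or later, where \<open>i = Max G\<close>, and \<open>Suc i\<close> is at
    most \<open>Suc (\<mu> i)\<close>.\<close>
  define D' where "D' = (\<lambda>n N. \<forall>G\<in>Pow {..n}. G \<in> \<G> \<longrightarrow>
    (\<forall>c\<le>Suc n. captures c (link G) (blocks \<zeta> k) N))"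
  have "\<exists>N\<subseteq>N1. infinite N \<and> D' 0 N \<and> (\<forall>n\<in>N. \<forall>k\<le>Suc n. D' k (N \<inter> {n<..}))"
  proof (rule fusion[OF N1(2)])
    fix n N assume N: "infinite N" "N \<subseteq> N1"
    show "\<exists>N'\<subseteq>N. infinite N' \<and> D' n N'"
      unfolding D'_def
    proof (rule dense_finite[where M = N1])
      fix G N assume N: "infinite N" "N \<subseteq> N1"
      show "\<exists>N'\<subseteq>N. infinite N' \<and>
          (G \<in> \<G> \<longrightarrow> (\<forall>c\<le>Suc n. captures c (link G) (blocks \<zeta> k) N'))"
      proof (cases "G \<in> \<G>")
        case True
        then obtain n0 where n0: "\<forall>L\<subseteq>M1 \<inter> {n0<..}. infinite L \<longrightarrow> ok G L" unfolding \<G>_def by blast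
        let ?N = "N \<inter> {n0<..}"
        have sub: "?N \<subseteq> M1 \<inter> {n0<..}" using N N1 by blast
        have "infinite ?N" by (rule infinite_Int_greaterThan[OF N(1)])
        moreover have "?N \<subseteq> M" using sub M1(1) by blast
        ultimately have "index_set ?N" using index_set_subset[OF Suc.prems(2)] by blast
        moreover have "jointly_large (link G) \<zeta> k \<epsilon> ?N"
          unfolding jointly_large_def
        proof (intro allI impI)
          fix L assume "L \<subseteq> ?N" "infinite L"
          then have "ok G L" using n0 sub by (meson order_trans)
          then show "\<exists>F\<in>link G. \<forall>j<k. \<epsilon> \<le> sum (ra \<zeta> L j) F" unfolding ok_def link_def by blast
        qed
        ultimately obtain N2 where N2: "N2 \<subseteq> ?N" "infinite N2" "captures 0 (link G) (blocks \<zeta> k) N2"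
          using Suc.IH[OF her_link] by blast
        obtain N3 where "N3 \<subseteq> N2" "infinite N3" "\<forall>c\<le>Suc n. captures c (link G) (blocks \<zeta> k) N3"
          using captures_shift[OF N2(2,3), of "Suc n"] by blast
        then show ?thesis using N2(1) by (intro exI[of _ N3]) auto
      qed (use N in blast)
    next
      fix G and N N' :: "nat set"
      assume "G \<in> \<G> \<longrightarrow> (\<forall>c\<le>Suc n. captures c (link G) (blocks \<zeta> k) N)" "N' \<subseteq> N"
      then show "G \<in> \<G> \<longrightarrow> (\<forall>c\<le>Suc n. captures c (link G) (blocks \<zeta> k) N')"
        using captures_antimono by blast
    qed (use N in auto)
  next
    fix n N N' assume "D' n N" "N' \<subseteq> N"
    then show "D' n N'" unfolding D'_def using captures_antimono by blast
  qed
  then obtain N where N: "N \<subseteq> N1" "infinite N" "D' 0 N"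
    and DN: "\<And>n. n \<in> N \<Longrightarrow> D' n (N \<inter> {n<..})" by (meson le_SucI order.refl)
  have "captures 0 \<F> (blocks \<zeta> (Suc k)) N"
    unfolding captures_def
  proof (intro allI impI)
    fix \<mu> :: "nat \<Rightarrow> nat" and F assume \<mu>: "strict_mono \<mu>" "\<mu> ` {0..} \<subseteq> N" and F: "blocks \<zeta> (Suc k) F"
    obtain G H where GH: "F = G \<union> H" "schreier \<zeta> G" "blocks \<zeta> k H" "\<forall>g\<in>G. \<forall>h\<in>H. g < h"
      using blocks_SucD[OF F] by blast
    have \<mu>G: "\<mu> ` G \<in> \<G>"
      using captures_antimono[OF N1(3) N(1)] \<mu> GH(2) unfolding captures_def by (simp add: atLeast_0)
    have "\<mu> ` H \<in> link (\<mu> ` G)"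
    proof (cases "G = {}")
      case True
      then have "captures 0 (link (\<mu> ` G)) (blocks \<zeta> k) N" using N(3) \<mu>G unfolding D'_def by simp
      then show ?thesis using \<mu> GH(3) unfolding captures_def by (simp add: atLeast_0)
    next
      case False
      define i where "i = Max G"
      have i: "i \<in> G" "\<And>g. g \<in> G \<Longrightarrow> g \<le> i"
        using False schreier_finite[OF GH(2)] by (auto simp: i_def)
      have "\<mu> ` G \<in> Pow {..\<mu> i}" using i(2) \<mu>(1) by (auto simp: strict_mono_less_eq)
      moreover have "\<mu> i \<in> N" using \<mu>(2) by auto
      moreover have "Suc i \<le> Suc (\<mu> i)" using strict_mono_imp_increasing[OF \<mu>(1), of i] by simp
      ultimately have "captures (Suc i) (link (\<mu> ` G)) (blocks \<zeta> k) (N \<inter> {\<mu> i<..})"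
        using DN[of "\<mu> i"] \<mu>G unfolding D'_def by blast
      moreover have "\<mu> ` {Suc i..} \<subseteq> N \<inter> {\<mu> i<..}"
        using \<mu> by (auto simp: strict_mono_less)
      moreover have "H \<subseteq> {Suc i..}" using GH(4) i(1) by (auto simp: Suc_le_eq)
      ultimately show ?thesis using \<mu>(1) GH(3) unfolding captures_def by blast
    qed
    then show "\<mu> ` F \<in> \<F>" by (simp add: link_def GH(1) image_Un)
  qed
  then show ?case using N N1 M1 by (intro exI[of _ N]) auto
qed

text \<open>Counting: if a mean of \<open>s\<close> numbers in the unit interval is at least
  \<epsilon>, then at least \<open>s * \<epsilon> / 2\<close> of them are at least
  \<open>\<epsilon> / 2\<close>, and this exceeds \<open>k\<close> once the minimum \<open>s\<close>
  of \<open>L\<close> is large. Selecting these averages gives one set with the property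
  \<open>P\<close>; by Ramsey's theorem one such set is enough.\<close>

lemma jointly_large_if_large_osucc:
  assumes her: "hereditary \<F>" and M: "index_set M" and \<epsilon>: "\<epsilon> > 0" and large: "large \<F> (osucc \<zeta>) \<epsilon> M"
  shows "\<exists>N\<subseteq>M. infinite N \<and> jointly_large \<F> \<zeta> k (\<epsilon> / 2) N"
proof -
  define P where "P = (\<lambda>L. \<exists>F\<in>\<F>. \<forall>j<k. \<epsilon> / 2 \<le> sum (ra \<zeta> L j) F)"
  have "\<exists>N\<subseteq>M. infinite N \<and> ((\<forall>L\<subseteq>N. infinite L \<longrightarrow> P L) \<or> (\<forall>L\<subseteq>N. infinite L \<longrightarrow> \<not> P L))"
    by (rule averages_ramsey[OF M, where k = k and \<xi> = \<zeta>]) (simp add: P_def)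
  then obtain N where N: "N \<subseteq> M" "infinite N"
    and alt: "(\<forall>L\<subseteq>N. infinite L \<longrightarrow> P L) \<or> (\<forall>L\<subseteq>N. infinite L \<longrightarrow> \<not> P L)" by blast
  obtain m :: nat where m: "real k / (\<epsilon> / 2) < real m" using reals_Archimedean2 by blast
  define L where "L = N \<inter> {m<..}"
  have L: "L \<subseteq> N" "infinite L" using infinite_Int_greaterThan[OF N(2)] by (auto simp: L_def)
  have iL: "index_set L" using index_set_subset[OF M] L N by blast
  define s where "s = Inf L"
  have s: "s > m" "s \<ge> 1" using index_set_Inf[OF iL] by (auto simp: s_def L_def)
  obtain F where F: "F \<in> \<F>" "\<epsilon> \<le> sum (avg (osucc \<zeta>) L) F"
    using large L N unfolding large_def by (meson order_trans)
  have finF: "finite F" using F(1) her unfolding hereditary_def by blast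
  define J where "J = {j. j < s \<and> \<epsilon> / 2 \<le> sum (ra \<zeta> L j) F}"
  have "k \<le> card J"
  proof -
    have "\<epsilon> * real s \<le> (\<Sum>j<s. sum (ra \<zeta> L j) F)"
      using F(2) s by (simp add: sum_avg_osucc[OF iL] s_def[symmetric] field_simps)
    also have "\<dots> \<le> (\<Sum>j<s. (if j \<in> J then 1 else 0) + \<epsilon> / 2)"
    proof (rule sum_mono)
      fix j assume "j \<in> {..<s}"
      then show "sum (ra \<zeta> L j) F \<le> (if j \<in> J then 1 else 0) + \<epsilon> / 2"
        using sum_ra_le_1[OF iL finF, where \<xi> = \<zeta> and n = j] \<epsilon> by (auto simp: J_def)
    qed
    also have "\<dots> = real (card J) + real s * (\<epsilon> / 2)"
    proof -
      have "(\<Sum>j<s. (if j \<in> J then 1 else 0)) = real (card ({..<s} \<inter> J))" by (simp add: sum.If_cases)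
      also have "{..<s} \<inter> J = J" by (auto simp: J_def)
      finally show ?thesis by (simp add: sum.distrib)
    qed
    finally have "real s * (\<epsilon> / 2) \<le> real (card J)" by (simp add: field_simps)
    moreover have "real k < real s * (\<epsilon> / 2)"
    proof -
      have "real k / (\<epsilon> / 2) < real s" using m s(1) by linarith
      then show ?thesis using \<epsilon> by (simp add: pos_divide_less_eq)
    qed
    ultimately show ?thesis by linarith
  qed
  \<comment> \<open>The indices from \<open>s\<close> on make the selection infinite; as
    \<open>J\<close> has at least \<open>k\<close> elements, all below \<open>s\<close>, the first
    \<open>k\<close> values of \<open>h\<close> are in \<open>J\<close>.\<close>
  define h where "h = enumerate (J \<union> {s..})"
  have inf: "infinite (J \<union> {s..})" by (simp add: infinite_Ici)
  have h: "strict_mono h" unfolding h_def using inf by (rule strict_mono_enumerate)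
  have hJ: "h i \<in> J" if "i < k" for i
  proof (rule ccontr)
    assume "h i \<notin> J"
    then have his: "s \<le> h i" using enumerate_in_set[OF inf, of i] by (auto simp: h_def)
    have "J \<subseteq> h ` {..<i}"
    proof
      fix j assume j: "j \<in> J"
      then obtain l where l: "j = h l" using enumerate_Ex[OF inf, of j] by (auto simp: h_def)
      have "h l < h i" using j his l by (simp add: J_def)
      then show "j \<in> h ` {..<i}" using l h by (simp add: strict_mono_less)
    qed
    then have "card J \<le> card (h ` {..<i})" by (intro card_mono) auto
    also have "\<dots> \<le> i" using card_image_le[of "{..<i}" h] by simp
    finally show False using \<open>k \<le> card J\<close> \<open>i < k\<close> by simp
  qed
  define L' where "L' = (\<Union>i. supp (ra \<zeta> L (h i)))"
  note sel = ra_selection[OF iL h, of \<zeta>, folded L'_def]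
  have "P L'" unfolding P_def
  proof (intro bexI[OF _ F(1)] allI impI)
    fix j assume "j < k"
    then show "\<epsilon> / 2 \<le> sum (ra \<zeta> L' j) F" using hJ[of j] sel(3)[of j] by (simp add: J_def)
  qed
  moreover have "L' \<subseteq> N" "infinite L'" using sel(1,2) L(1) by (auto simp: index_set_def)
  ultimately have "\<forall>L\<subseteq>N. infinite L \<longrightarrow> P L" using alt by blast
  then show ?thesis using N unfolding jointly_large_def P_def by blast
qed

text \<open>At a successor the diagonal runs over the number of blocks, at a limit over the index
  \<open>n\<close> of \<open>\<phi> \<xi> n\<close>. In the limit case the induction hypothesis asks
  for largeness at the lower order \<open>\<phi> \<xi> n\<close>, which
  \<open>large_antimono\<close> supplies.\<close>

lemma large_captures: "large_captures \<xi>"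
proof (induction \<xi> rule: omega1_induct)
  case zero
  show ?case
    unfolding large_captures_def
  proof (intro allI impI)
    fix \<F> \<epsilon> M assume her: "hereditary \<F>" and M: "index_set M" and \<epsilon>: "\<epsilon> > (0::real)"
      and large: "large \<F> 0 \<epsilon> M"
    have iM: "infinite M" using M by (simp add: index_set_def)
    have sing: "{m} \<in> \<F>" if m: "m \<in> M" for m
    proof -
      define L where "L = insert m (M \<inter> {m<..})"
      have L: "L \<subseteq> M" "infinite L" using m infinite_Int_greaterThan[OF iM] by (auto simp: L_def)
      have "Inf L = m" unfolding L_def by (intro cInf_eq_minimum) auto
      then have avg: "avg 0 L = indicator {m}" by (simp add: avg_0)
      obtain F where F: "F \<in> \<F>" "\<epsilon> \<le> sum (avg 0 L) F" using large L unfolding large_def by blast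
      have "m \<in> F"
      proof (rule ccontr)
        assume "m \<notin> F"
        then have "sum (avg 0 L) F = 0" unfolding avg by (intro sum.neutral) (auto simp: indicator_def)
        then show False using F(2) \<epsilon> by simp
      qed
      then have "{m} \<subseteq> F" by simp
      then show ?thesis using F(1) her unfolding hereditary_def by blast
    qed
    have "captures 0 \<F> (schreier 0) M"
      unfolding captures_def
    proof (intro allI impI)
      fix \<mu> :: "nat \<Rightarrow> nat" and F assume \<mu>: "\<mu> ` {0..} \<subseteq> M" and F: "schreier 0 F"
      obtain n where "F \<subseteq> {n}" using schreier_zeroD[OF F] by (elim exE)
      then have "\<mu> ` F \<subseteq> {\<mu> n}" by auto
      moreover have "{\<mu> n} \<in> \<F>" using sing \<mu> by auto
      ultimately show "\<mu> ` F \<in> \<F>" using her unfolding hereditary_def by blast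
    qed
    then show "\<exists>N\<subseteq>M. infinite N \<and> captures 0 \<F> (schreier 0) N" using iM by blast
  qed
next
  case (succ \<zeta>)
  show ?case
    unfolding large_captures_def
  proof (intro allI impI)
    fix \<F> \<epsilon> M assume her: "hereditary \<F>" and M: "index_set M" and \<epsilon>: "\<epsilon> > (0::real)"
      and large: "large \<F> (osucc \<zeta>) \<epsilon> M"
    have iM: "infinite M" using M by (simp add: index_set_def)
    have "\<exists>N\<subseteq>M. infinite N \<and> captures 0 \<F> (\<lambda>F. \<exists>n. blocks \<zeta> n F \<and> F \<subseteq> {n..}) N"
    proof (rule captures_diagonal[OF iM])
      fix n N assume N: "infinite N" "N \<subseteq> M"
      have iN: "index_set N" using index_set_subset[OF M] N by blast
      have "large \<F> (osucc \<zeta>) \<epsilon> N" using large N unfolding large_def by blast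
      then obtain N1 where N1: "N1 \<subseteq> N" "infinite N1" "jointly_large \<F> \<zeta> n (\<epsilon> / 2) N1"
        using jointly_large_if_large_osucc[OF her iN \<epsilon>] by blast
      have iN1: "index_set N1" using index_set_subset[OF iN] N1 by blast
      have "\<exists>N\<subseteq>N1. infinite N \<and> captures 0 \<F> (blocks \<zeta> n) N"
        using jointly_large_captures[OF succ _ her iN1 N1(3)] \<epsilon> by simp
      then show "\<exists>N'\<subseteq>N. infinite N' \<and> captures 0 \<F> (blocks \<zeta> n) N'" using N1(1) by (meson order_trans)
    qed
    then obtain N where N: "N \<subseteq> M" "infinite N"
      "captures 0 \<F> (\<lambda>F. \<exists>n. blocks \<zeta> n F \<and> F \<subseteq> {n..}) N" by blast
    have "captures 0 \<F> (schreier (osucc \<zeta>)) N"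
      by (rule captures_family_antimono[OF N(3) schreier_osuccD])
    then show "\<exists>N\<subseteq>M. infinite N \<and> captures 0 \<F> (schreier (osucc \<zeta>)) N" using N(1,2) by blast
  qed
next
  case (limit \<xi>)
  show ?case
    unfolding large_captures_def
  proof (intro allI impI)
    fix \<F> \<epsilon> M assume her: "hereditary \<F>" and M: "index_set M" and \<epsilon>: "\<epsilon> > (0::real)"
      and large: "large \<F> \<xi> \<epsilon> M"
    have iM: "infinite M" using M by (simp add: index_set_def)
    have fin: "\<And>F. F \<in> \<F> \<Longrightarrow> finite F" using her unfolding hereditary_def by blast
    let ?S = "\<lambda>n F. n \<ge> 1 \<and> schreier (\<phi> \<xi> n) F"
    have "\<exists>N\<subseteq>M. infinite N \<and> captures 0 \<F> (\<lambda>F. \<exists>n. ?S n F \<and> F \<subseteq> {n..}) N"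
    proof (rule captures_diagonal[OF iM])
      fix n N assume N: "infinite N" "N \<subseteq> M"
      have iN: "index_set N" using index_set_subset[OF M] N by blast
      show "\<exists>N'\<subseteq>N. infinite N' \<and> captures 0 \<F> (?S n) N'"
      proof (cases "n \<ge> 1")
        case True
        have less: "\<phi> \<xi> n < \<xi>" by (rule limit_sequences_less[OF limit_sequences limit.hyps True])
        have "large \<F> \<xi> \<epsilon> N" using large N unfolding large_def by blast
        have "\<exists>N1\<subseteq>N. infinite N1 \<and> large \<F> (\<phi> \<xi> n) (\<epsilon> / 2) N1"
          by (rule large_antimono[OF _ iN \<open>large \<F> \<xi> \<epsilon> N\<close>]) (use fin less \<epsilon> in auto)
        then obtain N1 where N1: "N1 \<subseteq> N" "infinite N1" "large \<F> (\<phi> \<xi> n) (\<epsilon> / 2) N1" by blast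
        have iN1: "index_set N1" using index_set_subset[OF iN] N1 by blast
        have "\<epsilon> / 2 > 0" using \<epsilon> by simp
        then have "\<exists>N'\<subseteq>N1. infinite N' \<and> captures 0 \<F> (schreier (\<phi> \<xi> n)) N'"
          using limit.IH[OF less] her iN1 N1(3) unfolding large_captures_def by blast
        then show ?thesis using N1(1) True unfolding captures_def by (meson order_trans)
      next
        case False
        then show ?thesis using N by (intro exI[of _ N]) (auto simp: captures_def)
      qed
    qed
    then obtain N where N: "N \<subseteq> M" "infinite N"
      "captures 0 \<F> (\<lambda>F. \<exists>n. ?S n F \<and> F \<subseteq> {n..}) N" by blast
    have "captures 0 \<F> (schreier \<xi>) N"
    proof (rule captures_family_antimono[OF N(3)])
      show "\<exists>n. ?S n F \<and> F \<subseteq> {n..}" if "schreier \<xi> F" for F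
        using schreier_limitD[OF that limit.hyps] by auto
    qed
    then show "\<exists>N\<subseteq>M. infinite N \<and> captures 0 \<F> (schreier \<xi>) N" using N(1,2) by blast
  qed
qed

lemma schreier_image_if_large:
  assumes "hereditary \<F>" "index_set M" "\<epsilon> > 0" "large \<F> \<xi> \<epsilon> M"
  shows "\<exists>\<mu>. strict_mono \<mu> \<and> range \<mu> \<subseteq> M \<and> (\<forall>F. schreier \<xi> F \<longrightarrow> \<mu> ` F \<in> \<F>)"
proof -
  obtain N where N: "N \<subseteq> M" "infinite N" "captures 0 \<F> (schreier \<xi>) N"
    using large_captures[of \<xi>] assms unfolding large_captures_def by blast
  have "strict_mono (enumerate N)" by (rule strict_mono_enumerate[OF N(2)])
  moreover have "range (enumerate N) \<subseteq> N" using enumerate_in_set[OF N(2)] by auto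
  ultimately show ?thesis
    using N(1,3) unfolding captures_def by (intro exI[of _ "enumerate N"]) (auto simp: atLeast_0)
qed

end

section \<open>Functionals on a normed space\<close>

definition sublinear :: "('a::real_vector \<Rightarrow> real) \<Rightarrow> bool" where
  "sublinear q \<longleftrightarrow> (\<forall>u v. q (u + v) \<le> q u + q v) \<and> (\<forall>t\<ge>0. \<forall>v. q (t *\<^sub>R v) \<le> t * q v)"

text \<open>For sublinear \<open>q\<close> this is the largest sublinear functional below
  \<open>q\<close> whose value at \<open>- y\<close> is at most \<open>- q y\<close>.\<close>

definition shrink :: "('a::real_vector \<Rightarrow> real) \<Rightarrow> 'a \<Rightarrow> 'a \<Rightarrow> real" where
  "shrink q y x = (INF t\<in>{0..}. q (x + t *\<^sub>R y) - t * q y)"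

lemma sublinearD:
  assumes "sublinear q"
  shows "q (u + v) \<le> q u + q v" "t \<ge> 0 \<Longrightarrow> q (t *\<^sub>R v) \<le> t * q v" "q 0 = 0" "- q (- v) \<le> q v"
    "t \<ge> 0 \<Longrightarrow> q (t *\<^sub>R v) = t * q v"
proof -
  show add: "q (u + v) \<le> q u + q v" for u v using assms by (simp add: sublinear_def)
  show mult: "q (t *\<^sub>R v) \<le> t * q v" if "t \<ge> 0" for t v using assms that by (simp add: sublinear_def)
  show zero: "q 0 = 0" using add[of 0 0] mult[of 0 0] by simp
  show "- q (- v) \<le> q v" using add[of v "- v"] zero by simp
  show "q (t *\<^sub>R v) = t * q v" if t: "t \<ge> 0" for t v
  proof (cases "t = 0")
    case False
    then have "q v \<le> (1 / t) * q (t *\<^sub>R v)" using mult[of "1 / t" "t *\<^sub>R v"] t by simp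
    then have "t * q v \<le> q (t *\<^sub>R v)" using False t by (simp add: field_simps)
    then show ?thesis using mult[OF t, of v] by simp
  qed (simp add: zero)
qed

lemma shrink_le:
  assumes q: "sublinear q" and t: "t \<ge> 0"
  shows "shrink q y x \<le> q (x + t *\<^sub>R y) - t * q y"
  unfolding shrink_def
proof (rule cINF_lower)
  have "- q (- x) \<le> q (x + t *\<^sub>R y) - t * q y" if "t \<ge> 0" for t
    using sublinearD(1)[OF q, of "x + t *\<^sub>R y" "- x"] sublinearD(5)[OF q that, of y] by simp
  then show "bdd_below ((\<lambda>t. q (x + t *\<^sub>R y) - t * q y) ` {0..})"
    by (intro bdd_belowI2[where m = "- q (- x)"]) simp
qed (use t in simp)

lemma le_shrink: "(\<And>t. t \<ge> 0 \<Longrightarrow> c \<le> q (x + t *\<^sub>R y) - t * q y) \<Longrightarrow> c \<le> shrink q y x"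
  unfolding shrink_def by (rule cINF_greatest) auto

lemma sublinear_shrink:
  assumes q: "sublinear q"
  shows "sublinear (shrink q y)"
  unfolding sublinear_def
proof (intro conjI allI impI)
  fix u v
  have "shrink q y (u + v) - (q (v + t *\<^sub>R y) - t * q y) \<le> shrink q y u" if t: "t \<ge> 0" for t
  proof (rule le_shrink)
    fix s :: real assume s: "s \<ge> 0"
    have "shrink q y (u + v) \<le> q (u + v + (s + t) *\<^sub>R y) - (s + t) * q y"
      using s t by (intro shrink_le[OF q]) simp
    also have "u + v + (s + t) *\<^sub>R y = (u + s *\<^sub>R y) + (v + t *\<^sub>R y)" by (simp add: algebra_simps)
    also have "q \<dots> \<le> q (u + s *\<^sub>R y) + q (v + t *\<^sub>R y)" by (rule sublinearD(1)[OF q])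
    finally show "shrink q y (u + v) - (q (v + t *\<^sub>R y) - t * q y) \<le> q (u + s *\<^sub>R y) - s * q y"
      by (simp add: algebra_simps)
  qed
  then have "shrink q y (u + v) - shrink q y u \<le> shrink q y v"
    by (intro le_shrink) (simp add: algebra_simps)
  then show "shrink q y (u + v) \<le> shrink q y u + shrink q y v" by simp
next
  fix t :: real and v assume t: "t \<ge> 0"
  show "shrink q y (t *\<^sub>R v) \<le> t * shrink q y v"
  proof (cases "t = 0")
    case True
    then show ?thesis using shrink_le[OF q, of 0 y 0] sublinearD(3)[OF q] by simp
  next
    case False
    then have t: "t > 0" using t by simp
    have "shrink q y (t *\<^sub>R v) / t \<le> shrink q y v"
    proof (rule le_shrink)
      fix s :: real assume s: "s \<ge> 0"
      have "shrink q y (t *\<^sub>R v) \<le> q (t *\<^sub>R v + (t * s) *\<^sub>R y) - (t * s) * q y"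
        using s t by (intro shrink_le[OF q]) simp
      also have "t *\<^sub>R v + (t * s) *\<^sub>R y = t *\<^sub>R (v + s *\<^sub>R y)" by (simp add: algebra_simps)
      also have "q \<dots> = t * q (v + s *\<^sub>R y)" using t by (intro sublinearD(5)[OF q]) simp
      finally have "shrink q y (t *\<^sub>R v) \<le> (q (v + s *\<^sub>R y) - s * q y) * t" by (simp add: algebra_simps)
      then show "shrink q y (t *\<^sub>R v) / t \<le> q (v + s *\<^sub>R y) - s * q y"
        using t by (simp only: pos_divide_le_eq)
    qed
    then show ?thesis using t by (simp add: pos_divide_le_eq mult.commute)
  qed
qed

text \<open>Zorn's lemma with pointwise infima of chains. These are finite because
  \<open>- p (- x)\<close> bounds every member from below at \<open>x\<close>, and subadditive
  because of any two members of a chain one lies below the other.\<close>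

lemma minimal_sublinear:
  fixes p :: "'a::real_vector \<Rightarrow> real"
  assumes p: "sublinear p"
  shows "\<exists>q. sublinear q \<and> q \<le> p \<and> (\<forall>r. sublinear r \<longrightarrow> r \<le> q \<longrightarrow> r = q)"
proof -
  define A where "A = {q. sublinear q \<and> q \<le> p}"
  \<comment> \<open>Reversed, so that the maximal elements of Zorn's lemma are minimal
    functionals.\<close>
  define P where "P = (\<lambda>(q::'a \<Rightarrow> real) r. r \<le> q)"
  have "\<exists>m\<in>A. \<forall>a\<in>A. P m a \<longrightarrow> a = m"
  proof (rule predicate_Zorn)
    show "partial_order_on A (relation_of P A)"
      by (rule partial_order_on_relation_ofI) (auto simp: P_def)
    fix C assume C: "C \<in> Chains (relation_of P A)"
    have CA: "q \<in> A" if "q \<in> C" for q using C that by (auto simp: Chains_def relation_of_def)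
    have lin: "q \<le> r \<or> r \<le> q" if "q \<in> C" "r \<in> C" for q r
      using C that by (auto simp: Chains_def relation_of_def P_def)
    show "\<exists>u\<in>A. \<forall>a\<in>C. P a u"
    proof (cases "C = {}")
      case True
      then show ?thesis using p by (auto simp: A_def)
    next
      case False
      define u where "u x = (INF q\<in>C. q x)" for x
      have bdd: "bdd_below ((\<lambda>q. q x) ` C)" for x
      proof (rule bdd_belowI2[where m = "- p (- x)"])
        fix q assume "q \<in> C"
        then have q: "sublinear q" "q (- x) \<le> p (- x)" using CA by (auto simp: A_def le_fun_def)
        show "- p (- x) \<le> q x" using sublinearD(4)[OF q(1), of x] q(2) by simp
      qed
      have u_le: "u x \<le> q x" if "q \<in> C" for q x unfolding u_def by (rule cINF_lower[OF bdd that])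
      have le_u: "c \<le> u x" if "\<And>q. q \<in> C \<Longrightarrow> c \<le> q x" for c x
        unfolding u_def using False that by (rule cINF_greatest)
      have "sublinear u"
        unfolding sublinear_def
      proof (intro conjI allI impI)
        fix x y
        have "u (x + y) \<le> q x + r y" if qr: "q \<in> C" "r \<in> C" for q r
        proof -
          obtain s where s: "s \<in> C" "s \<le> q" "s \<le> r" using lin[OF qr] qr by blast
          have "u (x + y) \<le> s (x + y)" by (rule u_le[OF s(1)])
          also have "\<dots> \<le> s x + s y" using CA[OF s(1)] sublinearD(1) by (auto simp: A_def)
          also have "\<dots> \<le> q x + r y" using s by (simp add: le_fun_def add_mono)
          finally show ?thesis .
        qed
        then have "u (x + y) - r y \<le> u x" if "r \<in> C" for r
          using that by (intro le_u) (simp add: algebra_simps)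
        then have "u (x + y) - u x \<le> u y" by (intro le_u) (simp add: algebra_simps)
        then show "u (x + y) \<le> u x + u y" by simp
      next
        fix t :: real and x assume t: "t \<ge> 0"
        have le: "u (t *\<^sub>R x) \<le> t * q x" if q: "q \<in> C" for q
        proof -
          have "u (t *\<^sub>R x) \<le> q (t *\<^sub>R x)" by (rule u_le[OF q])
          also have "\<dots> \<le> t * q x" using CA[OF q] sublinearD(2) t by (auto simp: A_def)
          finally show ?thesis .
        qed
        show "u (t *\<^sub>R x) \<le> t * u x"
        proof (cases "t = 0")
          case True
          then show ?thesis using le False by auto
        next
          case False
          then have "u (t *\<^sub>R x) / t \<le> u x"
            using le t by (intro le_u) (simp add: pos_divide_le_eq mult.commute)
          then show ?thesis using False t by (simp add: pos_divide_le_eq mult.commute)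
        qed
      qed
      moreover have "u \<le> p"
      proof (rule le_funI)
        fix x
        obtain q where "q \<in> C" using False by blast
        then show "u x \<le> p x" using u_le[of q x] CA[of q] by (auto simp: A_def le_fun_def intro: order_trans)
      qed
      ultimately show ?thesis using u_le by (auto simp: A_def P_def le_fun_def)
    qed
  qed
  then obtain q where q: "q \<in> A" "\<And>a. a \<in> A \<Longrightarrow> a \<le> q \<Longrightarrow> a = q" unfolding P_def by blast
  have "r = q" if "sublinear r" "r \<le> q" for r
    using q that by (auto simp: A_def intro: order_trans)
  then show ?thesis using q(1) by (auto simp: A_def)
qed

text \<open>A minimal sublinear functional \<open>q\<close> is linear: \<open>shrink q y\<close> is a sublinear functional below
  \<open>q\<close>, so it equals \<open>q\<close>, which is superadditivity of \<open>q\<close>.\<close>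

lemma Hahn_Banach_sublinear:
  fixes p :: "'a::real_vector \<Rightarrow> real"
  assumes p: "sublinear p"
  shows "\<exists>f. linear f \<and> f \<le> p"
proof -
  obtain q where q: "sublinear q" "q \<le> p" and min: "\<And>r. sublinear r \<Longrightarrow> r \<le> q \<Longrightarrow> r = q"
    using minimal_sublinear[OF p] by blast
  have add: "q (x + y) = q x + q y" for x y
  proof -
    have "shrink q y z \<le> q z" for z using shrink_le[OF q(1), of 0 y z] by simp
    then have "shrink q y = q" by (intro min sublinear_shrink[OF q(1)] le_funI)
    then have "q x \<le> q (x + y) - q y" using shrink_le[OF q(1), of 1 y x] by simp
    then show ?thesis using sublinearD(1)[OF q(1), of x y] by simp
  qed
  have neg: "q (- x) = - q x" for x using add[of x "- x"] sublinearD(3)[OF q(1)] by simp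
  have "q (t *\<^sub>R x) = t * q x" for t x
  proof (cases "t \<ge> 0")
    case True
    then show ?thesis by (rule sublinearD(5)[OF q(1)])
  next
    case False
    then have "q ((- t) *\<^sub>R x) = (- t) * q x" by (intro sublinearD(5)[OF q(1)]) simp
    then show ?thesis using neg[of "t *\<^sub>R x"] by simp
  qed
  then have "linear q" using add by (intro linearI) simp_all
  then show ?thesis using q(2) by blast
qed

section \<open>The dual ball: norming functionals and compactness\<close>

definition dual_ball :: "('a::real_normed_vector \<Rightarrow> real) set" where
  "dual_ball = {f. linear f \<and> (\<forall>v. \<bar>f v\<bar> \<le> norm v)}"

lemma dual_ballD:
  assumes "f \<in> dual_ball"
  shows "linear f" "\<bar>f v\<bar> \<le> norm v" "bounded_linear f"
proof -
  show f: "linear f" "\<bar>f v\<bar> \<le> norm v" for v using assms by (auto simp: dual_ball_def)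
  show "bounded_linear f"
    by (rule bounded_linear_intro[where K = 1]) (use f in \<open>auto simp: linear_add linear_scale\<close>)
qed

text \<open>Shrinking the norm in direction \<open>v\<close> forces
  \<open>f (- v) \<le> - norm v\<close>, while \<open>f\<close> stays below the norm.\<close>

lemma norming_functional:
  fixes v :: "'a::real_normed_vector"
  shows "\<exists>f\<in>dual_ball. f v = norm v"
proof -
  have norm: "sublinear (norm :: 'a \<Rightarrow> real)" by (simp add: sublinear_def norm_triangle_ineq)
  obtain f where f: "linear f" "f \<le> shrink norm v"
    using Hahn_Banach_sublinear[OF sublinear_shrink[OF norm]] by blast
  have le: "f x \<le> norm x" for x
    using f(2) shrink_le[OF norm, of 0 v x] by (auto simp: le_fun_def intro: order_trans)
  have "f (- v) \<le> - norm v"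
    using f(2) shrink_le[OF norm, of 1 v "- v"] by (auto simp: le_fun_def intro: order_trans)
  then have "f v = norm v" using le[of v] linear_neg[OF f(1), of v] by simp
  moreover have "\<bar>f x\<bar> \<le> norm x" for x using le[of x] le[of "- x"] linear_neg[OF f(1), of x] by simp
  ultimately show ?thesis using f(1) by (auto simp: dual_ball_def)
qed

text \<open>Banach-Alaoglu: a closed subset of a product of compact intervals, in the topology of
  pointwise convergence.\<close>

lemma compact_dual_ball: "compact (dual_ball :: ('a::real_normed_vector \<Rightarrow> real) set)"
proof -
  have "compactin (product_topology (\<lambda>_. euclidean) UNIV) (PiE UNIV (\<lambda>v::'a. {- norm v..norm v}))"
    by (subst compactin_PiE) simp
  then have box: "compact (PiE UNIV (\<lambda>v::'a. {- norm v..norm v}))"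
    by (simp add: euclidean_product_topology)
  have coord: "continuous_on UNIV (\<lambda>f::'a \<Rightarrow> real. f v)" for v
    by (rule continuous_on_product_coordinates)
  have "closed (\<Inter>u v. {f::'a \<Rightarrow> real. f (u + v) = f u + f v})"
    by (intro closed_INT ballI closed_Collect_eq continuous_on_add coord)
  moreover have "closed (\<Inter>c v. {f::'a \<Rightarrow> real. f (c *\<^sub>R v) = c * f v})"
    by (intro closed_INT ballI closed_Collect_eq continuous_on_mult continuous_on_const coord)
  ultimately have "compact (PiE UNIV (\<lambda>v::'a. {- norm v..norm v}) \<inter>
      ((\<Inter>u v. {f::'a \<Rightarrow> real. f (u + v) = f u + f v}) \<inter> (\<Inter>c v. {f::'a \<Rightarrow> real. f (c *\<^sub>R v) = c * f v})))"
    using box by (intro compact_Int_closed closed_Int)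
  also have "PiE UNIV (\<lambda>v::'a. {- norm v..norm v}) \<inter>
      ((\<Inter>u v. {f::'a \<Rightarrow> real. f (u + v) = f u + f v}) \<inter> (\<Inter>c v. {f::'a \<Rightarrow> real. f (c *\<^sub>R v) = c * f v}))
      = dual_ball"
    by (auto simp: dual_ball_def linear_iff PiE_iff abs_le_iff minus_le_iff)
  finally show ?thesis .
qed

lemma dual_ball_compactness:
  fixes U :: "nat \<Rightarrow> ('a::real_normed_vector \<Rightarrow> real) set"
  assumes closed: "\<And>n. closed (U n)" and fip: "\<And>n. \<exists>f\<in>dual_ball. \<forall>i<n. f \<in> U i"
  shows "\<exists>f\<in>dual_ball. \<forall>i. f \<in> U i"
proof -
  have "dual_ball \<inter> (\<Inter>(range U)) \<noteq> {}"
  proof (rule compact_imp_fip[OF compact_dual_ball])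
    show "\<And>T. T \<in> range U \<Longrightarrow> closed T" using closed by blast
    fix F' assume "finite F'" "F' \<subseteq> range U"
    then obtain I where I: "finite I" "F' = U ` I" by (meson finite_subset_image)
    obtain n where n: "\<forall>i\<in>I. i < n" using I(1) finite_nat_set_iff_bounded by blast
    obtain f where "f \<in> dual_ball" "\<forall>i<n. f \<in> U i" using fip by blast
    then have "f \<in> dual_ball \<inter> \<Inter>F'" using n I(2) by blast
    then show "dual_ball \<inter> \<Inter>F' \<noteq> {}" by blast
  qed
  then show ?thesis by blast
qed

section \<open>Boundedness of weakly null sequences\<close>

definition weakly_null :: "(nat \<Rightarrow> 'a::real_normed_vector) \<Rightarrow> bool" where
  "weakly_null x \<longleftrightarrow> (\<forall>f :: 'a \<Rightarrow> real. bounded_linear f \<longrightarrow> (\<lambda>n. f (x n)) \<longlonglongrightarrow> 0)"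

text \<open>Gliding hump without Baire category: choose functionals \<open>g k\<close> norming \<open>x (n k)\<close>, where
  \<open>norm (x (n k)) \<ge> 4 ^ k\<close>, and signs such that the partial sums of \<open>\<Sum>\<plusminus>3\<^sup>-\<^sup>k * g k\<close> stay large at
  \<open>x (n k)\<close>; the tail of the series is too small to destroy this.\<close>

lemma weakly_null_bounded:
  fixes x :: "nat \<Rightarrow> 'a::real_normed_vector"
  assumes x: "weakly_null x"
  shows "\<exists>C>0. \<forall>n. norm (x n) \<le> C"
proof (rule ccontr)
  assume contra: "\<not> ?thesis"
  have "\<exists>n. (4::real) ^ k \<le> norm (x n)" for k
  proof (rule ccontr)
    assume "\<not> ?thesis"
    then have "(4::real) ^ k > 0 \<and> (\<forall>n. norm (x n) \<le> 4 ^ k)" by (auto simp: not_le less_imp_le)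
    then show False using contra by blast
  qed
  then obtain n where n: "\<And>k. (4::real) ^ k \<le> norm (x (n k))" by metis
  obtain g where g: "\<And>k. g k \<in> dual_ball" "\<And>k. g k (x (n k)) = norm (x (n k))"
    using bchoice[of UNIV "\<lambda>k f. f \<in> dual_ball \<and> f (x (n k)) = norm (x (n k))"]
      norming_functional by blast
  define r :: "nat \<Rightarrow> real" where "r k = (1 / 3) ^ k" for k
  define h where "h = rec_nat (\<lambda>_. 0) (\<lambda>k f v.
    f v + (if f (x (n k)) \<ge> 0 then 1 else - 1) * r k * g k v)"
  define \<sigma> :: "nat \<Rightarrow> real" where "\<sigma> k = (if h k (x (n k)) \<ge> 0 then 1 else - 1)" for k
  have h0: "h 0 = (\<lambda>_. 0)" by (simp add: h_def)
  have hSuc: "h (Suc k) v = h k v + \<sigma> k * r k * g k v" for k v by (simp add: h_def \<sigma>_def)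
  have h_sum: "h k v = (\<Sum>j<k. \<sigma> j * r j * g j v)" for k v by (induction k) (simp_all add: h0 hSuc)
  have term_le: "\<bar>\<sigma> j * r j * g j v\<bar> \<le> r j * norm v" for j v
    using dual_ballD(2)[OF g(1), of j v] by (simp add: abs_mult \<sigma>_def r_def)
  have r_sum: "summable r" "(\<Sum>j. r (j + k)) = (3 / 2) * r k" for k
  proof -
    show "summable r" unfolding r_def by (rule summable_geometric) simp
    have "(\<Sum>j. r (j + k)) = (\<Sum>j. r j * r k)" by (simp add: r_def power_add)
    also have "\<dots> = (\<Sum>j. r j) * r k" using \<open>summable r\<close> by (rule suminf_mult2[symmetric])
    also have "(\<Sum>j. r j) = 3 / 2" unfolding r_def by (subst suminf_geometric) simp_all
    finally show "(\<Sum>j. r (j + k)) = (3 / 2) * r k" .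
  qed
  have summ: "summable (\<lambda>j. \<sigma> j * r j * g j v)" for v
    by (rule summable_comparison_test'[where g = "\<lambda>j. r j * norm v" and N = 0])
      (use term_le summable_mult2[OF r_sum(1)] in auto)
  define f where "f v = (\<Sum>j. \<sigma> j * r j * g j v)" for v
  have tail: "\<bar>f v - h k v\<bar> \<le> (3 / 2) * r k * norm v" for k v
  proof -
    have "f v - h k v = (\<Sum>j. \<sigma> (j + k) * r (j + k) * g (j + k) v)"
      unfolding f_def h_sum using suminf_minus_initial_segment[OF summ[of v], of k] by simp
    also have "\<bar>\<dots>\<bar> \<le> (\<Sum>j. r (j + k) * norm v)"
    proof (rule order_trans[OF summable_rabs suminf_le])
      have sr: "summable (\<lambda>j. r (j + k) * norm v)"
        using r_sum(1) by (intro summable_mult2) (simp add: summable_iff_shift)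
      show "summable (\<lambda>j. \<bar>\<sigma> (j + k) * r (j + k) * g (j + k) v\<bar>)"
        by (rule summable_comparison_test'[OF sr, where N = 0]) (use term_le in auto)
      then show "summable (\<lambda>j. \<bar>\<sigma> (j + k) * r (j + k) * g (j + k) v\<bar>)" .
      show "summable (\<lambda>j. r (j + k) * norm v)" by (rule sr)
    qed (use term_le in auto)
    also have "\<dots> = (3 / 2) * r k * norm v"
      using r_sum by (subst suminf_mult2[symmetric]) (simp_all add: summable_iff_shift)
    finally show ?thesis .
  qed
  have "bounded_linear f"
  proof (rule bounded_linear_intro[where K = "3 / 2"])
    show "f (u + v) = f u + f v" for u v
      unfolding f_def using summ dual_ballD(1)[OF g(1)]
      by (subst suminf_add) (simp_all add: linear_add algebra_simps)
    show "f (c *\<^sub>R v) = c *\<^sub>R f v" for c v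
      unfolding f_def using summ dual_ballD(1)[OF g(1)]
      by (simp add: suminf_mult[symmetric] linear_scale algebra_simps)
    show "norm (f v) \<le> norm v * (3 / 2)" for v using tail[of v 0] by (simp add: h0 r_def)
  qed
  then have "(\<lambda>m. f (x m)) \<longlonglongrightarrow> 0" using x by (simp add: weakly_null_def)
  then obtain B where B: "\<And>m. \<bar>f (x m)\<bar> \<le> B"
    using convergent_imp_Bseq[of "\<lambda>m. f (x m)"] by (auto simp: convergent_def Bseq_def)
  \<comment> \<open>The sign prevents the new term from cancelling against the earlier ones. The
    tail after it is at most half of it, because the coefficients shrink by the factor 3; against
    the growth \<open>4 ^ k\<close> this leaves half of \<open>(4 / 3) ^ k\<close>.\<close>
  have le: "(1 / 2) * (4 / 3) ^ k \<le> B" for k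
  proof -
    let ?v = "x (n k)"
    have "h (Suc k) ?v = h k ?v + \<sigma> k * (r k * norm ?v)" by (simp add: hSuc g(2))
    moreover have "r k * norm ?v \<ge> 0" by (simp add: r_def)
    ultimately have "r k * norm ?v \<le> \<bar>h (Suc k) ?v\<bar>" by (auto simp: \<sigma>_def)
    moreover have "\<bar>f ?v - h (Suc k) ?v\<bar> \<le> (1 / 2) * (r k * norm ?v)"
      using tail[of ?v "Suc k"] by (simp add: r_def)
    ultimately have "(1 / 2) * (r k * norm ?v) \<le> \<bar>f ?v\<bar>" by linarith
    moreover have "r k * 4 ^ k \<le> r k * norm ?v" using n[of k] by (intro mult_left_mono) (auto simp: r_def)
    moreover have "r k * 4 ^ k = (4 / 3) ^ k" by (simp add: r_def power_mult_distrib[symmetric])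
    ultimately show ?thesis using B[of "n k"] by linarith
  qed
  obtain k where "2 * B < (4 / 3 :: real) ^ k" using real_arch_pow[of "4 / 3" "2 * B"] by auto
  then show False using le[of k] by simp
qed

section \<open>Summability and Schreier families\<close>

definition upper_sets :: "real \<Rightarrow> (nat \<Rightarrow> 'a::real_normed_vector) \<Rightarrow> nat set set" where
  "upper_sets \<delta> x = {F. finite F \<and> (\<exists>f\<in>dual_ball. \<forall>i\<in>F. \<delta> \<le> f (x i))}"

lemma hereditary_upper_sets: "hereditary (upper_sets \<delta> x)"
  unfolding hereditary_def
proof (intro ballI conjI allI impI)
  fix F G assume F: "F \<in> upper_sets \<delta> x"
  then show "finite F" by (simp add: upper_sets_def)
  assume "G \<subseteq> F"
  then show "G \<in> upper_sets \<delta> x" using F finite_subset unfolding upper_sets_def by blast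
qed

lemma weakly_null_tendsto:
  fixes w :: "nat \<Rightarrow> 'a::real_normed_vector"
  assumes "weakly_null w" "w \<longlonglongrightarrow> l"
  shows "l = 0"
proof -
  obtain f where f: "f \<in> dual_ball" "f l = norm l" using norming_functional by blast
  have "(\<lambda>n. f (w n)) \<longlonglongrightarrow> f l" by (rule bounded_linear.tendsto[OF dual_ballD(3)[OF f(1)] assms(2)])
  moreover have "(\<lambda>n. f (w n)) \<longlonglongrightarrow> 0" using assms(1) dual_ballD(3)[OF f(1)] by (simp add: weakly_null_def)
  ultimately show ?thesis using LIMSEQ_unique f(2) by fastforce
qed

lemma weakly_null_comp:
  assumes "weakly_null x" "strict_mono \<mu>"
  shows "weakly_null (x \<circ> \<mu>)"
  unfolding weakly_null_def
proof (intro allI impI)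
  fix f :: "'a \<Rightarrow> real" assume "bounded_linear f"
  then have "(\<lambda>n. f (x n)) \<longlonglongrightarrow> 0" using assms(1) by (simp add: weakly_null_def)
  from LIMSEQ_subseq_LIMSEQ[OF this assms(2)] show "(\<lambda>n. f ((x \<circ> \<mu>) n)) \<longlonglongrightarrow> 0"
    by (simp add: comp_def)
qed

lemma upper_sets_comp:
  assumes "strict_mono \<mu>"
  shows "F \<in> upper_sets \<delta> (x \<circ> \<mu>) \<longleftrightarrow> \<mu> ` F \<in> upper_sets \<delta> x"
  using finite_image_iff[OF inj_on_subset[OF strict_mono_imp_inj_on[OF assms] subset_UNIV], of F]
  by (simp add: upper_sets_def)

lemma Cesaro_null:
  fixes v :: "nat \<Rightarrow> 'a::real_normed_vector"
  assumes v: "v \<longlonglongrightarrow> 0"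
  shows "(\<lambda>n. (1 / real n) *\<^sub>R (\<Sum>k<n. v k)) \<longlonglongrightarrow> 0"
proof (rule LIMSEQ_I)
  fix e :: real assume e: "e > 0"
  then obtain N where N: "\<And>k. k \<ge> N \<Longrightarrow> norm (v k) < e / 2"
    using LIMSEQ_D[OF v, of "e / 2"] by auto
  define K where "K = (\<Sum>k<N. norm (v k))"
  obtain m :: nat where m: "2 * K / e < real m" using reals_Archimedean2 by blast
  show "\<exists>n0. \<forall>n\<ge>n0. norm ((1 / real n) *\<^sub>R (\<Sum>k<n. v k) - 0) < e"
  proof (intro exI allI impI)
    fix n assume n: "n \<ge> Suc (max N m)"
    have "norm (\<Sum>k<n. v k) \<le> (\<Sum>k<n. norm (v k))" by (rule norm_sum)
    also have "\<dots> = K + (\<Sum>k=N..<n. norm (v k))"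
      unfolding K_def lessThan_atLeast0 using n by (intro sum.atLeastLessThan_concat[symmetric]) auto
    also have "(\<Sum>k=N..<n. norm (v k)) \<le> (\<Sum>k=N..<n. e / 2)"
      using N by (intro sum_mono) (auto intro: less_imp_le)
    also have "\<dots> \<le> real n * (e / 2)" using e by (simp add: field_simps)
    finally have "norm (\<Sum>k<n. v k) \<le> K + real n * (e / 2)" by simp
    moreover have "K < real n * (e / 2)"
    proof -
      have "2 * K / e < real n" using m n by simp
      then show ?thesis using e by (simp add: pos_divide_less_eq algebra_simps)
    qed
    ultimately have "norm (\<Sum>k<n. v k) < e * real n" by (simp add: field_simps)
    then show "norm ((1 / real n) *\<^sub>R (\<Sum>k<n. v k) - 0) < e"
      using n by (simp add: pos_divide_less_eq)
  qed
qed

lemma average_eq_sum: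
  fixes x :: "nat \<Rightarrow> 'a::banach"
  assumes "finite U" "supp a \<subseteq> U"
  shows "average a x = (\<Sum>i\<in>U. a i *\<^sub>R x i)"
  unfolding average_def using assms by (intro suminf_finite) (auto simp: supp_def)

context repeated_averages
begin

lemma average_ra:
  fixes x :: "nat \<Rightarrow> 'a::banach"
  assumes "index_set L"
  shows "average (ra \<xi> L n) x = (\<Sum>i\<in>supp (ra \<xi> L n). ra \<xi> L n i *\<^sub>R x i)"
  using average_eq_sum[OF finite_supp_ra[OF assms] order.refl] .

lemma linear_average_ra:
  fixes f :: "'a::banach \<Rightarrow> real"
  assumes "index_set L" "linear f"
  shows "f (average (ra \<xi> L n) x) = (\<Sum>i\<in>supp (ra \<xi> L n). ra \<xi> L n i * f (x i))"
  unfolding average_ra[OF assms(1)] using assms(2) by (simp add: linear_sum linear_scale)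

lemma average_ra_osucc:
  fixes x :: "nat \<Rightarrow> 'a::banach" and \<zeta> :: omega1
  assumes L: "index_set L"
  defines "k \<equiv> block_start (ra \<zeta> L)" and "s \<equiv> block_length (ra \<zeta> L)"
  shows "average (ra (osucc \<zeta>) L n) x = (1 / real (s n)) *\<^sub>R (\<Sum>j<s n. average (ra \<zeta> L (k n + j)) x)"
proof -
  define U where "U = (\<Union>j<s n. supp (ra \<zeta> L (k n + j)))"
  have fin: "finite U" unfolding U_def by (intro finite_UN_I finite_supp_ra[OF L]) simp
  have eq: "ra (osucc \<zeta>) L n = (\<lambda>i. (1 / real (s n)) * (\<Sum>j<s n. ra \<zeta> L (k n + j) i))"
    by (simp add: repeated_average_osucc succ_average_def k_def s_def)
  have "supp (ra (osucc \<zeta>) L n) \<subseteq> U"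
    unfolding U_def eq by (force simp: supp_def intro: sum.neutral)
  then have "average (ra (osucc \<zeta>) L n) x = (\<Sum>i\<in>U. ra (osucc \<zeta>) L n i *\<^sub>R x i)"
    by (rule average_eq_sum[OF fin])
  also have "\<dots> = (1 / real (s n)) *\<^sub>R (\<Sum>i\<in>U. \<Sum>j<s n. ra \<zeta> L (k n + j) i *\<^sub>R x i)"
    unfolding eq by (simp add: scaleR_sum_right scaleR_sum_left sum_divide_distrib)
  also have "(\<Sum>i\<in>U. \<Sum>j<s n. ra \<zeta> L (k n + j) i *\<^sub>R x i) = (\<Sum>j<s n. average (ra \<zeta> L (k n + j)) x)"
  proof (subst sum.swap, rule sum.cong[OF refl])
    fix j assume "j \<in> {..<s n}"
    then have "supp (ra \<zeta> L (k n + j)) \<subseteq> U" unfolding U_def by blast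
    then show "(\<Sum>i\<in>U. ra \<zeta> L (k n + j) i *\<^sub>R x i) = average (ra \<zeta> L (k n + j)) x"
      by (rule average_eq_sum[OF fin, symmetric])
  qed
  finally show ?thesis .
qed

lemma Inf_remainder_ge:
  assumes L: "index_set L"
  shows "Suc n \<le> Inf (remainder \<xi> L n)"
proof (induction n)
  case 0
  then show ?case using index_set_Inf(2)[OF L] by simp
next
  case (Suc n)
  let ?R = "remainder \<xi> L n"
  have R: "index_set ?R" by (rule index_set_remainder[OF L])
  have m: "Inf (remainder \<xi> L (Suc n)) \<in> remainder \<xi> L (Suc n)"
    by (rule index_set_Inf(1)[OF index_set_remainder[OF L]])
  have I: "initial_segment (supp (avg \<xi> ?R)) ?R" "supp (avg \<xi> ?R) \<noteq> {}"
    using coherentD(2,3)[OF coherent R] by auto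
  have "Inf ?R \<in> supp (avg \<xi> ?R)" using Inf_initial_segment[OF I] Inf_nat_def1[OF I(2)] by simp
  then have "Inf ?R < Inf (remainder \<xi> L (Suc n))" using m I(1) by (auto simp: initial_segment_def)
  then show ?case using Suc by simp
qed

lemma supp_ra_ge:
  assumes "index_set L" "i \<in> supp (ra \<xi> L n)"
  shows "n < i"
proof -
  have "i \<in> remainder \<xi> L n" using supp_ra_subset[OF assms(1)] assms(2) by blast
  then have "Inf (remainder \<xi> L n) \<le> i" by (rule index_set_Inf(3)[OF index_set_remainder[OF assms(1)]])
  then show ?thesis using Inf_remainder_ge[OF assms(1), where n = n and \<xi> = \<xi>] by simp
qed

text \<open>Fusion produces \<open>L\<close> such that first averages of sets in \<open>L\<close>
  beyond an element \<open>n\<close> of \<open>L\<close> have norm below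
  \<open>1 / real (Suc n)\<close>. The later averages of \<open>L\<close> are first averages of
  remainders, which eventually lie beyond \<open>n\<close>; so they tend to \<open>0\<close>, and so
  do their Cesaro means.\<close>

lemma summable_along_if_null:
  fixes x :: "nat \<Rightarrow> 'a::banach"
  assumes x: "\<And>\<epsilon> M. \<epsilon> > 0 \<Longrightarrow> index_set M \<Longrightarrow>
      \<exists>N\<subseteq>M. infinite N \<and> (\<forall>L\<subseteq>N. infinite L \<longrightarrow> norm (average (avg \<xi> L) x) < \<epsilon>)"
  shows "\<exists>L. index_set L \<and> summable_along \<phi> L \<xi> x"
proof -
  define D where "D = (\<lambda>n N. \<forall>L\<subseteq>N. infinite L \<longrightarrow> norm (average (avg \<xi> L) x) < 1 / real (Suc n))"
  have M: "index_set {1..}" by (simp add: index_set_def infinite_Ici)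
  have "\<exists>N\<subseteq>{1..}. infinite N \<and> D 0 N \<and> (\<forall>n\<in>N. \<forall>k\<le>Suc n. D k (N \<inter> {n<..}))"
  proof (rule fusion)
    fix n and N :: "nat set" assume "infinite N" "N \<subseteq> {1..}"
    then have "index_set N" by (simp add: index_set_def)
    then show "\<exists>N'\<subseteq>N. infinite N' \<and> D n N'" unfolding D_def by (intro x) simp_all
  qed (use M in \<open>auto simp: D_def index_set_def\<close>)
  then obtain L where L: "L \<subseteq> {1..}" "infinite L" and DL: "\<And>n. n \<in> L \<Longrightarrow> D n (L \<inter> {n<..})"
    by (meson le_SucI order.refl)
  have iL: "index_set L" using L by (simp add: index_set_def)
  have "(\<lambda>k. average (ra \<xi> L k) x) \<longlonglongrightarrow> 0"
  proof (rule LIMSEQ_I)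
    fix e :: real assume e: "e > 0"
    obtain m :: nat where m: "1 / e < real m" using reals_Archimedean2 by blast
    obtain n where n: "n \<in> L" "n > m" using L(2) infinite_nat_iff_unbounded by blast
    have "norm (average (ra \<xi> L k) x - 0) < e" if k: "k \<ge> n" for k
    proof -
      let ?R = "remainder \<xi> L k"
      have R: "index_set ?R" by (rule index_set_remainder[OF iL])
      have "?R \<subseteq> L \<inter> {n<..}"
      proof
        fix i assume i: "i \<in> ?R"
        then have "Suc k \<le> i"
          using Inf_remainder_ge[OF iL, where n = k and \<xi> = \<xi>] index_set_Inf(3)[OF R i] by simp
        then show "i \<in> L \<inter> {n<..}" using i remainder_subset k by auto
      qed
      then have "norm (average (avg \<xi> ?R) x) < 1 / real (Suc n)"
        using DL[OF n(1)] R unfolding D_def index_set_def by blast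
      also have "\<dots> \<le> e"
      proof -
        have "1 / e < real (Suc n)" using m n(2) by simp
        then show ?thesis using e by (simp add: field_simps)
      qed
      finally show ?thesis using ra_eq_avg[OF iL, of \<xi> k] by simp
    qed
    then show "\<exists>n0. \<forall>k\<ge>n0. norm (average (ra \<xi> L k) x - 0) < e" by blast
  qed
  from Cesaro_null[OF this] have "summable_along \<phi> L \<xi> x"
    unfolding summable_along_def convergent_def by blast
  then show ?thesis using iL by blast
qed

text \<open>Where a norming functional stays below \<open>\<epsilon> / 2\<close>, it contributes at
  most \<open>\<epsilon> / 2\<close> to an average of norm at least \<epsilon>. At least
  \<open>\<epsilon> / 2\<close> comes from the other indices, where its values are at most
  \<open>C\<close>, so these have mass at least \<open>\<epsilon> / (2 * C)\<close>.\<close>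

lemma large_if_not_summable:
  fixes x :: "nat \<Rightarrow> 'a::banach"
  assumes x: "weakly_null x" and not: "\<And>L. index_set L \<Longrightarrow> \<not> summable_along \<phi> L \<xi> x"
  shows "\<exists>\<delta>>0. \<exists>\<epsilon>>0. \<exists>M. index_set M \<and> large (upper_sets \<delta> x) \<xi> \<epsilon> M"
proof -
  obtain C where C: "C > 0" "\<And>n. norm (x n) \<le> C" using weakly_null_bounded[OF x] by blast
  obtain \<epsilon> M where \<epsilon>: "\<epsilon> > 0" and M: "index_set M" and
    no: "\<not> (\<exists>N\<subseteq>M. infinite N \<and> (\<forall>L\<subseteq>N. infinite L \<longrightarrow> norm (average (avg \<xi> L) x) < \<epsilon>))"
    using summable_along_if_null[of \<xi> x] not by blast
  have "\<exists>N\<subseteq>M. infinite N \<and> ((\<forall>L\<subseteq>N. infinite L \<longrightarrow> norm (average (avg \<xi> L) x) < \<epsilon>) \<or>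
      (\<forall>L\<subseteq>N. infinite L \<longrightarrow> \<not> norm (average (avg \<xi> L) x) < \<epsilon>))"
    by (rule averages_ramsey[OF M, where k = 1 and \<xi> = \<xi>]) simp
  then obtain N where N: "N \<subseteq> M" "infinite N"
    and ge: "\<And>L. L \<subseteq> N \<Longrightarrow> infinite L \<Longrightarrow> \<epsilon> \<le> norm (average (avg \<xi> L) x)"
    using no by (meson not_less)
  have iN: "index_set N" using index_set_subset[OF M] N by blast
  have "large (upper_sets (\<epsilon> / 2) x) \<xi> (\<epsilon> / (2 * C)) N"
    unfolding large_def
  proof (intro allI impI)
    fix L assume L: "L \<subseteq> N" "infinite L"
    have iL: "index_set L" using index_set_subset[OF iN] L by blast
    obtain f where f: "f \<in> dual_ball" "f (average (avg \<xi> L) x) = norm (average (avg \<xi> L) x)"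
      using norming_functional by blast
    let ?a = "avg \<xi> L"
    define F where "F = {i \<in> supp ?a. \<epsilon> / 2 \<le> f (x i)}"
    have fin: "finite (supp ?a)" by (rule finite_supp_ra[OF iL])
    have F: "F \<in> upper_sets (\<epsilon> / 2) x" using fin f(1) unfolding upper_sets_def F_def by auto
    have "\<epsilon> \<le> (\<Sum>i\<in>supp ?a. ?a i * f (x i))"
      using ge[OF L] f linear_average_ra[OF iL dual_ballD(1)[OF f(1)], of \<xi> 0 x] by simp
    also have "\<dots> \<le> (\<Sum>i\<in>supp ?a. (if i \<in> F then ?a i else 0) * C + ?a i * (\<epsilon> / 2))"
    proof (rule sum_mono)
      fix i assume i: "i \<in> supp ?a"
      have a: "?a i \<ge> 0" by (rule avg_nonneg[OF iL])
      have fC: "f (x i) \<le> C" using dual_ballD(2)[OF f(1), of "x i"] C(2)[of i] by simp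
      show "?a i * f (x i) \<le> (if i \<in> F then ?a i else 0) * C + ?a i * (\<epsilon> / 2)"
      proof (cases "i \<in> F")
        case True
        have "?a i * f (x i) \<le> ?a i * C" using a fC by (intro mult_left_mono)
        moreover have "0 \<le> ?a i * (\<epsilon> / 2)" using a \<epsilon> by simp
        ultimately show ?thesis using True by simp
      next
        case False
        then have "f (x i) \<le> \<epsilon> / 2" using i by (auto simp: F_def)
        then have "?a i * f (x i) \<le> ?a i * (\<epsilon> / 2)" using a by (intro mult_left_mono)
        then show ?thesis using False by simp
      qed
    qed
    also have "\<dots> = (\<Sum>i\<in>supp ?a. if i \<in> F then ?a i else 0) * C + sum ?a (supp ?a) * (\<epsilon> / 2)"
      by (simp only: sum.distrib sum_distrib_right)
    also have "(\<Sum>i\<in>supp ?a. if i \<in> F then ?a i else 0) = sum ?a F"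
    proof -
      have "supp ?a \<inter> F = F" by (auto simp: F_def)
      then show ?thesis using sum.inter_restrict[OF fin, of ?a F] by simp
    qed
    also have "sum ?a (supp ?a) = 1" by (rule sum_ra_supp[OF iL])
    finally have "\<epsilon> / 2 \<le> sum ?a F * C" by simp
    then have "\<epsilon> / (2 * C) \<le> sum ?a F" using C(1) by (simp add: field_simps)
    then show "\<exists>F\<in>upper_sets (\<epsilon> / 2) x. \<epsilon> / (2 * C) \<le> sum ?a F" using F by blast
  qed
  moreover have "\<epsilon> / 2 > 0" "\<epsilon> / (2 * C) > 0" using \<epsilon> C(1) by simp_all
  ultimately show ?thesis using iN by blast
qed

lemma norm_average_ge:
  fixes x :: "nat \<Rightarrow> 'a::banach"
  assumes L: "index_set L" and "supp (ra \<xi> L n) \<in> upper_sets \<delta> x"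
  shows "\<delta> \<le> norm (average (ra \<xi> L n) x)"
proof -
  let ?a = "ra \<xi> L n"
  obtain f where f: "f \<in> dual_ball" "\<And>i. i \<in> supp ?a \<Longrightarrow> \<delta> \<le> f (x i)"
    using assms(2) unfolding upper_sets_def by blast
  have "\<delta> = (\<Sum>i\<in>supp ?a. ?a i * \<delta>)"
    using sum_ra_supp[OF L, where \<xi> = \<xi> and n = n] by (simp add: sum_distrib_right[symmetric])
  also have "\<dots> \<le> (\<Sum>i\<in>supp ?a. ?a i * f (x i))"
    using f(2) ra_nonneg[OF L] by (intro sum_mono mult_left_mono) auto
  also have "\<dots> = f (average ?a x)" using linear_average_ra[OF L dual_ballD(1)[OF f(1)]] by simp
  also have "\<dots> \<le> norm (average ?a x)" using dual_ballD(2)[OF f(1), of "average ?a x"] by simp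
  finally show ?thesis .
qed

lemma averages_weakly_null:
  fixes x :: "nat \<Rightarrow> 'a::banach"
  assumes x: "weakly_null x" and L: "index_set L"
  shows "weakly_null (\<lambda>n. average (ra \<xi> L n) x)"
  unfolding weakly_null_def
proof (intro allI impI LIMSEQ_I)
  fix f :: "'a \<Rightarrow> real" and e :: real assume f: "bounded_linear f" and e: "e > 0"
  have lim: "(\<lambda>n. f (x n)) \<longlonglongrightarrow> 0" using x f by (simp add: weakly_null_def)
  obtain N where N: "\<And>n. n \<ge> N \<Longrightarrow> \<bar>f (x n)\<bar> < e / 2" using LIMSEQ_D[OF lim, of "e / 2"] e by auto
  have "norm (f (average (ra \<xi> L n) x) - 0) < e" if n: "n \<ge> N" for n
  proof -
    let ?a = "ra \<xi> L n"
    have "\<bar>f (average ?a x)\<bar> \<le> (\<Sum>i\<in>supp ?a. \<bar>?a i * f (x i)\<bar>)"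
      using linear_average_ra[OF L bounded_linear.linear[OF f], of \<xi> n x] by (simp add: sum_abs)
    also have "\<dots> \<le> (\<Sum>i\<in>supp ?a. ?a i * (e / 2))"
    proof (rule sum_mono)
      fix i assume "i \<in> supp ?a"
      then have "\<bar>f (x i)\<bar> \<le> e / 2" using supp_ra_ge[OF L] N[of i] n by fastforce
      then show "\<bar>?a i * f (x i)\<bar> \<le> ?a i * (e / 2)"
        using mult_left_mono[OF _ ra_nonneg[OF L, where \<xi> = \<xi> and n = n and i = i]]
          ra_nonneg[OF L, where \<xi> = \<xi> and n = n and i = i] by (simp only: abs_mult abs_of_nonneg)
    qed
    also have "\<dots> = e / 2"
      using sum_ra_supp[OF L, where \<xi> = \<xi> and n = n] by (simp only: sum_distrib_right[symmetric])
    finally show ?thesis using e by simp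
  qed
  then show "\<exists>N. \<forall>n\<ge>N. norm (f (average (ra \<xi> L n) x) - 0) < e" by blast
qed

text \<open>With Cesaro means \<open>S\<close>, the mean of the \<open>s\<close> averages from index
  \<open>k\<close> on equals \<open>(k + s) / s\<close> times \<open>S (k + s)\<close> minus
  \<open>k / s\<close> times \<open>S k\<close>. The length \<open>s\<close> is the minimum of the
  \<open>k\<close>-th remainder, hence exceeds \<open>k\<close>. So the coefficients are at most
  \<open>2\<close> and \<open>1\<close>, they differ by \<open>1\<close>, and the block means have
  the same limit as \<open>S\<close>.\<close>

lemma averages_osucc_convergent:
  fixes x :: "nat \<Rightarrow> 'a::banach"
  assumes L: "index_set L" and summ: "summable_along \<phi> L \<zeta> x"
  shows "convergent (\<lambda>n. average (ra (osucc \<zeta>) L n) x)"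
proof -
  define v where "v k = average (ra \<zeta> L k) x" for k
  define S where "S n = (1 / real n) *\<^sub>R (\<Sum>k<n. v k)" for n
  obtain l where l: "S \<longlonglongrightarrow> l"
    using summ unfolding summable_along_def convergent_def S_def v_def by blast
  define k where "k = block_start (ra \<zeta> L)"
  define s where "s = block_length (ra \<zeta> L)"
  have s: "k n < s n" for n
    using Inf_supp_ra[OF L, where \<xi> = \<zeta> and n = "k n"] Inf_remainder_ge[OF L, where \<xi> = \<zeta> and n = "k n"]
    by (simp add: s_def k_def block_length_def)
  have kSuc: "k (Suc n) = k n + s n" for n by (simp add: k_def s_def block_length_def)
  have kn: "n \<le> k n" for n
  proof (induction n)
    case (Suc n)
    then show ?case using s[of n] kSuc[of n] by simp
  qed simp
  define w where "w n = average (ra (osucc \<zeta>) L n) x" for n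
  have bound: "norm (w n - l) \<le> 2 * norm (S (k n + s n) - l) + norm (S (k n) - l)" for n
  proof -
    let ?k = "k n" and ?s = "s n"
    have pos: "real ?s > 0" using s[of n] by simp
    have S_eq: "(\<Sum>j<m. v j) = real m *\<^sub>R S m" for m by (cases "m = 0") (auto simp: S_def)
    have "w n = (1 / real ?s) *\<^sub>R (\<Sum>j<?s. v (?k + j))"
      unfolding w_def v_def s_def k_def by (rule average_ra_osucc[OF L])
    then have "real ?s *\<^sub>R w n = (\<Sum>j<?s. v (?k + j))" using pos by simp
    also have "\<dots> = (\<Sum>j<?k + ?s. v j) - (\<Sum>j<?k. v j)"
    proof -
      have "(\<Sum>j<?s. v (?k + j)) = sum v {?k..<?k + ?s}"
        using sum.shift_bounds_nat_ivl[of v 0 ?k ?s] by (simp add: lessThan_atLeast0 add.commute)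
      also have "\<dots> = (\<Sum>j<?k + ?s. v j) - (\<Sum>j<?k. v j)"
        unfolding lessThan_atLeast0 by (subst sum_diff_nat_ivl) simp_all
      finally show ?thesis .
    qed
    finally have "real ?s *\<^sub>R w n = real (?k + ?s) *\<^sub>R S (?k + ?s) - real ?k *\<^sub>R S ?k"
      by (simp only: S_eq)
    then have "real ?s *\<^sub>R (w n - l) = real (?k + ?s) *\<^sub>R (S (?k + ?s) - l) - real ?k *\<^sub>R (S ?k - l)"
      by (simp add: algebra_simps)
    then have "real ?s * norm (w n - l) = norm (real (?k + ?s) *\<^sub>R (S (?k + ?s) - l) - real ?k *\<^sub>R (S ?k - l))"
      by (metis abs_of_nat norm_scaleR)
    also have "\<dots> \<le> real (?k + ?s) * norm (S (?k + ?s) - l) + real ?k * norm (S ?k - l)"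
      by (rule order_trans[OF norm_triangle_ineq4]) simp
    also have "\<dots> \<le> (2 * real ?s) * norm (S (?k + ?s) - l) + real ?s * norm (S ?k - l)"
      using s[of n] by (intro add_mono mult_right_mono) auto
    also have "\<dots> = real ?s * (2 * norm (S (?k + ?s) - l) + norm (S ?k - l))" by (simp add: algebra_simps)
    finally show ?thesis using pos by (simp only: mult_le_cancel_left_pos)
  qed
  have lim_k: "filterlim k at_top sequentially"
    by (rule filterlim_at_top_mono[OF filterlim_ident]) (simp add: kn)
  have lim_ks: "filterlim (\<lambda>n. k n + s n) at_top sequentially"
    by (rule filterlim_at_top_mono[OF lim_k]) simp
  have "(\<lambda>n. 2 * norm (S (k n + s n) - l) + norm (S (k n) - l)) \<longlonglongrightarrow> 2 * 0 + 0"
    by (intro tendsto_add tendsto_mult tendsto_const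
        filterlim_compose[OF tendsto_norm_zero[OF LIM_zero[OF l]] lim_ks]
        filterlim_compose[OF tendsto_norm_zero[OF LIM_zero[OF l]] lim_k])
  then have "(\<lambda>n. 2 * norm (S (k n + s n) - l) + norm (S (k n) - l)) \<longlonglongrightarrow> 0" by simp
  then have "(\<lambda>n. w n - l) \<longlonglongrightarrow> 0"
    by (rule Lim_null_comparison[rotated]) (use bound in simp)
  then have "w \<longlonglongrightarrow> l" by (rule LIM_zero_cancel)
  then show ?thesis unfolding convergent_def w_def by blast
qed

lemma not_summable_if_schreier:
  fixes y :: "nat \<Rightarrow> 'a::banach"
  assumes y: "weakly_null y" and \<delta>: "\<delta> > 0"
    and upper: "\<And>F. schreier (osucc \<zeta>) F \<Longrightarrow> F \<in> upper_sets \<delta> y" and L: "index_set L"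
  shows "\<not> summable_along \<phi> L \<zeta> y"
proof
  assume "summable_along \<phi> L \<zeta> y"
  then obtain l where l: "(\<lambda>n. average (ra (osucc \<zeta>) L n) y) \<longlonglongrightarrow> l"
    using averages_osucc_convergent[OF L] unfolding convergent_def by blast
  then have "l = 0" by (rule weakly_null_tendsto[OF averages_weakly_null[OF y L]])
  then have lim: "(\<lambda>n. norm (average (ra (osucc \<zeta>) L n) y)) \<longlonglongrightarrow> 0" using l tendsto_norm_zero by blast
  have "\<delta> \<le> norm (average (ra (osucc \<zeta>) L n) y)" for n
  proof (rule norm_average_ge[OF L upper])
    show "schreier (osucc \<zeta>) (supp (ra (osucc \<zeta>) L n))"
      unfolding ra_eq_avg[OF L, of "osucc \<zeta>" n] by (rule schreier_supp_avg[OF index_set_remainder[OF L]])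
  qed
  then have "\<delta> \<le> 0" by (intro LIMSEQ_le_const[OF lim]) blast
  then show False using \<delta> by simp
qed

lemma not_weak_Banach_Saks_iff:
  "\<not> weak_Banach_Saks \<phi> \<xi> TYPE('a::banach) \<longleftrightarrow>
    (\<exists>x :: nat \<Rightarrow> 'a. weakly_null x \<and> (\<forall>L. index_set L \<longrightarrow> \<not> summable_along \<phi> L \<xi> x))"
proof
  assume "\<not> weak_Banach_Saks \<phi> \<xi> TYPE('a)"
  then obtain x :: "nat \<Rightarrow> 'a" where x: "weakly_convergent x"
    and not: "\<And>L. index_set L \<Longrightarrow> \<not> summable_along \<phi> L \<xi> x"
    unfolding weak_Banach_Saks_def index_set_def by blast
  obtain l where l: "\<And>f :: 'a \<Rightarrow> real. bounded_linear f \<Longrightarrow> (\<lambda>n. f (x n)) \<longlonglongrightarrow> f l"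
    using x unfolding weakly_convergent_def by blast
  define y where "y n = x n - l" for n
  have "weakly_null y"
    unfolding weakly_null_def
  proof (intro allI impI)
    fix f :: "'a \<Rightarrow> real" assume f: "bounded_linear f"
    then show "(\<lambda>n. f (y n)) \<longlonglongrightarrow> 0"
      using LIM_zero[OF l[OF f]] by (simp add: y_def linear_diff[OF bounded_linear.linear[OF f]])
  qed
  moreover have "\<not> summable_along \<phi> L \<xi> y" if L: "index_set L" for L
  proof
    have avg: "average (ra \<xi> L k) x = average (ra \<xi> L k) y + l" for k
      using sum_ra_supp[OF L, where \<xi> = \<xi> and n = k]
      by (simp add: average_ra[OF L] y_def scaleR_diff_right sum_subtractf scaleR_sum_left[symmetric])
    assume "summable_along \<phi> L \<xi> y"
    then obtain m where m: "(\<lambda>n. (1 / real n) *\<^sub>R (\<Sum>k<n. average (ra \<xi> L k) y)) \<longlonglongrightarrow> m"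
      unfolding summable_along_def convergent_def by blast
    have "(\<lambda>n. (1 / real n) *\<^sub>R (\<Sum>k<n. average (ra \<xi> L k) y) + l) \<longlonglongrightarrow> m + l"
      by (intro tendsto_add m tendsto_const)
    \<comment> \<open>At \<open>n = 0\<close> the left side is \<open>l\<close> and the right side
      is \<open>0\<close>, because \<open>1 / 0 = 0\<close>.\<close>
    moreover have "eventually (\<lambda>n. (1 / real n) *\<^sub>R (\<Sum>k<n. average (ra \<xi> L k) y) + l
        = (1 / real n) *\<^sub>R (\<Sum>k<n. average (ra \<xi> L k) x)) sequentially"
      using eventually_gt_at_top[of 0]
      by eventually_elim (simp add: avg sum.distrib scaleR_add_right sum_constant_scaleR)
    ultimately have "(\<lambda>n. (1 / real n) *\<^sub>R (\<Sum>k<n. average (ra \<xi> L k) x)) \<longlonglongrightarrow> m + l"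
      by (rule Lim_transform_eventually)
    then show False using not[OF L] unfolding summable_along_def convergent_def by blast
  qed
  ultimately show "\<exists>x :: nat \<Rightarrow> 'a. weakly_null x \<and> (\<forall>L. index_set L \<longrightarrow> \<not> summable_along \<phi> L \<xi> x)"
    by blast
next
  assume "\<exists>x :: nat \<Rightarrow> 'a. weakly_null x \<and> (\<forall>L. index_set L \<longrightarrow> \<not> summable_along \<phi> L \<xi> x)"
  then obtain x :: "nat \<Rightarrow> 'a" where x: "weakly_null x"
    "\<forall>L. index_set L \<longrightarrow> \<not> summable_along \<phi> L \<xi> x" by blast
  have "weakly_convergent x"
    unfolding weakly_convergent_def
  proof (intro exI[of _ 0] allI impI)
    fix f :: "'a \<Rightarrow> real" assume f: "bounded_linear f"
    then show "(\<lambda>n. f (x n)) \<longlonglongrightarrow> f 0"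
      using x(1) linear_0[OF bounded_linear.linear[OF f]] by (simp add: weakly_null_def)
  qed
  then show "\<not> weak_Banach_Saks \<phi> \<xi> TYPE('a)"
    using x(2) unfolding weak_Banach_Saks_def index_set_def by blast
qed

lemma schreier_upper_sets:
  assumes bad: "\<not> weak_Banach_Saks \<phi> \<xi> TYPE('a::banach)" and "\<eta> \<le> \<xi>"
  shows "\<exists>(y :: nat \<Rightarrow> 'a) \<delta>. weakly_null y \<and> \<delta> > 0 \<and> (\<forall>F. schreier \<eta> F \<longrightarrow> F \<in> upper_sets \<delta> y)"
proof -
  obtain x :: "nat \<Rightarrow> 'a" where x: "weakly_null x" "\<And>L. index_set L \<Longrightarrow> \<not> summable_along \<phi> L \<xi> x"
    using bad not_weak_Banach_Saks_iff by blast
  obtain \<delta> \<epsilon> M where \<delta>: "\<delta> > 0" and \<epsilon>: "\<epsilon> > 0" and M: "index_set M" "large (upper_sets \<delta> x) \<xi> \<epsilon> M"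
    using large_if_not_summable[OF x] by blast
  have "\<exists>N\<subseteq>M. infinite N \<and> large (upper_sets \<delta> x) \<eta> (\<epsilon> / 2) N"
    by (rule large_antimono[OF _ M]) (use assms(2) \<epsilon> in \<open>auto simp: upper_sets_def\<close>)
  then obtain N where N: "N \<subseteq> M" "infinite N" "large (upper_sets \<delta> x) \<eta> (\<epsilon> / 2) N" by blast
  have iN: "index_set N" using index_set_subset[OF M(1)] N by blast
  obtain \<mu> where \<mu>: "strict_mono \<mu>" "\<And>F. schreier \<eta> F \<Longrightarrow> \<mu> ` F \<in> upper_sets \<delta> x"
    using schreier_image_if_large[OF hereditary_upper_sets iN _ N(3)] \<epsilon> by auto
  then show ?thesis
    using weakly_null_comp[OF x(1) \<mu>(1)] upper_sets_comp[OF \<mu>(1)] \<delta> by blast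
qed

lemma weak_Banach_Saks_mono:
  assumes "weak_Banach_Saks \<phi> \<zeta> TYPE('a::banach)" "\<zeta> \<le> \<xi>"
  shows "weak_Banach_Saks \<phi> \<xi> TYPE('a)"
proof (rule ccontr)
  assume bad: "\<not> weak_Banach_Saks \<phi> \<xi> TYPE('a)"
  then have "\<zeta> < \<xi>" using assms by (cases "\<zeta> = \<xi>") auto
  then have "osucc \<zeta> \<le> \<xi>" by (simp add: osucc_le_iff)
  from schreier_upper_sets[OF bad this] obtain y :: "nat \<Rightarrow> 'a" and \<delta> where
    "weakly_null y" "\<delta> > 0" "\<And>F. schreier (osucc \<zeta>) F \<Longrightarrow> F \<in> upper_sets \<delta> y" by blast
  then show False using assms(1) not_summable_if_schreier not_weak_Banach_Saks_iff by blast
qed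

end

section \<open>Unconditionality\<close>

text \<open>The upper bound on \<open>B\<close> is one-sided: if a point cannot be added to
  \<open>B\<close>, functionals exceed \<open>\<delta> / 2\<close> there, which weak nullity allows
  only finitely often. The gap between \<delta> and \<open>\<delta> / 2\<close> is the source of the
  l1 constant.\<close>

definition separated :: "real \<Rightarrow> (nat \<Rightarrow> 'a::real_normed_vector) \<Rightarrow> nat set \<Rightarrow> nat set \<Rightarrow> bool" where
  "separated \<delta> y A B \<longleftrightarrow>
     (\<exists>f\<in>dual_ball. (\<forall>i\<in>A. \<delta> \<le> f (y i)) \<and> (\<forall>i\<in>B. f (y i) \<le> \<delta> / 2))"

lemma finite_chain_has_greatest:
  assumes "finite I" "I \<noteq> {}" "\<And>i j. i \<in> I \<Longrightarrow> j \<in> I \<Longrightarrow> H i \<subseteq> H j \<or> H j \<subseteq> H i"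
  shows "\<exists>i\<in>I. \<forall>j\<in>I. H j \<subseteq> H i"
  using assms
proof (induction I rule: finite_ne_induct)
  case (singleton i)
  then show ?case by blast
next
  case (insert i I)
  then obtain m where m: "m \<in> I" "\<forall>j\<in>I. H j \<subseteq> H m" by (metis insertCI)
  then show ?case using insert.prems[of i m] by blast
qed

lemma initial_segment_chain:
  assumes "initial_segment A L" "initial_segment B L"
  shows "A \<subseteq> B \<or> B \<subseteq> A"
proof (rule ccontr)
  assume "\<not> ?thesis"
  then obtain a b where "a \<in> A" "a \<notin> B" "b \<in> B" "b \<notin> A" by blast
  then have "b < a" "a < b" using assms unfolding initial_segment_def by blast+
  then show False by simp
qed

text \<open>If \<open>H i\<close> witnesses that \<open>n i\<close> is bad, for all \<open>n i\<close> in an infinite set, then a functional that is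
  large on the longest of finitely many \<open>H i\<close> is large on the corresponding \<open>n i\<close>. By compactness
  some functional is large on all \<open>n i\<close>, contradicting weak nullity.\<close>

lemma finite_bad:
  fixes y :: "nat \<Rightarrow> 'a::real_normed_vector"
  assumes y: "weakly_null y" and \<delta>: "\<delta> > 0"
    and bad: "\<And>n L. n \<in> B \<Longrightarrow> L \<subseteq> B \<inter> {n<..} \<Longrightarrow> infinite L \<Longrightarrow>
      \<exists>H. initial_segment H L \<and> separated \<delta> y (G \<union> H) G' \<and> \<not> separated \<delta> y (G \<union> H) (insert n G')"
  shows "finite B"
proof (rule ccontr)
  assume B: "infinite B"
  define n where "n = enumerate B"
  have n: "strict_mono n" "\<And>i. n i \<in> B"
    unfolding n_def using strict_mono_enumerate[OF B] enumerate_in_set[OF B] by auto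
  have "\<exists>f\<in>dual_ball. \<forall>i. f \<in> {f. \<delta> / 2 \<le> f (y (n i))}"
  proof (rule dual_ball_compactness)
    show "closed {f. \<delta> / 2 \<le> f (y (n i))}" for i
      by (intro closed_Collect_le continuous_on_const continuous_on_product_coordinates)
    fix m :: nat
    show "\<exists>f\<in>dual_ball. \<forall>i<m. f \<in> {f. \<delta> / 2 \<le> f (y (n i))}"
    proof (cases "m = 0")
      case True
      have "(\<lambda>_. 0) \<in> (dual_ball :: ('a \<Rightarrow> real) set)" by (simp add: dual_ball_def linear_iff)
      then show ?thesis using True by blast
    next
      case False
      \<comment> \<open>\<open>L\<close> lies beyond \<open>n i\<close> for all
        \<open>i < m\<close>, so the witnesses for different \<open>i\<close> are initial segments
        of one set and hence nested.\<close>
      define L where "L = B \<inter> {n m<..}"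
      have L: "infinite L" unfolding L_def by (rule infinite_Int_greaterThan[OF B])
      have "\<exists>H. initial_segment H L \<and> separated \<delta> y (G \<union> H) G' \<and>
          \<not> separated \<delta> y (G \<union> H) (insert (n i) G')" if "i < m" for i
      proof (rule bad[OF n(2) _ L])
        show "L \<subseteq> B \<inter> {n i<..}" using strict_mono_less[OF n(1), of i m] that by (auto simp: L_def)
      qed
      then obtain H where H: "\<And>i. i < m \<Longrightarrow> initial_segment (H i) L"
        "\<And>i. i < m \<Longrightarrow> separated \<delta> y (G \<union> H i) G'"
        "\<And>i. i < m \<Longrightarrow> \<not> separated \<delta> y (G \<union> H i) (insert (n i) G')" by metis
      have "\<exists>i\<in>{..<m}. \<forall>j\<in>{..<m}. H j \<subseteq> H i"
        by (rule finite_chain_has_greatest) (use False initial_segment_chain H(1) in \<open>auto simp: lessThan_empty_iff\<close>)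
      then obtain i where i: "i < m" "\<And>j. j < m \<Longrightarrow> H j \<subseteq> H i" by auto
      obtain f where f: "f \<in> dual_ball" "\<forall>k\<in>G \<union> H i. \<delta> \<le> f (y k)" "\<forall>k\<in>G'. f (y k) \<le> \<delta> / 2"
        using H(2)[OF i(1)] unfolding separated_def by blast
      have "\<delta> / 2 \<le> f (y (n j))" if j: "j < m" for j
      proof (rule ccontr)
        assume "\<not> ?thesis"
        then have "\<forall>k\<in>insert (n j) G'. f (y k) \<le> \<delta> / 2" using f(3) by auto
        moreover have "\<forall>k\<in>G \<union> H j. \<delta> \<le> f (y k)" using f(2) i(2)[OF j] by blast
        ultimately show False using H(3)[OF j] f(1) unfolding separated_def by blast
      qed
      then show ?thesis using f(1) by blast
    qed
  qed
  then obtain f where f: "f \<in> dual_ball" "\<And>i. \<delta> / 2 \<le> f (y (n i))" by blast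
  have "(\<lambda>i. f ((y \<circ> n) i)) \<longlonglongrightarrow> 0"
    using weakly_null_comp[OF y n(1)] dual_ballD(3)[OF f(1)] by (simp only: weakly_null_def)
  then have "\<delta> / 2 \<le> 0" by (rule LIMSEQ_le_const) (use f(2) in auto)
  then show False using \<delta> by simp
qed

text \<open>The points of \<open>E - H\<close> are added in increasing order. When \<open>b\<close>
  is added, \<open>G\<close> and \<open>G'\<close> are the parts of \<open>H\<close> and
  \<open>E - H\<close> below \<open>b\<close>; failure means that the part of \<open>H\<close> above
  \<open>b\<close> lies in \<open>bad b (G, G')\<close>. A first fusion with
  \<open>open_ramsey\<close> makes failure occur either along every infinite set beyond
  \<open>b\<close> or for no finite set there. By \<open>finite_bad\<close> the former happens for
  only finitely many \<open>b\<close> for each pair, and a second fusion discards these.\<close>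

lemma weakly_null_unconditional:
  fixes y :: "nat \<Rightarrow> 'a::real_normed_vector"
  assumes y: "weakly_null y" and \<delta>: "\<delta> > 0"
  shows "\<exists>N. infinite N \<and> (\<forall>H E. finite H \<longrightarrow> finite E \<longrightarrow> H \<subseteq> N \<longrightarrow> E \<subseteq> N \<longrightarrow>
    H \<in> upper_sets \<delta> y \<longrightarrow> separated \<delta> y H (E - H))"
proof -
  define bad where "bad = (\<lambda>n (G, G'). {H. separated \<delta> y (G \<union> H) G' \<and>
    \<not> separated \<delta> y (G \<union> H) (insert n G')})"
  define all_bad where "all_bad = (\<lambda>n p N. \<forall>L\<subseteq>N. infinite L \<longrightarrow> (\<exists>H\<in>bad n p. initial_segment H L))"
  define none_bad where "none_bad = (\<lambda>n p N. \<forall>H\<subseteq>N. finite H \<longrightarrow> H \<notin> bad n p)"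
  have sub_all: "all_bad n p N'" if "all_bad n p N" "N' \<subseteq> N" for n p N N'
    using that unfolding all_bad_def by (meson order_trans)
  have sub_none: "none_bad n p N'" if "none_bad n p N" "N' \<subseteq> N" for n p N N'
    using that unfolding none_bad_def by (meson order_trans)
  define D where "D = (\<lambda>n N. \<forall>p\<in>Pow {..n} \<times> Pow {..n}. all_bad n p N \<or> none_bad n p N)"
  have "\<exists>N\<subseteq>UNIV. infinite N \<and> D 0 N \<and> (\<forall>n\<in>N. \<forall>k\<le>Suc n. D k (N \<inter> {n<..}))"
  proof (rule fusion)
    fix n and N :: "nat set" assume N: "infinite N"
    show "\<exists>N'\<subseteq>N. infinite N' \<and> D n N'"
      unfolding D_def
    proof (rule dense_finite[where M = UNIV])
      fix p and N :: "nat set" assume "infinite N"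
      then show "\<exists>N'\<subseteq>N. infinite N' \<and> (all_bad n p N' \<or> none_bad n p N')"
        unfolding all_bad_def none_bad_def by (rule open_ramsey)
    next
      fix p and N N' :: "nat set" assume "all_bad n p N \<or> none_bad n p N" "N' \<subseteq> N"
      then show "all_bad n p N' \<or> none_bad n p N'" using sub_all sub_none by blast
    qed (use N in auto)
  next
    fix n and N N' :: "nat set" assume "D n N" "N' \<subseteq> N"
    then show "D n N'" unfolding D_def using sub_all sub_none by blast
  qed simp
  then obtain M where M: "infinite M" and DM: "\<And>n. n \<in> M \<Longrightarrow> D n (M \<inter> {n<..})"
    by (meson le_SucI order.refl)
  define bads where "bads p = {n\<in>M. all_bad n p (M \<inter> {n<..})}" for p
  have fin: "finite (bads p)" for p
  proof -
    obtain G G' where p: "p = (G, G')" by (cases p)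
    show ?thesis
    proof (rule finite_bad[OF y \<delta>, where G = G and G' = G'])
      fix n L assume n: "n \<in> bads p" and L: "L \<subseteq> bads p \<inter> {n<..}" "infinite L"
      have "L \<subseteq> M \<inter> {n<..}" using L(1) by (auto simp: bads_def)
      then obtain H where "H \<in> bad n p" "initial_segment H L"
        using n L(2) unfolding bads_def all_bad_def by blast
      then show "\<exists>H. initial_segment H L \<and> separated \<delta> y (G \<union> H) G' \<and>
          \<not> separated \<delta> y (G \<union> H) (insert n G')" by (auto simp: bad_def p)
    qed
  qed
  define D2 where "D2 = (\<lambda>n N. \<forall>p\<in>Pow {..n} \<times> Pow {..n}. N \<inter> bads p = {})"
  have "\<exists>N\<subseteq>M. infinite N \<and> D2 0 N \<and> (\<forall>n\<in>N. \<forall>k\<le>Suc n. D2 k (N \<inter> {n<..}))"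
  proof (rule fusion[OF M])
    fix n and N :: "nat set" assume N: "infinite N" "N \<subseteq> M"
    let ?B = "\<Union>p\<in>Pow {..n} \<times> Pow {..n}. bads p"
    have "finite ?B" using fin by (intro finite_UN_I) auto
    then have "infinite (N - ?B)" using N(1) by (rule Diff_infinite_finite)
    moreover have "D2 n (N - ?B)" unfolding D2_def by blast
    ultimately show "\<exists>N'\<subseteq>N. infinite N' \<and> D2 n N'" by (intro exI[of _ "N - ?B"]) auto
  next
    fix n and N N' :: "nat set" assume "D2 n N" "N' \<subseteq> N"
    then show "D2 n N'" unfolding D2_def by blast
  qed
  then obtain N where N: "N \<subseteq> M" "infinite N" "D2 0 N"
    and D2N: "\<And>n. n \<in> N \<Longrightarrow> D2 n (N \<inter> {n<..})" by (meson le_SucI order.refl)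
  have good: "separated \<delta> y (G \<union> H) (insert b G')"
    if b: "b \<in> N" and G: "G \<subseteq> N \<inter> {..<b}" "G' \<subseteq> N \<inter> {..<b}" and H: "H \<subseteq> N \<inter> {b<..}" "finite H"
      and sep: "separated \<delta> y (G \<union> H) G'" for b G G' H
  proof -
    have "b \<notin> bads (G, G')"
    proof (cases "G \<union> G' = {}")
      case True
      then show ?thesis using N(3) b unfolding D2_def by blast
    next
      case False
      define m where "m = Max (G \<union> G')"
      have fin: "finite (G \<union> G')" using G by (meson Un_least finite_lessThan finite_subset le_inf_iff)
      have m: "m \<in> G \<union> G'" unfolding m_def by (rule Max_in[OF fin False])
      have max: "g \<le> m" if "g \<in> G \<union> G'" for g unfolding m_def by (rule Max_ge[OF fin that])
      have mN: "m \<in> N" "m < b" using m G by auto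
      have "(G, G') \<in> Pow {..m} \<times> Pow {..m}" using max by auto
      then have "(N \<inter> {m<..}) \<inter> bads (G, G') = {}" using D2N[OF mN(1)] unfolding D2_def by blast
      then show ?thesis using b mN(2) by blast
    qed
    then have "\<not> all_bad b (G, G') (M \<inter> {b<..})" using b N(1) unfolding bads_def by blast
    moreover have "(G, G') \<in> Pow {..b} \<times> Pow {..b}" using G by auto
    ultimately have "none_bad b (G, G') (M \<inter> {b<..})" using DM[of b] b N(1) unfolding D_def by blast
    then have "H \<notin> bad b (G, G')" using H N(1) unfolding none_bad_def by blast
    then show ?thesis using sep by (simp add: bad_def)
  qed
  have "separated \<delta> y H (E - H)"
    if E: "finite E" "E \<subseteq> N" and H: "finite H" "H \<subseteq> N" "H \<in> upper_sets \<delta> y" for H E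
    using E
  proof (induction E rule: finite_linorder_max_induct)
    case empty
    then show ?case using H(3) unfolding upper_sets_def separated_def by auto
  next
    case (insert b E)
    then have IH: "separated \<delta> y H (E - H)" by auto
    show ?case
    proof (cases "b \<in> H")
      case True
      then show ?thesis using IH by (simp add: insert_Diff_if)
    next
      case False
      define G where "G = H \<inter> {..<b}"
      define H' where "H' = H \<inter> {b<..}"
      have GH: "G \<union> H' = H" using False by (auto simp: G_def H'_def) (metis linorder_neqE_nat)
      have "separated \<delta> y (G \<union> H') (insert b (E - H))"
      proof (rule good)
        show "separated \<delta> y (G \<union> H') (E - H)" using IH GH by simp
      qed (use insert H in \<open>auto simp: G_def H'_def\<close>)
      then show ?thesis using False GH by (simp add: insert_Diff_if)
    qed
  qed
  then show ?thesis using N(2) by blast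
qed

text \<open>After a change of all signs the coefficients have nonnegative sum. Take a functional at
  least \<delta> on the indices of nonnegative coefficients and at most \<open>\<delta> / 2\<close>
  on the others. The number \<open>3 / 4 * \<delta>\<close> is the middle of this gap: for either
  sign \<open>a i * f (y i)\<close> exceeds \<open>3 / 4 * \<delta> * a i\<close> by at least
  \<open>\<delta> / 4 * \<bar>a i\<bar>\<close>, and the terms \<open>3 / 4 * \<delta> * a i\<close>
  have nonnegative sum.\<close>

lemma l1_lower_bound:
  fixes y :: "nat \<Rightarrow> 'a::real_normed_vector"
  assumes F: "finite F" and \<delta>: "\<delta> > 0" and sep: "\<And>G. G \<subseteq> F \<Longrightarrow> separated \<delta> y G (F - G)"
  shows "\<delta> / 4 * (\<Sum>i\<in>F. \<bar>a i\<bar>) \<le> norm (\<Sum>i\<in>F. a i *\<^sub>R y i)"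
proof -
  have pos: "\<delta> / 4 * (\<Sum>i\<in>F. \<bar>a i\<bar>) \<le> norm (\<Sum>i\<in>F. a i *\<^sub>R y i)"
    if half: "(\<Sum>i\<in>F. a i) \<ge> 0" for a
  proof -
    define G where "G = {i\<in>F. a i \<ge> 0}"
    obtain f where f: "f \<in> dual_ball" "\<And>i. i \<in> G \<Longrightarrow> \<delta> \<le> f (y i)" "\<And>i. i \<in> F - G \<Longrightarrow> f (y i) \<le> \<delta> / 2"
      using sep[of G] unfolding separated_def G_def by blast
    have "(\<Sum>i\<in>F. \<delta> / 4 * \<bar>a i\<bar> + 3 / 4 * \<delta> * a i) \<le> (\<Sum>i\<in>F. a i * f (y i))"
    proof (rule sum_mono)
      fix i assume i: "i \<in> F"
      show "\<delta> / 4 * \<bar>a i\<bar> + 3 / 4 * \<delta> * a i \<le> a i * f (y i)"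
      proof (cases "a i \<ge> 0")
        case True
        then have "a i * \<delta> \<le> a i * f (y i)" using f(2)[of i] i by (intro mult_left_mono) (auto simp: G_def)
        then show ?thesis using True by (simp add: algebra_simps)
      next
        case False
        then have "a i * (\<delta> / 2) \<le> a i * f (y i)"
          using f(3)[of i] i by (intro mult_left_mono_neg) (auto simp: G_def)
        then show ?thesis using False by (simp add: algebra_simps)
      qed
    qed
    moreover have "0 \<le> 3 / 4 * \<delta> * (\<Sum>i\<in>F. a i)" using half \<delta> by simp
    ultimately have "\<delta> / 4 * (\<Sum>i\<in>F. \<bar>a i\<bar>) \<le> (\<Sum>i\<in>F. a i * f (y i))"
      by (simp only: sum.distrib sum_distrib_left[symmetric])
    also have "\<dots> = f (\<Sum>i\<in>F. a i *\<^sub>R y i)"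
      using dual_ballD(1)[OF f(1)] by (simp add: linear_sum linear_scale)
    also have "\<dots> \<le> norm (\<Sum>i\<in>F. a i *\<^sub>R y i)"
      using dual_ballD(2)[OF f(1), of "\<Sum>i\<in>F. a i *\<^sub>R y i"] by simp
    finally show ?thesis .
  qed
  show ?thesis
  proof (cases "(\<Sum>i\<in>F. a i) \<ge> 0")
    case True
    then show ?thesis by (rule pos)
  next
    case False
    then show ?thesis using pos[of "\<lambda>i. - a i"] by (simp add: sum_negf)
  qed
qed

section \<open>Trees of $\ell^1$-sequences\<close>

text \<open>A lower bound for the usual rank of the node \<open>s\<close>; as a predicate it also
  makes sense when \<open>T\<close> is ill-founded and no ordinal rank exists.\<close>

function rank_ge :: "('b list \<Rightarrow> bool) \<Rightarrow> omega1 \<Rightarrow> 'b list \<Rightarrow> bool" where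
  "rank_ge T \<alpha> s \<longleftrightarrow> T s \<and> (\<forall>\<beta>\<in>{..<\<alpha>}. \<exists>d. rank_ge T \<beta> (s @ [d]))"
  by auto
termination
proof (relation "inv_image {(\<beta>, \<alpha>). \<beta> < \<alpha>} (\<lambda>(T, \<alpha>, s). \<alpha>)")
  show "wf (inv_image {(\<beta>, \<alpha>). \<beta> < \<alpha>} (\<lambda>(T::'b list \<Rightarrow> bool, \<alpha>::omega1, s::'b list). \<alpha>))"
    by (rule wf_inv_image[OF wf])
qed auto

declare rank_ge.simps [simp del]

lemma rank_ge_antimono: "rank_ge T \<alpha> s \<Longrightarrow> \<beta> \<le> \<alpha> \<Longrightarrow> rank_ge T \<beta> s"
  unfolding rank_ge.simps[of T \<alpha> s] rank_ge.simps[of T \<beta> s] by auto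

text \<open>A node of rank at least every \<alpha> has a child with the same property. Otherwise
  every child \<open>d\<close> fails at some \<open>\<alpha> d\<close>; for \<open>d\<close> in
  \<open>D\<close> these countably many ordinals have a bound \<gamma>, yet rank at least
  \<open>osucc \<gamma>\<close> provides a child of rank at least \<gamma>.\<close>

lemma infinite_branch:
  assumes D: "countable D" and T: "\<And>s. T s \<Longrightarrow> set s \<subseteq> D" and rank: "\<And>\<alpha>. rank_ge T \<alpha> []"
  shows "\<exists>ds. \<forall>n. T (map ds [0..<n])"
proof -
  have step: "\<exists>d. \<forall>\<alpha>. rank_ge T \<alpha> (s @ [d])" if s: "\<forall>\<alpha>. rank_ge T \<alpha> s" for s
  proof (rule ccontr)
    assume "\<not> ?thesis"
    then have "\<forall>d. \<exists>\<alpha>. \<not> rank_ge T \<alpha> (s @ [d])" by blast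
    then obtain \<alpha> where \<alpha>: "\<And>d. \<not> rank_ge T (\<alpha> d) (s @ [d])" by metis
    obtain \<gamma> where \<gamma>: "\<And>d. d \<in> D \<Longrightarrow> \<alpha> d \<le> \<gamma>"
      using countable_bounded_omega1[of "\<alpha> ` D"] D by auto
    obtain d where d: "rank_ge T \<gamma> (s @ [d])"
      using s[rule_format, of "osucc \<gamma>"] unfolding rank_ge.simps[of T "osucc \<gamma>"]
      by (meson lessThan_iff less_osucc)
    then have "T (s @ [d])" unfolding rank_ge.simps[of T \<gamma>] by blast
    then have "d \<in> D" using T by fastforce
    then show False using rank_ge_antimono[OF d \<gamma>] \<alpha> by blast
  qed
  have "\<exists>S. \<forall>n. (length (S n) = n \<and> (\<forall>\<alpha>. rank_ge T \<alpha> (S n))) \<and> (\<exists>d. S (Suc n) = S n @ [d])"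
  proof (rule dependent_nat_choice)
    show "\<exists>s. length s = 0 \<and> (\<forall>\<alpha>. rank_ge T \<alpha> s)" using rank by simp
    fix s n assume s: "length s = n \<and> (\<forall>\<alpha>. rank_ge T \<alpha> s)"
    then obtain d where "\<forall>\<alpha>. rank_ge T \<alpha> (s @ [d])" using step by blast
    then show "\<exists>s'. (length s' = Suc n \<and> (\<forall>\<alpha>. rank_ge T \<alpha> s')) \<and> (\<exists>d. s' = s @ [d])"
      using s by (intro exI[of _ "s @ [d]"]) simp
  qed
  then obtain S where S: "\<And>n. length (S n) = n" "\<And>n \<alpha>. rank_ge T \<alpha> (S n)"
    "\<And>n. \<exists>d. S (Suc n) = S n @ [d]" by blast
  define ds where "ds n = S (Suc n) ! n" for n
  have "map ds [0..<n] = S n" for n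
  proof (induction n)
    case (Suc n)
    obtain d where "S (Suc n) = S n @ [d]" using S(3) by blast
    then show ?case using Suc S(1)[of n] by (simp add: ds_def nth_append)
  qed (use S(1)[of 0] in simp)
  moreover have "T (S n)" for n using S(2)[of 0 n] unfolding rank_ge.simps[of T 0 "S n"] by blast
  ultimately show ?thesis by metis
qed

text \<open>One constant \<open>K\<close> serves both bounds, so that natural values of
  \<open>K\<close> give countably many trees to choose from.\<close>

definition l1_list :: "'a::real_normed_vector set \<Rightarrow> real \<Rightarrow> 'a list \<Rightarrow> bool" where
  "l1_list D K s \<longleftrightarrow> set s \<subseteq> D \<and> (\<forall>d\<in>set s. norm d \<le> K) \<and>
     (\<forall>a. (\<Sum>i<length s. \<bar>a i\<bar>) \<le> K * norm (\<Sum>i<length s. a i *\<^sub>R s ! i))"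

lemma contains_l1_if_branch:
  fixes ds :: "nat \<Rightarrow> 'a::banach"
  assumes branch: "\<And>n. l1_list D K (map ds [0..<n])"
  shows "contains_l1 TYPE('a)"
proof -
  have norm_le: "norm (ds n) \<le> K" for n using branch[of "Suc n"] by (simp add: l1_list_def)
  have lower: "(\<Sum>i<n. \<bar>a i\<bar>) \<le> K * norm (\<Sum>i<n. a i *\<^sub>R ds i)" for a n
  proof -
    have "(\<Sum>i<n. a i *\<^sub>R map ds [0..<n] ! i) = (\<Sum>i<n. a i *\<^sub>R ds i)" by (intro sum.cong) auto
    then show ?thesis using branch[of n] by (simp add: l1_list_def)
  qed
  have "1 \<le> K * norm (ds 0)" using lower[of "\<lambda>_. 1" 1] by simp
  moreover have "0 \<le> K" using norm_le[of 0] norm_ge_zero[of "ds 0"] by linarith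
  ultimately have K: "K > 0" by (cases "K = 0") auto
  define T where "T a = (\<Sum>i. a i *\<^sub>R ds i)" for a :: "nat \<Rightarrow> real"
  have summ_norm: "summable (\<lambda>i. norm (a i *\<^sub>R ds i))" if "a \<in> l1" for a
    by (rule summable_comparison_test'[where g = "\<lambda>i. \<bar>a i\<bar> * K" and N = 0])
      (use that norm_le in \<open>auto simp: l1_def mult_left_mono intro: summable_mult2\<close>)
  have summ: "summable (\<lambda>i. a i *\<^sub>R ds i)" if "a \<in> l1" for a
    using summ_norm[OF that] by (rule summable_norm_cancel)
  have "\<forall>a\<in>l1. \<forall>b\<in>l1. T (\<lambda>i. a i + b i) = T a + T b"
    using summ by (simp add: T_def scaleR_add_left suminf_add)
  moreover have "\<forall>r. \<forall>a\<in>l1. T (\<lambda>i. r * a i) = r *\<^sub>R T a"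
  proof (intro allI ballI)
    fix r a assume "a \<in> l1"
    then have "r *\<^sub>R T a = (\<Sum>i. r *\<^sub>R (a i *\<^sub>R ds i))"
      unfolding T_def by (intro suminf_scaleR_right summ)
    then show "T (\<lambda>i. r * a i) = r *\<^sub>R T a" by (simp add: T_def)
  qed
  moreover have "(1 / K) * l1_norm a \<le> norm (T a) \<and> norm (T a) \<le> K * l1_norm a" if a: "a \<in> l1" for a
  proof
    have "norm (T a) \<le> (\<Sum>i. norm (a i *\<^sub>R ds i))"
      unfolding T_def by (rule summable_norm[OF summ_norm[OF a]])
    also have "\<dots> \<le> (\<Sum>i. \<bar>a i\<bar> * K)"
      using norm_le a by (intro suminf_le summ_norm[OF a]) (auto simp: l1_def mult_left_mono intro: summable_mult2)
    also have "\<dots> = K * l1_norm a"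
      using a suminf_mult[of "\<lambda>i. \<bar>a i\<bar>" K] unfolding l1_norm_def l1_def by (simp add: mult.commute)
    finally show "norm (T a) \<le> K * l1_norm a" .
    have lim1: "(\<lambda>n. \<Sum>i<n. \<bar>a i\<bar>) \<longlonglongrightarrow> l1_norm a"
      using a unfolding l1_norm_def l1_def by (intro summable_LIMSEQ) simp
    have lim2: "(\<lambda>n. K * norm (\<Sum>i<n. a i *\<^sub>R ds i)) \<longlonglongrightarrow> K * norm (T a)"
      unfolding T_def by (intro tendsto_mult tendsto_const tendsto_norm summable_LIMSEQ summ[OF a])
    have "l1_norm a \<le> K * norm (T a)"
      by (rule LIMSEQ_le[OF lim1 lim2]) (use lower in auto)
    then show "(1 / K) * l1_norm a \<le> norm (T a)" using K by (simp add: pos_divide_le_eq mult.commute)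
  qed
  ultimately show ?thesis
    unfolding contains_l1_def using K by (intro exI[of _ T] conjI exI[of _ "1 / K"] exI[of _ K]) auto
qed

context repeated_averages
begin

section \<open>Ranks of Schreier families\<close>

lemma schreier_singleton: "n \<ge> 1 \<Longrightarrow> schreier \<xi> {n}"
proof (induction \<xi> rule: omega1_induct)
  case zero
  show ?case by (rule schreier_zero[of _ n]) simp
next
  case (succ \<zeta>)
  have "blocks \<zeta> (Suc 0) ({n} \<union> {})" by (rule blocks_Suc[OF succ.IH blocks_zero]) (use succ in auto)
  then show ?case by (intro schreier_osucc[of \<zeta> "Suc 0"]) (use succ in auto)
next
  case (limit \<xi>)
  have "schreier (\<phi> \<xi> 1) {n}"
    using limit.IH[OF limit_sequences_less[OF limit_sequences limit.hyps]] limit.prems by simp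
  then show ?case using limit by (intro schreier_limit[of \<xi> 1]) auto
qed

text \<open>Schreier families grow with the ordinal only far enough out, whence \<open>n0\<close>.
  If \<xi> is the successor of \<eta>, the new point takes a block of its own, so there are two
  blocks and \<open>n \<ge> 2\<close> is asked. In the other cases the point is accommodated at an
  order between \<eta> and \<xi>, and one block or one term of the limit sequence leads back to
  \<xi>.\<close>

lemma schreier_insert:
  "\<eta> < \<xi> \<Longrightarrow> \<exists>n0. \<forall>n\<ge>n0. \<forall>F. schreier \<eta> F \<longrightarrow> F \<subseteq> {n<..} \<longrightarrow> schreier \<xi> (insert n F)"
proof (induction \<xi> rule: omega1_induct)
  case zero
  then show ?case by (metis not_le zero_le_omega1)
next
  case (succ \<zeta>)
  show ?case
  proof (cases "\<eta> = \<zeta>")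
    case True
    have "schreier (osucc \<zeta>) (insert n F)" if n: "n \<ge> 2" and F: "schreier \<zeta> F" "F \<subseteq> {n<..}" for n F
    proof -
      have "blocks \<zeta> (Suc (Suc 0)) ({n} \<union> (F \<union> {}))"
        by (intro blocks_Suc schreier_singleton F(1) blocks_zero) (use n F(2) in auto)
      then have "blocks \<zeta> 2 (insert n F)" by (simp add: numeral_2_eq_2)
      then show ?thesis by (rule schreier_osucc) (use n F(2) in auto)
    qed
    then show ?thesis using True by blast
  next
    case False
    then have "\<eta> < \<zeta>" using succ.prems by (metis osucc_le_iff not_le order.not_eq_order_implies_strict)
    then obtain n0 where n0: "\<And>n F. n \<ge> n0 \<Longrightarrow> schreier \<eta> F \<Longrightarrow> F \<subseteq> {n<..} \<Longrightarrow> schreier \<zeta> (insert n F)"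
      using succ.IH by blast
    have "schreier (osucc \<zeta>) (insert n F)"
      if n: "n \<ge> Suc n0" and F: "schreier \<eta> F" "F \<subseteq> {n<..}" for n F
    proof -
      have "schreier \<zeta> (insert n F)" using n0[OF _ F] n by simp
      then have "blocks \<zeta> (Suc 0) (insert n F \<union> {})" by (rule blocks_Suc[OF _ blocks_zero]) simp
      then show ?thesis by (intro schreier_osucc[of \<zeta> "Suc 0"]) (use n F(2) in auto)
    qed
    then show ?thesis by blast
  qed
next
  case (limit \<xi>)
  obtain m where m: "m \<ge> 1" "\<eta> < \<phi> \<xi> m"
    using limit_sequence_eventually[OF limit.hyps limit.prems] less_osucc by (metis le_less_trans order.refl)
  obtain n0 where n0: "\<And>n F. n \<ge> n0 \<Longrightarrow> schreier \<eta> F \<Longrightarrow> F \<subseteq> {n<..} \<Longrightarrow> schreier (\<phi> \<xi> m) (insert n F)"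
    using limit.IH[OF limit_sequences_less[OF limit_sequences limit.hyps m(1)] m(2)] by blast
  have "schreier \<xi> (insert n F)" if n: "n \<ge> max n0 m" and F: "schreier \<eta> F" "F \<subseteq> {n<..}" for n F
    by (rule schreier_limit[OF limit.hyps m(1) n0[OF _ F]]) (use n F(2) in auto)
  then show ?case by blast
qed

text \<open>The third premise lets every Schreier set of order \<xi> beyond \<open>k\<close> be
  appended to \<open>ns\<close>. Appending a single point by \<open>schreier_insert\<close> lowers
  \<xi> to any prescribed \<open>\<eta> < \<xi>\<close>, which is one step of the rank. The case of
  interest is \<open>ns = []\<close> with \<xi> equal to \<xi>0.\<close>

lemma rank_ge_schreier:
  assumes T: "\<And>ns. distinct ns \<Longrightarrow> schreier \<xi>0 (set ns) \<Longrightarrow> T (map z ns)"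
  shows "\<lbrakk>distinct ns; set ns \<subseteq> {..<k}; \<And>F. schreier \<xi> F \<Longrightarrow> F \<subseteq> {k..} \<Longrightarrow> schreier \<xi>0 (set ns \<union> F)\<rbrakk>
    \<Longrightarrow> rank_ge T \<xi> (map z ns)"
proof (induction \<xi> arbitrary: ns k rule: less_induct)
  case (less \<xi>)
  have "schreier \<xi> {}" using schreier_subset[OF schreier_singleton[of 1 \<xi>]] by simp
  then have "schreier \<xi>0 (set ns)" using less.prems(3)[of "{}"] by simp
  then have "T (map z ns)" using T less.prems(1) by blast
  moreover have "\<exists>d. rank_ge T \<eta> (map z ns @ [d])" if \<eta>: "\<eta> < \<xi>" for \<eta>
  proof -
    obtain n0 where n0: "\<And>n F. n \<ge> n0 \<Longrightarrow> schreier \<eta> F \<Longrightarrow> F \<subseteq> {n<..} \<Longrightarrow> schreier \<xi> (insert n F)"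
      using schreier_insert[OF \<eta>] by blast
    define n where "n = max n0 k"
    have "rank_ge T \<eta> (map z (ns @ [n]))"
    proof (rule less.IH[OF \<eta>, where k = "Suc n"])
      show "distinct (ns @ [n])" using less.prems(1,2) by (auto simp: n_def)
      show "set (ns @ [n]) \<subseteq> {..<Suc n}" using less.prems(2) by (auto simp: n_def)
      fix F assume F: "schreier \<eta> F" "F \<subseteq> {Suc n..}"
      then have "schreier \<xi> (insert n F)" by (intro n0) (auto simp: n_def Suc_le_eq)
      then have "schreier \<xi>0 (set ns \<union> insert n F)" using F(2) by (intro less.prems(3)) (auto simp: n_def)
      then show "schreier \<xi>0 (set (ns @ [n]) \<union> F)" by simp
    qed
    then show ?thesis by auto
  qed
  ultimately show ?case unfolding rank_ge.simps[of T \<xi>] by blast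
qed

lemma schreier_l1:
  assumes bad: "\<not> weak_Banach_Saks \<phi> \<xi> TYPE('a::banach)"
  shows "\<exists>(z :: nat \<Rightarrow> 'a) c C. c > 0 \<and> (\<forall>n. norm (z n) \<le> C) \<and>
    (\<forall>F a. schreier \<xi> F \<longrightarrow> c * (\<Sum>i\<in>F. \<bar>a i\<bar>) \<le> norm (\<Sum>i\<in>F. a i *\<^sub>R z i))"
proof -
  obtain y :: "nat \<Rightarrow> 'a" and \<delta> where y: "weakly_null y" and \<delta>: "\<delta> > 0"
    and upper: "\<And>F. schreier \<xi> F \<Longrightarrow> F \<in> upper_sets \<delta> y"
    using schreier_upper_sets[OF bad order.refl] by blast
  obtain C where C: "\<And>n. norm (y n) \<le> C" using weakly_null_bounded[OF y] by blast
  obtain N where N: "infinite N" "\<And>H E. finite H \<Longrightarrow> finite E \<Longrightarrow> H \<subseteq> N \<Longrightarrow> E \<subseteq> N \<Longrightarrow>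
      H \<in> upper_sets \<delta> y \<Longrightarrow> separated \<delta> y H (E - H)"
    using weakly_null_unconditional[OF y \<delta>] by blast
  define \<mu> where "\<mu> = enumerate N"
  have \<mu>: "strict_mono \<mu>" "\<And>i. \<mu> i \<in> N"
    unfolding \<mu>_def using strict_mono_enumerate[OF N(1)] enumerate_in_set[OF N(1)] by auto
  have inj: "inj_on \<mu> F" for F using strict_mono_imp_inj_on[OF \<mu>(1)] inj_on_subset by blast
  have "\<delta> / 4 * (\<Sum>i\<in>F. \<bar>a i\<bar>) \<le> norm (\<Sum>i\<in>F. a i *\<^sub>R y (\<mu> i))" if F: "schreier \<xi> F" for F a
  proof -
    have fin: "finite F" by (rule schreier_finite[OF F])
    \<comment> \<open>Closure under spreading carries the Schreier condition over to the
      subsequence.\<close>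
    have "schreier \<xi> (\<mu> ` F)"
      using \<mu>(1) by (intro schreier_spread[OF F] strict_mono_imp_increasing)
        (auto simp: strict_mono_on_def strict_mono_def)
    then have "\<mu> ` F \<in> upper_sets \<delta> y" by (rule upper)
    then have "separated \<delta> y G (\<mu> ` F - G)" if "G \<subseteq> \<mu> ` F" for G
      using that \<mu>(2) fin hereditary_upper_sets[of \<delta> y] unfolding hereditary_def
      by (intro N(2)) (auto intro: finite_subset)
    from l1_lower_bound[OF _ \<delta> this, of "a \<circ> the_inv_into F \<mu>"] fin
    show ?thesis by (simp add: sum.reindex[OF inj] the_inv_into_f_f[OF inj])
  qed
  then show ?thesis using \<delta> C by (intro exI[of _ "y \<circ> \<mu>"] exI[of _ "\<delta> / 4"] exI[of _ C]) auto
qed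

lemma rank_ge_l1_list:
  assumes bad: "\<not> weak_Banach_Saks \<phi> \<xi> TYPE('a::banach)" and D: "closure D = (UNIV :: 'a set)"
  shows "\<exists>p::nat. rank_ge (l1_list D (real p)) \<xi> []"
proof -
  obtain z :: "nat \<Rightarrow> 'a" and c C where c: "c > 0" and C: "\<And>n. norm (z n) \<le> C"
    and l1: "\<And>F a. schreier \<xi> F \<Longrightarrow> c * (\<Sum>i\<in>F. \<bar>a i\<bar>) \<le> norm (\<Sum>i\<in>F. a i *\<^sub>R z i)"
    using schreier_l1[OF bad] by blast
  have "\<exists>d\<in>D. dist d (z n) < c / 2" for n
    using D c closure_approachable[of "z n" D] half_gt_zero[OF c] by blast
  then obtain d where d: "\<And>n. d n \<in> D" "\<And>n. dist (d n) (z n) < c / 2" by metis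
  \<comment> \<open>Moving each vector by less than \<open>c / 2\<close> halves the lower constant,
    whence \<open>2 / c\<close>, and raises the norm bound to \<open>C + c / 2\<close>.\<close>
  obtain p :: nat where p: "max (C + c / 2) (2 / c) < real p" using reals_Archimedean2 by blast
  have norm_d: "norm (d n) \<le> real p" for n
    using norm_triangle_sub[of "d n" "z n"] C[of n] d(2)[of n] p by (simp add: dist_norm)
  have lower: "(\<Sum>i\<in>F. \<bar>a i\<bar>) \<le> real p * norm (\<Sum>i\<in>F. a i *\<^sub>R d i)" if F: "schreier \<xi> F" for F a
  proof -
    have "norm ((\<Sum>i\<in>F. a i *\<^sub>R z i) - (\<Sum>i\<in>F. a i *\<^sub>R d i)) \<le> (\<Sum>i\<in>F. norm (a i *\<^sub>R (z i - d i)))"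
      unfolding sum_subtractf[symmetric] scaleR_diff_right[symmetric] by (rule norm_sum)
    also have "\<dots> \<le> (\<Sum>i\<in>F. \<bar>a i\<bar> * (c / 2))"
    proof (rule sum_mono)
      fix i
      have "norm (z i - d i) \<le> c / 2" using d(2)[of i] by (simp add: dist_norm norm_minus_commute)
      then show "norm (a i *\<^sub>R (z i - d i)) \<le> \<bar>a i\<bar> * (c / 2)"
        unfolding norm_scaleR by (rule mult_left_mono) simp
    qed
    also have "\<dots> = c / 2 * (\<Sum>i\<in>F. \<bar>a i\<bar>)" by (simp only: sum_distrib_right[symmetric] mult.commute)
    finally have "c / 2 * (\<Sum>i\<in>F. \<bar>a i\<bar>) \<le> norm (\<Sum>i\<in>F. a i *\<^sub>R d i)"
      using l1[OF F, of a] norm_triangle_ineq2[of "\<Sum>i\<in>F. a i *\<^sub>R z i" "\<Sum>i\<in>F. a i *\<^sub>R d i"] by simp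
    then have "(\<Sum>i\<in>F. \<bar>a i\<bar>) \<le> 2 / c * norm (\<Sum>i\<in>F. a i *\<^sub>R d i)" using c by (simp add: field_simps)
    also have "\<dots> \<le> real p * norm (\<Sum>i\<in>F. a i *\<^sub>R d i)" using p by (intro mult_right_mono) auto
    finally show ?thesis .
  qed
  have "l1_list D (real p) (map d ns)" if ns: "distinct ns" "schreier \<xi> (set ns)" for ns
    unfolding l1_list_def
  proof (intro conjI allI)
    fix a :: "nat \<Rightarrow> real"
    have bij: "bij_betw ((!) ns) {..<length ns} (set ns)" by (rule bij_betw_nth[OF ns(1)]) auto
    define b where "b = a \<circ> the_inv_into {..<length ns} ((!) ns)"
    have b: "b (ns ! i) = a i" if "i < length ns" for i
      using that bij by (simp add: b_def bij_betw_def the_inv_into_f_f)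
    have "(\<Sum>i<length ns. \<bar>a i\<bar>) = (\<Sum>n\<in>set ns. \<bar>b n\<bar>)"
      using b by (subst sum.reindex_bij_betw[OF bij, symmetric]) simp
    moreover have "(\<Sum>i<length ns. a i *\<^sub>R d (ns ! i)) = (\<Sum>n\<in>set ns. b n *\<^sub>R d n)"
      using b by (subst sum.reindex_bij_betw[OF bij, symmetric]) simp
    ultimately show "(\<Sum>i<length (map d ns). \<bar>a i\<bar>) \<le>
        real p * norm (\<Sum>i<length (map d ns). a i *\<^sub>R map d ns ! i)"
      using lower[OF ns(2), of b] by simp
  qed (use d(1) norm_d in auto)
  then have "rank_ge (l1_list D (real p)) \<xi> (map d [])"
    by (rule rank_ge_schreier[where k = 0]) auto
  then show ?thesis by auto
qed

lemma ex_weak_Banach_Saks: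
  assumes sep: "separable_space (euclidean :: ('a :: banach) topology)"
    and not: "\<not> contains_l1 TYPE('a)"
  shows "\<exists>\<xi>. weak_Banach_Saks \<phi> \<xi> TYPE('a)"
proof (rule ccontr)
  assume bad: "\<not> ?thesis"
  obtain D :: "'a set" where D: "countable D" "closure D = UNIV"
    using sep unfolding separable_space_def by (auto simp: euclidean_closure_of)
  \<comment> \<open>If every \<open>p\<close> failed at some ordinal, a common bound \<gamma> of
    these countably many ordinals would contradict the existence of a suitable \<open>p\<close> for
    \<gamma>.\<close>
  have "\<exists>p::nat. \<forall>\<xi>. rank_ge (l1_list D (real p)) \<xi> []"
  proof (rule ccontr)
    assume "\<not> ?thesis"
    then obtain \<alpha> where \<alpha>: "\<And>p::nat. \<not> rank_ge (l1_list D (real p)) (\<alpha> p) []" by metis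
    obtain \<gamma> where \<gamma>: "\<And>p. \<alpha> p \<le> \<gamma>" using countable_bounded_omega1[of "range \<alpha>"] by auto
    obtain p :: nat where "rank_ge (l1_list D (real p)) \<gamma> []" using rank_ge_l1_list[OF _ D(2)] bad by blast
    then show False using rank_ge_antimono \<gamma> \<alpha> by blast
  qed
  then obtain p :: nat where p: "\<And>\<xi>. rank_ge (l1_list D (real p)) \<xi> []" by blast
  have "\<exists>ds. \<forall>n. l1_list D (real p) (map ds [0..<n])"
    by (rule infinite_branch[OF D(1) _ p]) (simp add: l1_list_def)
  then show False using contains_l1_if_branch not by blast
qed

end

section \<open>The Banach--Saks index\<close>

theorem corollary2p4p16:
  fixes \<phi> :: "omega1 \<Rightarrow> nat \<Rightarrow> omega1"
  assumes "limit_sequences \<phi>"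
    and "separable_space (euclidean :: ('a :: banach) topology)"
    and "\<not> contains_l1 TYPE('a)"
  shows "\<exists>!\<xi>. (\<forall>\<zeta>\<ge>\<xi>. weak_Banach_Saks \<phi> \<zeta> TYPE('a)) \<and>
              (\<forall>\<zeta><\<xi>. \<not> weak_Banach_Saks \<phi> \<zeta> TYPE('a))"
proof -
  interpret repeated_averages \<phi> by standard (rule assms(1))
  obtain \<xi>0 where "weak_Banach_Saks \<phi> \<xi>0 TYPE('a)" using ex_weak_Banach_Saks[OF assms(2,3)] by blast
  then have least: "weak_Banach_Saks \<phi> (LEAST \<xi>. weak_Banach_Saks \<phi> \<xi> TYPE('a)) TYPE('a)" by (rule LeastI)
  show ?thesis
  proof (rule ex1I)
    show "(\<forall>\<zeta>\<ge>LEAST \<xi>. weak_Banach_Saks \<phi> \<xi> TYPE('a). weak_Banach_Saks \<phi> \<zeta> TYPE('a)) \<and>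
        (\<forall>\<zeta><LEAST \<xi>. weak_Banach_Saks \<phi> \<xi> TYPE('a). \<not> weak_Banach_Saks \<phi> \<zeta> TYPE('a))"
      using weak_Banach_Saks_mono[OF least] not_less_Least by blast
    fix \<xi>
    assume "(\<forall>\<zeta>\<ge>\<xi>. weak_Banach_Saks \<phi> \<zeta> TYPE('a)) \<and> (\<forall>\<zeta><\<xi>. \<not> weak_Banach_Saks \<phi> \<zeta> TYPE('a))"
    then show "\<xi> = (LEAST \<xi>. weak_Banach_Saks \<phi> \<xi> TYPE('a))"
      using Least_equality[of "\<lambda>\<xi>. weak_Banach_Saks \<phi> \<xi> TYPE('a)" \<xi>] by (metis not_less order.refl)
  qed
qed

end
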